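(* Let $d,m\ge 1$ be integers, $n=d+m$, let $A\in\mathbb{R}^{(d+1)\times m}$ and let $\mathcal{L}=\{(\bm{x},\widetilde{\bm{x}}A)\mid \bm{x}\in\mathbb{R}^d\}\subset\mathbb{R}^n$, where $\widetilde{\bm{x}}=(1,\bm{x})$. Suppose that $\omega(A)\neq n$. Then $$\mathcal{L}\text{ is of Khintchine type}\iff\omega(A)<n.$$
   Context: Vectors are row vectors; $|\cdot|$ is the supremum norm; $\|\bm{y}\|$ is the sup-norm distance of $\bm{y}$ to the nearest integer vector (also for column vectors). "Decreasing" means non-increasing. The diophantine exponent $\omega(A)$ of a real matrix $A$ with $m$ columns is the supremum (possibly $\infty$) of all $\omega\in\mathbb{R}$ such that $\|A\bm{q}^{\mathrm T}\|<|\bm{q}|^{-\omega}$ holds for infinitely many $\bm{q}\in\mathbb{Z}^m$. An approximation function is a function $\psi:\mathbb{N}\to\mathbb{R}_{\ge0}$; let $\mathcal{S}_n(\psi)=\{\bm{y}\in\mathbb{R}^n:\|q\bm{y}\|<\psi(q)\text{ for infinitely many }q\in\mathbb{N}\}$. A submanifold $\mathcal{M}$ of $\mathbb{R}^n$ is of Khintchine type if for any decreasing approximation function $\psi$: the set $\mathcal{S}_n(\psi)\cap\mathcal{M}$ is null with respect to the induced Lebesgue measure on $\mathcal{M}$ when $\sum_{q}\psi(q)^n<\infty$, and its complement in $\mathcal{M}$ is null when $\sum_q\psi(q)^n=\infty$. *)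

theory Defs
  imports "HOL-Analysis.Analysis"
begin

section \<open>Integer vectors and the diophantine exponent\<close>

definition int_vectors :: "(real^'n) set" where
  "int_vectors = {v. \<forall>i. v $ i \<in> \<int>}"

definition int_dist :: "real^'n \<Rightarrow> real" where
  "int_dist y = (INF p\<in>int_vectors. infnorm (y - p))"

text \<open>
  The convention \<open>0 powr a = 0\<close> is harmless below: it concerns the single vector \<open>q = 0\<close>.
\<close>

definition dioph_exponent :: "real^'m^'r \<Rightarrow> ereal" where
  "dioph_exponent A =
     Sup {ereal w | w :: real.
       infinite {q \<in> int_vectors. int_dist (A *v q) < infnorm q powr (- w)}}"

section \<open>Submanifolds and the induced Lebesgue measure\<close>

text \<open>
  Local \<open>C\<^sup>1\<close> parametrizations of a (\<open>CARD('k)\<close>-dimensional, embedded) submanifold \<open>M\<close>: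
  immersions of an open set that are homeomorphisms onto a relatively open part of \<open>M\<close>.
\<close>

definition local_parametrization ::
    "(real^'k) set \<Rightarrow> (real^'k \<Rightarrow> real^'n) \<Rightarrow> (real^'n) set \<Rightarrow> bool" where
  "local_parametrization U f M \<longleftrightarrow>
     open U \<and>
     (\<exists>f' :: real^'k \<Rightarrow> (real^'k) \<Rightarrow>\<^sub>L (real^'n).
        continuous_on U f' \<and>
        (\<forall>u\<in>U. (f has_derivative blinfun_apply (f' u)) (at u) \<and> inj (blinfun_apply (f' u)))) \<and>
     openin (top_of_set M) (f ` U) \<and>
     (\<exists>g. homeomorphism U (f ` U) f g)"

definition submanifold :: "'k::finite itself \<Rightarrow> (real^'n) set \<Rightarrow> bool" where
  "submanifold _ M \<longleftrightarrow>
     (\<forall>p\<in>M. \<exists>(U :: (real^'k) set) f. local_parametrization U f M \<and> p \<in> f ` U)"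

text \<open>
  The induced Lebesgue (Riemannian volume) measure, read in the coordinates of a local
  parametrization \<open>f\<close> with Jacobian matrix \<open>J\<close>, has density \<open>sqrt (det (J\<^sup>T J))\<close> with respect
  to Lebesgue measure on \<open>U\<close>.
\<close>

definition coordinate_volume ::
    "(real^'k) set \<Rightarrow> (real^'k \<Rightarrow> real^'n) \<Rightarrow> (real^'k) measure" where
  "coordinate_volume U f =
     density (lebesgue_on U)
       (\<lambda>u. let J = matrix (frechet_derivative f (at u))
             in ennreal (sqrt (det (transpose J ** J))))"

text \<open>
  Countably many parametrized pieces cover a submanifold, so a subset is null for the induced
  measure iff it is null in each of them.
\<close>

definition null_in :: "'k::finite itself \<Rightarrow> (real^'n) set \<Rightarrow> (real^'n) set \<Rightarrow> bool" where
  "null_in _ M E \<longleftrightarrow>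
     (\<forall>(U :: (real^'k) set) f. local_parametrization U f M \<longrightarrow>
        {u \<in> U. f u \<in> E} \<in> null_sets (coordinate_volume U f))"

section \<open>Khintchine type\<close>

text \<open>
  Approximation functions are defined on the positive integers; the value at \<open>0\<close> is never used.
\<close>

definition approx_function :: "(nat \<Rightarrow> real) \<Rightarrow> bool" where
  "approx_function \<psi> \<longleftrightarrow> (\<forall>q\<ge>1. 0 \<le> \<psi> q)"

definition psi_approximable :: "(nat \<Rightarrow> real) \<Rightarrow> (real^'n) set" where
  "psi_approximable \<psi> = {y. infinite {q. q \<ge> 1 \<and> int_dist (real q *\<^sub>R y) < \<psi> q}}"

definition khintchine_type :: "'k::finite itself \<Rightarrow> (real^'n) set \<Rightarrow> bool" where
  "khintchine_type K M \<longleftrightarrow>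
     submanifold K M \<and>
     (\<forall>\<psi>. approx_function \<psi> \<and> antimono_on {1..} \<psi> \<longrightarrow>
        (summable (\<lambda>q. \<psi> (Suc q) ^ CARD('n)) \<longrightarrow> null_in K M (psi_approximable \<psi> \<inter> M)) \<and>
        (\<not> summable (\<lambda>q. \<psi> (Suc q) ^ CARD('n)) \<longrightarrow> null_in K M (M - psi_approximable \<psi>)))"

section \<open>Affine subspaces\<close>

text \<open>
  \<open>\<real>\<^sup>d\<^sup>+\<^sup>1\<close> is indexed by \<open>'d option\<close>, with \<open>None\<close> the leading coordinate, and
  \<open>\<real>\<^sup>d\<^sup>+\<^sup>m\<close> by \<open>'d + 'm\<close>.
\<close>

definition tilde :: "real^'d::finite \<Rightarrow> real^('d option)" where
  "tilde x = (\<chi> i. case i of None \<Rightarrow> 1 | Some j \<Rightarrow> x $ j)"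

definition join_vec :: "real^'d \<Rightarrow> real^'m \<Rightarrow> real^('d + 'm)" where
  "join_vec x y = (\<chi> i. case i of Inl j \<Rightarrow> x $ j | Inr k \<Rightarrow> y $ k)"

definition affine_graph :: "real^'m^('d::finite option) \<Rightarrow> (real^('d + 'm)) set" where
  "affine_graph A = {join_vec x (tilde x v* A) | x. True}"

end

theory Submission
  imports Defs
begin

text \<open>
  Write \<open>n = d + m\<close> and \<open>L\<close> for the affine subspace, parametrized by \<open>x \<mapsto> (x, (1,x)A)\<close>. If
  \<open>b = (q,a)\<close> is an integer vector, the point of \<open>L\<close> above \<open>a/q\<close> is within \<open>\<alpha>/q\<close> of a rational
  point with denominator \<open>q\<close> precisely when \<open>bA\<close> is within \<open>\<alpha>\<close> of an integer vector. So the
  whole problem is about integer vectors \<open>b\<close> with \<open>int_dist (bA)\<close> small.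

  Suppose that \<open>\<omega>(A) < n\<close>. Then \<open>int_dist (Aj)\<close> is at least a constant times \<open>\<bar>j\<bar>\<close> to the power
  \<open>-w\<close>, for all integer vectors \<open>j \<noteq> 0\<close> and some \<open>w < n\<close>: the points \<open>Aj\<close> with
  \<open>\<bar>j\<bar> \<le> J\<close> are well separated on the torus of dimension \<open>d + 1\<close>. If \<open>B\<close> is a set of vectors \<open>b\<close> of size at most \<open>L\<close> with
  \<open>int_dist (bA) < \<alpha>\<close>, then the exponential sum over \<open>B\<close> is as large as \<open>card B / 2\<close> near each
  \<open>Aj\<close> with \<open>J\<close> about \<open>1/\<alpha>\<close>, and Parseval's identity gives \<open>card B = O(\<alpha>\<^sup>m L\<^sup>d\<^sup>+\<^sup>1)\<close>, the number that
  a random model predicts (\<open>kernel_count_bound\<close>). This is the dual large sieve inequality, in the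
  only case that is required. It holds as soon as \<open>\<alpha>\<close> is not smaller than \<open>L\<close> to the power
  \<open>-1/w\<close>, and since \<open>1/w > 1/n\<close>, an approximation function may be enlarged to that size without
  changing the convergence of its \<open>n\<close>-th powers.

  Convergence (\<open>khintchine_convergence\<close>): sum the bound over dyadic ranges of \<open>q\<close> and apply the
  Borel-Cantelli lemma.

  Divergence (\<open>khintchine_divergence\<close>): by the pigeonhole principle every \<open>x\<close> has a vector
  \<open>b = (q,a)\<close> with \<open>1 \<le> q \<le> 2\<^sup>t\<close>, \<open>a/q\<close> close to \<open>x\<close> and \<open>int_dist (bA) < \<alpha>\<close>; the counting bound shows
  that \<open>q\<close> is of order \<open>2\<^sup>t\<close> for most \<open>x\<close>. Hence the centers \<open>a/q\<close> contain a well spaced set of the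
  largest possible order in every fixed cube (\<open>local_ubiquity\<close>). The approximable sets around
  these centers are pairwise quasi-independent along the levels \<open>t\<close> at which \<open>2\<^sup>t \<psi>(2\<^sup>t)\<^sup>m\<close>
  is maximal so far, and the sum still diverges along those levels
  (\<open>records_not_summable\<close>). A second moment argument
  (\<open>measure_UN_separated_family_ge\<close>) gives a fixed proportion of every cube, and a covering argument
  (\<open>negligible_if_uniformly_dense\<close>) turns this into full measure.

  Suppose that \<open>\<omega>(A) > n\<close>. Then \<open>L\<close> is extremely close to infinitely many rational hyperplanes. The
  multiples of a point of \<open>L\<close> stay close to a union of parallel hyperplanes on the torus, so the pigeonhole
  principle is more effective than in general position and every point of \<open>L\<close> is approximable
  with exponent larger than \<open>1/n\<close> (\<open>approximable_if_large_exponent\<close>). This contradicts the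
  convergence half of the Khintchine property.
\<close>

section \<open>Sup norm, distance to the integers and the diophantine exponent\<close>

lemma infnorm_cart_le_iff: "infnorm (x::real^'n) \<le> r \<longleftrightarrow> (\<forall>i. \<bar>x $ i\<bar> \<le> r)"
proof
  assume "infnorm x \<le> r"
  then show "\<forall>i. \<bar>x $ i\<bar> \<le> r"
    using component_le_infnorm_cart order_trans by blast
next
  assume "\<forall>i. \<bar>x $ i\<bar> \<le> r"
  then show "infnorm x \<le> r"
    unfolding infnorm_cart by (intro cSup_least) auto
qed

lemma infnorm_cart_less_iff: "infnorm (x::real^'n::finite) < r \<longleftrightarrow> (\<forall>i. \<bar>x $ i\<bar> < r)"
proof
  assume "infnorm x < r"
  then show "\<forall>i. \<bar>x $ i\<bar> < r"
    using component_le_infnorm_cart le_less_trans by blast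
next
  assume *: "\<forall>i. \<bar>x $ i\<bar> < r"
  have "finite (range (\<lambda>i. \<bar>x $ i\<bar>))" by simp
  then have "Max (range (\<lambda>i. \<bar>x $ i\<bar>)) < r"
    using * by (subst Max_less_iff) auto
  moreover have "infnorm x \<le> Max (range (\<lambda>i. \<bar>x $ i\<bar>))"
    by (subst infnorm_cart_le_iff) auto
  ultimately show "infnorm x < r" by linarith
qed

definition ivec :: "('n::finite \<Rightarrow> int) \<Rightarrow> real^'n" where
  "ivec b = (\<chi> i. of_int (b i))"

lemma ivec_nth [simp]: "ivec b $ i = of_int (b i)"
  by (simp add: ivec_def)

lemma ivec_diff: "ivec b - ivec c = ivec (\<lambda>i. b i - c i)"
  by (simp add: vec_eq_iff)

lemma int_vectors_eq_range_ivec: "int_vectors = range ivec"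
proof -
  have "v \<in> range ivec" if "\<forall>i. v $ i \<in> \<int>" for v :: "real^'n"
  proof -
    have "v = ivec (\<lambda>i. \<lfloor>v $ i\<rfloor>)" using that by (simp add: vec_eq_iff)
    then show ?thesis by blast
  qed
  then show ?thesis by (auto simp: int_vectors_def)
qed

lemma int_dist_bdd_below: "bdd_below ((\<lambda>p. infnorm (y - p)) ` int_vectors)"
  by (rule bdd_belowI2[of _ 0]) (simp add: infnorm_pos_le)

lemma int_dist_less_iff: "int_dist (y::real^'n::finite) < r \<longleftrightarrow> (\<exists>p. \<forall>i. \<bar>y $ i - of_int (p i)\<bar> < r)"
proof -
  have "int_dist y < r \<longleftrightarrow> (\<exists>p\<in>int_vectors. infnorm (y - p) < r)"
    unfolding int_dist_def
    by (rule cINF_less_iff) (use int_dist_bdd_below in \<open>auto simp: int_vectors_eq_range_ivec\<close>)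
  then show ?thesis
    by (simp add: int_vectors_eq_range_ivec infnorm_cart_less_iff)
qed

lemma int_dist_leI: "(\<And>i. \<bar>y $ i - of_int (p i)\<bar> \<le> r) \<Longrightarrow> int_dist (y::real^'n::finite) \<le> r"
  by (rule dense_ge) (metis int_dist_less_iff le_less_trans less_imp_le)

lemma int_dist_nonneg: "0 \<le> int_dist y"
  unfolding int_dist_def
  by (rule cINF_greatest) (auto simp: infnorm_pos_le int_vectors_eq_range_ivec)

text \<open>
  Distance zero is inherited by multiples: one exact relation produces infinitely many.
\<close>
lemma int_dist_scale_zero:
  assumes "int_dist (y::real^'n::finite) = 0"
  shows "int_dist (of_nat k *\<^sub>R y) = 0"
proof -
  have "int_dist (of_nat k *\<^sub>R y) \<le> e" if "e > 0" for e
  proof -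
    have "int_dist y < e / (k + 1)" using assms that by simp
    then obtain p where p: "\<And>i. \<bar>y $ i - of_int (p i)\<bar> < e / (k + 1)"
      unfolding int_dist_less_iff by blast
    have "\<bar>(of_nat k *\<^sub>R y) $ i - of_int (int k * p i)\<bar> \<le> e" for i
    proof -
      have "\<bar>(of_nat k *\<^sub>R y) $ i - of_int (int k * p i)\<bar> = k * \<bar>y $ i - of_int (p i)\<bar>"
        by (simp add: abs_mult flip: right_diff_distrib)
      also have "\<dots> \<le> k * (e / (k + 1))" using p[of i] by (intro mult_left_mono) auto
      also have "\<dots> \<le> e" using that by (simp add: field_simps)
      finally show ?thesis .
    qed
    then show ?thesis by (rule int_dist_leI)
  qed
  then have "int_dist (of_nat k *\<^sub>R y) \<le> 0" by (rule field_le_epsilon[of _ 0, simplified])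
  then show ?thesis using int_dist_nonneg[of "of_nat k *\<^sub>R y"] by simp
qed

lemma infnorm_ivec_ge_1:
  assumes "b \<noteq> (\<lambda>_. 0)"
  shows "1 \<le> infnorm (ivec b)"
proof -
  obtain i where "b i \<noteq> 0" using assms by auto
  then have "1 \<le> \<bar>ivec b $ i\<bar>" by simp
  then show ?thesis using component_le_infnorm_cart order_trans by blast
qed

lemma ivec_eq_0_iff: "ivec b = 0 \<longleftrightarrow> b = (\<lambda>_. 0)"
  by (auto simp: vec_eq_iff)

lemma finite_bounded_int_functions: "finite {b::'n::finite \<Rightarrow> int. \<forall>i. \<bar>real_of_int (b i) - z i\<bar> \<le> L}"
proof (rule finite_subset)
  show "{b. \<forall>i. \<bar>real_of_int (b i) - z i\<bar> \<le> L} \<subseteq> PiE UNIV (\<lambda>i. {\<lfloor>z i - L\<rfloor>..\<lceil>z i + L\<rceil>})"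
  proof safe
    fix b :: "'n \<Rightarrow> int" and i assume *: "\<forall>i. \<bar>real_of_int (b i) - z i\<bar> \<le> L"
    have "\<bar>real_of_int (b i) - z i\<bar> \<le> L" using * by blast
    then show "b i \<in> {\<lfloor>z i - L\<rfloor>..\<lceil>z i + L\<rceil>}" by (simp add: floor_le_iff le_ceiling_iff) linarith
  qed auto
  show "finite (PiE UNIV (\<lambda>i::'n. {\<lfloor>z i - L\<rfloor>..\<lceil>z i + L\<rceil>}))"
    by (intro finite_PiE) auto
qed

lemma infinite_bounded_int_functions:
  assumes "infinite S" "S \<subseteq> int_vectors"
  shows "\<exists>v\<in>S. R < infnorm (v::real^'n::finite)"
proof (rule ccontr)
  assume "\<not> (\<exists>v\<in>S. R < infnorm v)"
  then have "S \<subseteq> ivec ` {b::'n\<Rightarrow>int. \<forall>i. \<bar>real_of_int (b i) - 0\<bar> \<le> R}"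
    using assms(2) by (force simp: int_vectors_eq_range_ivec infnorm_cart_le_iff not_less)
  then show False using assms(1) finite_bounded_int_functions[of "\<lambda>_. 0" R] finite_subset by blast
qed

text \<open>
  Applied to differences, this says that the points \<open>Aj\<close> are separated on the torus, with gaps that decrease at
  most like a power of the size of \<open>j\<close>.
\<close>
definition kernel_gap :: "real^'m::finite^'r::finite \<Rightarrow> real \<Rightarrow> real \<Rightarrow> bool" where
  "kernel_gap A c w \<longleftrightarrow> (\<forall>j. j \<noteq> (\<lambda>_. 0) \<longrightarrow> c * infnorm (ivec j) powr (- w) \<le> int_dist (A *v ivec j))"

text \<open>
  The definition of the exponent bounds \<open>int_dist (Aj)\<close> from below for all but finitely many \<open>j\<close>.
  For these finitely many it is still positive, since a single zero would
  give infinitely many zeros and hence an infinite exponent; so a smaller constant absorbs them.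
\<close>
lemma dioph_exponent_less_imp_kernel_gap:
  fixes A :: "real^'m::finite^'r::finite"
  assumes "dioph_exponent A < ereal n" "u < n"
  shows "\<exists>w c. u < w \<and> w < n \<and> 0 < c \<and> kernel_gap A c w"
proof -
  obtain w where w: "dioph_exponent A < ereal w" "u < w" "w < n"
  proof -
    have "max (dioph_exponent A) (ereal u) < ereal n" using assms by simp
    then obtain w where "max (dioph_exponent A) (ereal u) < ereal w" "ereal w < ereal n"
      using ereal_dense2 by blast
    then show ?thesis using that by auto
  qed
  define S where "S = {q \<in> int_vectors. int_dist (A *v q) < infnorm q powr (- w)}"
  have fin: "finite S"
  proof (rule ccontr)
    assume "infinite S"
    then have "ereal w \<le> dioph_exponent A"
      unfolding dioph_exponent_def S_def by (intro Sup_upper) auto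
    then show False using w by simp
  qed
  have pos: "0 < int_dist (A *v ivec j)" if "j \<noteq> (\<lambda>_. 0)" for j
  proof (rule ccontr)
    assume "\<not> ?thesis"
    then have z: "int_dist (A *v ivec j) = 0" using int_dist_nonneg[of "A *v ivec j"] by simp
    define g where "g k = real (Suc k) *\<^sub>R ivec j" for k
    have j0: "ivec j \<noteq> 0" using that by (simp add: ivec_eq_0_iff)
    have "inj g" by (rule injI) (use j0 in \<open>auto simp: g_def\<close>)
    moreover have "range g \<subseteq> S"
    proof safe
      fix k
      have "g k \<in> int_vectors"
        unfolding g_def int_vectors_def by (auto intro!: Ints_mult simp del: of_nat_Suc)
      moreover have "int_dist (A *v g k) = 0"
        using int_dist_scale_zero[OF z, of "Suc k"] by (simp add: g_def matrix_vector_mult_scaleR del: of_nat_Suc)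
      moreover have "0 < infnorm (g k)" using j0 by (simp add: infnorm_pos_lt g_def del: of_nat_Suc)
      ultimately show "g k \<in> S" by (simp add: S_def)
    qed
    ultimately show False using fin by (meson finite_subset infinite_UNIV_nat range_inj_infinite)
  qed
  define ratio where "ratio v = int_dist (A *v v) / infnorm v powr (- w)" for v
  define c where "c = Min (insert 1 (ratio ` (S - {0})))"
  have c_le: "c \<le> 1" "\<And>v. v \<in> S \<Longrightarrow> v \<noteq> 0 \<Longrightarrow> c \<le> ratio v"
    using fin by (auto simp: c_def)
  have "0 < ratio v" if "v \<in> S - {0}" for v
  proof -
    obtain j where "v = ivec j" using \<open>v \<in> S - {0}\<close> by (auto simp: S_def int_vectors_eq_range_ivec)
    then show ?thesis using that pos[of j] by (auto simp: ratio_def ivec_eq_0_iff infnorm_eq_0)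
  qed
  then have "0 < c" using fin by (simp add: c_def)
  moreover have "c * infnorm (ivec j) powr (- w) \<le> int_dist (A *v ivec j)" if "j \<noteq> (\<lambda>_. 0)" for j
  proof -
    have p: "0 < infnorm (ivec j) powr (- w)" using infnorm_ivec_ge_1[OF that] by simp
    show ?thesis
    proof (cases "ivec j \<in> S")
      case True
      then have "c \<le> ratio (ivec j)" using c_le(2) that by (simp add: ivec_eq_0_iff)
      then show ?thesis using p by (simp add: ratio_def field_simps)
    next
      case False
      then have "infnorm (ivec j) powr (- w) \<le> int_dist (A *v ivec j)"
        by (simp add: S_def int_vectors_eq_range_ivec)
      moreover have "c * infnorm (ivec j) powr (- w) \<le> infnorm (ivec j) powr (- w)"
        using c_le(1) p by simp
      ultimately show ?thesis by linarith
    qed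
  qed
  ultimately show ?thesis using w unfolding kernel_gap_def by blast
qed

section \<open>Counting integer vectors in an approximate kernel\<close>

lemma cis_sum: "finite I \<Longrightarrow> cis (\<Sum>i\<in>I. f i) = (\<Prod>i\<in>I. cis (f i))"
  by (induction I rule: finite_induct) (simp_all add: cis_mult[symmetric])

lemma sum_cis_roots_of_unity:
  assumes "0 < M"
  shows "(\<Sum>k<M. cis (2 * pi * (of_int d * real k / real M))) = (if int M dvd d then of_nat M else 0)"
proof -
  define w where "w = cis (2 * pi * (of_int d / real M))"
  have pw: "cis (2 * pi * (of_int d * real k / real M)) = w ^ k" for k
    unfolding w_def Complex.DeMoivre by (rule arg_cong[where f=cis]) simp
  show ?thesis
  proof (cases "int M dvd d")
    case True
    then obtain e where "d = int M * e" by blast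
    then have "w = cis (2 * pi * of_int e)" using assms by (simp add: w_def)
    also have "\<dots> = 1" by (simp add: cis_multiple_2pi)
    finally have "w = 1" .
    then show ?thesis unfolding pw using True by simp
  next
    case False
    have "w \<noteq> 1"
    proof
      assume "w = 1"
      then have "cos (2 * pi * (of_int d / real M)) = 1" by (simp add: w_def complex_eq_iff)
      then obtain e :: int where "2 * pi * (of_int d / real M) = of_int e * 2 * pi"
        using cos_one_2pi_int by blast
      then have "real_of_int d = of_int (int M * e)" using assms by (simp add: field_simps)
      then have "d = int M * e" using of_int_eq_iff by blast
      then show False using False by simp
    qed
    moreover have "w ^ M = 1"
    proof -
      have "w ^ M = cis (2 * pi * of_int d)" using assms by (simp add: w_def Complex.DeMoivre)
      then show ?thesis by (simp add: cis_multiple_2pi)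
    qed
    ultimately show ?thesis unfolding pw using False by (simp add: geometric_sum)
  qed
qed

text \<open>
  The exponential sum over \<open>B\<close> is sampled at the points with denominator \<open>M\<close> instead of being
  integrated over the torus, so that the identity is one of finite sums.
\<close>
lemma discrete_Parseval:
  fixes B :: "('r::finite \<Rightarrow> int) set"
  assumes "0 < M" "finite B"
    and inj: "\<And>b b'. b \<in> B \<Longrightarrow> b' \<in> B \<Longrightarrow> \<forall>i. int M dvd b i - b' i \<Longrightarrow> b = b'"
  shows "(\<Sum>k\<in>PiE UNIV (\<lambda>_. {..<M}). (cmod (\<Sum>b\<in>B. cis (2 * pi * (\<Sum>i\<in>UNIV. of_int (b i) * real (k i) / real M))))\<^sup>2)
         = real M ^ CARD('r) * real (card B)"
proof -
  let ?G = "PiE UNIV (\<lambda>_::'r. {..<M})"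
  let ?x = "\<lambda>b k. 2 * pi * (\<Sum>i\<in>UNIV. of_int (b i) * real (k i) / real M)"
  have orth: "(\<Sum>k\<in>?G. cis (?x b k) * cnj (cis (?x b' k))) = (if b = b' then of_nat (M ^ CARD('r)) else 0)"
    if "b \<in> B" "b' \<in> B" for b b'
  proof -
    have "cis (?x b k) * cnj (cis (?x b' k)) = (\<Prod>i\<in>UNIV. cis (2 * pi * (of_int (b i - b' i) * real (k i) / real M)))" for k
    proof -
      have "cis (?x b k) * cnj (cis (?x b' k)) = cis (?x b k - ?x b' k)"
        by (simp add: cis_cnj cis_mult)
      also have "?x b k - ?x b' k = (\<Sum>i\<in>UNIV. 2 * pi * (of_int (b i - b' i) * real (k i) / real M))"
        by (simp add: sum_distrib_left algebra_simps diff_divide_distrib flip: sum_subtractf)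
      finally show ?thesis by (simp add: cis_sum)
    qed
    then have "(\<Sum>k\<in>?G. cis (?x b k) * cnj (cis (?x b' k)))
        = (\<Sum>k\<in>?G. \<Prod>i\<in>UNIV. cis (2 * pi * (of_int (b i - b' i) * real (k i) / real M)))" by simp
    also have "\<dots> = (\<Prod>i\<in>UNIV. \<Sum>l<M. cis (2 * pi * (of_int (b i - b' i) * real l / real M)))"
      by (rule prod_sum_PiE[symmetric]) auto
    also have "\<dots> = (\<Prod>i\<in>UNIV. if int M dvd (b i - b' i) then of_nat M else 0)"
      using sum_cis_roots_of_unity[OF assms(1)] by (intro prod.cong refl) blast
    also have "\<dots> = (if b = b' then of_nat (M ^ CARD('r)) else 0)"
    proof (cases "b = b'")
      case False
      then obtain i where "\<not> int M dvd b i - b' i" using inj \<open>b \<in> B\<close> \<open>b' \<in> B\<close> by blast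
      then show ?thesis using False by (auto intro!: prod_zero)
    qed simp
    finally show ?thesis .
  qed
  have "complex_of_real (\<Sum>k\<in>?G. (cmod (\<Sum>b\<in>B. cis (?x b k)))\<^sup>2)
      = (\<Sum>k\<in>?G. \<Sum>b\<in>B. \<Sum>b'\<in>B. cis (?x b k) * cnj (cis (?x b' k)))"
    by (simp only: of_real_sum complex_norm_square cnj_sum sum_product)
  also have "\<dots> = (\<Sum>b\<in>B. \<Sum>k\<in>?G. \<Sum>b'\<in>B. cis (?x b k) * cnj (cis (?x b' k)))"
    by (rule sum.swap)
  also have "\<dots> = (\<Sum>b\<in>B. \<Sum>b'\<in>B. \<Sum>k\<in>?G. cis (?x b k) * cnj (cis (?x b' k)))"
    by (rule sum.cong[OF refl], rule sum.swap)
  also have "\<dots> = (\<Sum>b\<in>B. \<Sum>b'\<in>B. if b = b' then of_nat (M ^ CARD('r)) else 0)"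
    by (intro sum.cong refl orth)
  also have "\<dots> = complex_of_real (real M ^ CARD('r) * real (card B))"
    using assms(2) by (simp add: mult.commute)
  finally show ?thesis using of_real_eq_iff by blast
qed

lemma cos_ge_half_near_int:
  assumes "\<bar>x - of_int N\<bar> \<le> 1 / 6"
  shows "1 / 2 \<le> cos (2 * pi * x)"
proof -
  have "cos (2 * pi * x) = cos (2 * pi * (x - of_int N) + 2 * pi * of_int N)"
    by (simp add: algebra_simps)
  also have "\<dots> = cos (2 * pi * (x - of_int N))"
    by (simp only: cos_add) (simp add: sin_int_2pin cos_int_2pin)
  also have "\<dots> = cos \<bar>2 * pi * (x - of_int N)\<bar>" by simp
  also have "\<bar>2 * pi * (x - of_int N)\<bar> = 2 * pi * \<bar>x - of_int N\<bar>" by (simp add: abs_mult)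
  also have "cos (pi / 3) \<le> cos (2 * pi * \<bar>x - of_int N\<bar>)"
    using assms by (intro cos_monotone_0_pi_le) (simp_all add: field_simps)
  finally show ?thesis by (simp add: cos_60)
qed

text \<open>
  Let \<open>S\<close> be the exponential sum over \<open>B\<close>. For \<open>0 \<le> j \<le> J\<close> the product \<open>b \<cdot> (Aj) = (bA) \<cdot> j\<close> is close to
  an integer for every \<open>b\<close> in \<open>B\<close>, and stays so when \<open>Aj\<close> is rounded to
  denominator \<open>M\<close>; hence \<open>\<bar>S\<bar>\<close> is at least \<open>card B / 2\<close> at the rounded points. The
  separation hypothesis makes the \<open>(J + 1)\<^sup>m\<close> rounded points distinct, and Parseval's identity bounds
  how often \<open>S\<close> can be so large.
\<close>
lemma card_near_kernel_le:
  fixes A :: "real^'m::finite^'r::finite" and B :: "('r \<Rightarrow> int) set"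
  assumes M: "0 < M" "12 * real CARD('r) * L \<le> real M" and L: "0 \<le> L"
    and J: "12 * real CARD('m) * real J * \<delta> \<le> 1"
    and sep: "\<And>j. j \<noteq> (\<lambda>_. 0) \<Longrightarrow> (\<And>i. \<bar>j i\<bar> \<le> int J) \<Longrightarrow> 1 / real M \<le> int_dist (A *v ivec j)"
    and B: "finite B" "\<And>b i. b \<in> B \<Longrightarrow> \<bar>real_of_int (b i)\<bar> \<le> L"
           "\<And>b. b \<in> B \<Longrightarrow> int_dist (ivec b v* A) < \<delta>"
  shows "real (J + 1) ^ CARD('m) * real (card B) \<le> 4 * real M ^ CARD('r)"
proof -
  let ?J = "PiE UNIV (\<lambda>_::'m. {0..int J})"
  let ?G = "PiE UNIV (\<lambda>_::'r. {..<M})"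
  define K where "K j i = nat (\<lfloor>M * (A *v ivec j) $ i\<rfloor> mod int M)" for j and i :: 'r
  define S where "S k = (\<Sum>b\<in>B. cis (2 * pi * (\<Sum>i\<in>UNIV. of_int (b i) * real (k i) / real M)))" for k
  have K_eq: "\<exists>p. \<forall>i. int (K j i) = \<lfloor>M * (A *v ivec j) $ i\<rfloor> - int M * p i" for j
  proof -
    have "int (K j i) = \<lfloor>M * (A *v ivec j) $ i\<rfloor> - int M * (\<lfloor>M * (A *v ivec j) $ i\<rfloor> div int M)" for i
      using M(1) pos_mod_sign[of "int M" "\<lfloor>M * (A *v ivec j) $ i\<rfloor>"]
      by (simp add: K_def minus_mult_div_eq_mod)
    then show ?thesis by (intro exI[of _ "\<lambda>i. \<lfloor>M * (A *v ivec j) $ i\<rfloor> div int M"] allI)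
  qed
  have K_in: "K j \<in> ?G" for j
    using M(1) by (auto simp: K_def nat_less_iff)
  have inj: "inj_on K ?J"
  proof (rule inj_onI, rule ccontr)
    fix j j' assume j: "j \<in> ?J" "j' \<in> ?J" "K j = K j'" "j \<noteq> j'"
    obtain p where p: "\<And>i. int (K j i) = \<lfloor>M * (A *v ivec j) $ i\<rfloor> - int M * p i" using K_eq by blast
    obtain p' where p': "\<And>i. int (K j' i) = \<lfloor>M * (A *v ivec j') $ i\<rfloor> - int M * p' i" using K_eq by blast
    let ?d = "\<lambda>i. j i - j' i"
    have "?d \<noteq> (\<lambda>_. 0)" using j(4) by (auto simp: fun_eq_iff)
    moreover have "\<bar>?d i\<bar> \<le> int J" for i
      using j(1,2) by (auto simp: PiE_iff abs_le_iff) (smt (verit) atLeastAtMost_iff)+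
    ultimately have "1 / real M \<le> int_dist (A *v ivec ?d)" by (rule sep)
    moreover have "int_dist (A *v ivec ?d) < 1 / M"
      unfolding int_dist_less_iff
    proof (intro exI allI)
      fix i
      let ?y = "(A *v ivec j) $ i" and ?y' = "(A *v ivec j') $ i"
      have e0: "\<lfloor>M * ?y\<rfloor> - \<lfloor>M * ?y'\<rfloor> = int M * (p i - p' i)"
        using p[of i] p'[of i] j(3) by (simp add: algebra_simps)
      have e: "real_of_int \<lfloor>M * ?y\<rfloor> - of_int \<lfloor>M * ?y'\<rfloor> = M * (of_int (p i - p' i))"
        using arg_cong[OF e0, of real_of_int] by simp
      have "\<bar>M * (?y - ?y' - of_int (p i - p' i))\<bar> < 1"
        using e by (simp add: right_diff_distrib) linarith
      then have "M * \<bar>?y - ?y' - of_int (p i - p' i)\<bar> < 1"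
        using M(1) by (simp only: abs_mult abs_of_nat)
      then have "\<bar>?y - ?y' - of_int (p i - p' i)\<bar> < 1 / M"
        using M(1) by (simp only: pos_less_divide_eq mult.commute of_nat_0_less_iff)
      then show "\<bar>(A *v ivec ?d) $ i - of_int (p i - p' i)\<bar> < 1 / real M"
        by (simp add: ivec_diff[symmetric] matrix_vector_mult_diff_distrib)
    qed
    ultimately show False by simp
  qed
  have big: "real (card B) / 2 \<le> cmod (S (K j))" if j: "j \<in> ?J" for j
  proof -
    have "1 / 2 \<le> cos (2 * pi * (\<Sum>i\<in>UNIV. of_int (b i) * real (K j i) / real M))" if b: "b \<in> B" for b
    proof -
      let ?y = "A *v ivec j"
      obtain p where p: "\<And>i. int (K j i) = \<lfloor>M * ?y $ i\<rfloor> - int M * p i" using K_eq by blast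
      obtain c where c: "\<And>l. \<bar>(ivec b v* A) $ l - of_int (c l)\<bar> < \<delta>"
        using B(3)[OF b] unfolding int_dist_less_iff by blast
      have "real (K j i) = of_int \<lfloor>M * ?y $ i\<rfloor> - M * of_int (p i)" for i
        using arg_cong[OF p[of i], of real_of_int] by simp
      then have x: "(\<Sum>i\<in>UNIV. of_int (b i) * real (K j i) / real M)
         = (\<Sum>i\<in>UNIV. of_int (b i) * (of_int \<lfloor>M * ?y $ i\<rfloor> / M)) - of_int (\<Sum>i\<in>UNIV. b i * p i)"
        using M(1) by (simp add: sum_subtractf[symmetric] diff_divide_distrib right_diff_distrib)
      have "\<bar>(\<Sum>i\<in>UNIV. of_int (b i) * (of_int \<lfloor>M * ?y $ i\<rfloor> / M)) - (\<Sum>i\<in>UNIV. of_int (b i) * ?y $ i)\<bar>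
          \<le> (\<Sum>i\<in>(UNIV::'r set). L * (1 / M))"
        unfolding sum_subtractf[symmetric] right_diff_distrib[symmetric]
      proof (rule order_trans[OF sum_abs], rule sum_mono)
        fix i
        have "of_int \<lfloor>M * ?y $ i\<rfloor> / M - ?y $ i = (of_int \<lfloor>M * ?y $ i\<rfloor> - M * ?y $ i) / M"
          using M(1) by (simp add: diff_divide_distrib)
        also have "\<bar>\<dots>\<bar> \<le> 1 / M"
          unfolding abs_divide abs_of_nat by (intro divide_right_mono) linarith+
        finally have "\<bar>of_int \<lfloor>M * ?y $ i\<rfloor> / M - ?y $ i\<bar> \<le> 1 / M" .
        then show "\<bar>of_int (b i) * (of_int \<lfloor>M * ?y $ i\<rfloor> / M - ?y $ i)\<bar> \<le> L * (1 / M)"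
          unfolding abs_mult using B(2)[OF b, of i] L by (intro mult_mono) auto
      qed
      also have "\<dots> \<le> 1 / 12" using M by (simp add: field_simps)
      finally have 1: "\<bar>(\<Sum>i\<in>UNIV. of_int (b i) * (of_int \<lfloor>M * ?y $ i\<rfloor> / M)) - (\<Sum>i\<in>UNIV. of_int (b i) * ?y $ i)\<bar> \<le> 1 / 12" .
      have 2: "(\<Sum>i\<in>UNIV. of_int (b i) * ?y $ i) = (\<Sum>l\<in>UNIV. (ivec b v* A) $ l * of_int (j l))"
        using dot_lmul_matrix[of "ivec b" A "ivec j"] by (simp add: inner_vec_def)
      have "\<bar>(\<Sum>l\<in>UNIV. (ivec b v* A) $ l * of_int (j l)) - (\<Sum>l\<in>UNIV. of_int (c l) * of_int (j l))\<bar>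
          \<le> (\<Sum>l\<in>(UNIV::'m set). \<delta> * J)"
        unfolding sum_subtractf[symmetric] left_diff_distrib[symmetric]
      proof (rule order_trans[OF sum_abs], rule sum_mono)
        fix l
        have "j l \<in> {0..int J}" using j by auto
        then have "\<bar>real_of_int (j l)\<bar> \<le> J" by simp
        then show "\<bar>((ivec b v* A) $ l - of_int (c l)) * of_int (j l)\<bar> \<le> \<delta> * J"
          unfolding abs_mult using c[of l] by (intro mult_mono) auto
      qed
      also have "\<dots> \<le> 1 / 12" using J by (simp add: field_simps)
      finally have 3: "\<bar>(\<Sum>l\<in>UNIV. (ivec b v* A) $ l * of_int (j l)) - of_int (\<Sum>l\<in>UNIV. c l * j l)\<bar> \<le> 1 / 12"
        by simp
      show ?thesis
        unfolding x
        by (rule cos_ge_half_near_int[where N="(\<Sum>l\<in>UNIV. c l * j l) - (\<Sum>i\<in>UNIV. b i * p i)"])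
           (use 1 3 in \<open>unfold 2 of_int_diff, linarith\<close>)
    qed
    then have "real (card B) * (1 / 2) \<le> Re (S (K j))"
      unfolding S_def Re_sum by (intro sum_bounded_below) auto
    then show ?thesis using complex_Re_le_cmod[of "S (K j)"] by linarith
  qed
  have "card ?J = (J + 1) ^ CARD('m)" by (simp add: card_PiE nat_add_distrib)
  then have "real (J + 1) ^ CARD('m) * (real (card B) / 2)\<^sup>2 = (\<Sum>j\<in>?J. (real (card B) / 2)\<^sup>2)"
    by simp
  also have "\<dots> \<le> (\<Sum>j\<in>?J. (cmod (S (K j)))\<^sup>2)"
    by (intro sum_mono power_mono big) auto
  also have "\<dots> = (\<Sum>k\<in>K ` ?J. (cmod (S k))\<^sup>2)"
    using inj by (simp add: sum.reindex)
  also have "\<dots> \<le> (\<Sum>k\<in>?G. (cmod (S k))\<^sup>2)"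
    by (intro sum_mono2 finite_PiE) (use K_in in auto)
  also have "\<dots> = real M ^ CARD('r) * real (card B)"
    unfolding S_def
  proof (rule discrete_Parseval[OF M(1) B(1)], rule ccontr)
    fix b b' assume b: "b \<in> B" "b' \<in> B" "\<forall>i. int M dvd b i - b' i" "b \<noteq> b'"
    then obtain i where "b i \<noteq> b' i" by blast
    moreover have "int M dvd \<bar>b i - b' i\<bar>" using b(3) by simp
    ultimately have "int M \<le> \<bar>b i - b' i\<bar>" by (intro zdvd_imp_le) auto
    then have "real M \<le> \<bar>real_of_int (b i) - of_int (b' i)\<bar>" by linarith
    then have "real M \<le> 2 * L" using B(2)[OF b(1), of i] B(2)[OF b(2), of i] by linarith
    moreover have "12 * L \<le> 12 * real CARD('r) * L"
      using L by (intro mult_right_mono) auto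
    ultimately show False using M L by linarith
  qed
  finally have *: "real (J + 1) ^ CARD('m) * (real (card B) / 2)\<^sup>2 \<le> real M ^ CARD('r) * real (card B)" .
  show ?thesis
  proof (cases "card B = 0")
    case False
    then have "0 < real (card B)" by simp
    then show ?thesis using * by (simp add: power2_eq_square power_divide field_simps)
  qed simp
qed

text \<open>
  The bound has the order of magnitude of the volume of the box times the probability \<open>\<delta>\<^sup>m\<close>. The
  condition relating \<open>\<delta>\<close> and \<open>L\<close> is what makes the points \<open>Aj\<close>, \<open>\<bar>j\<bar> \<le> 1/\<delta>\<close>, separated at scale \<open>1/L\<close>. A
  translated box reduces to a centered one by subtracting one of its elements.
\<close>
lemma kernel_count_bound:
  fixes A :: "real^'m::finite^'r::finite"
  assumes "0 < c" "0 < w"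
    and gap: "kernel_gap A c w"
  shows "\<exists>C\<ge>1. \<forall>\<delta> L z. 0 < \<delta> \<longrightarrow> 1 \<le> L \<longrightarrow> C * \<delta> powr (- w) \<le> L \<longrightarrow>
     real (card {b. (\<forall>i. \<bar>real_of_int (b i) - z i\<bar> \<le> L) \<and> int_dist (ivec b v* A) < \<delta>})
       \<le> C * \<delta> ^ CARD('m) * L ^ CARD('r)"
proof -
  let ?r = "real CARD('r)" and ?m = "real CARD('m)"
  have r1: "1 \<le> ?r" and m1: "1 \<le> ?m" by (simp_all add: Suc_leI)
  define C where "C = max 1 (max (1 / c) (4 * (26 * ?r) ^ CARD('r) * (24 * ?m) ^ CARD('m)))"
  have origin: "real (card B) \<le> 4 * (26 * ?r) ^ CARD('r) * (24 * ?m) ^ CARD('m) * (\<delta> ^ CARD('m) * L ^ CARD('r))"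
    if \<delta>: "0 < \<delta>" and L: "1 \<le> L" "(1 / c) * \<delta> powr (- w) \<le> L"
      and B: "finite B" "\<And>b i. b \<in> B \<Longrightarrow> \<bar>real_of_int (b i)\<bar> \<le> 2 * L"
           "\<And>b. b \<in> B \<Longrightarrow> int_dist (ivec b v* A) < 2 * \<delta>"
    for \<delta> L and B :: "('r \<Rightarrow> int) set"
  proof -
    \<comment> \<open>The constants are those demanded by the error terms of the previous lemma for \<open>2L\<close> and \<open>2\<delta>\<close>; the factor
        2 comes from taking differences below.\<close>
    define J where "J = nat \<lfloor>1 / (24 * ?m * \<delta>)\<rfloor>"
    define M where "M = nat \<lceil>24 * ?r * L\<rceil>"
    have "1 * 1 \<le> ?r * L" using r1 L by (intro mult_mono) auto
    then have rL: "24 \<le> 24 * ?r * L" by simp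
    have M: "24 * ?r * L \<le> M" "M \<le> 26 * ?r * L" "0 < M" using rL unfolding M_def by linarith+
    have J0: "0 \<le> 1 / (24 * ?m * \<delta>)" using \<delta> by simp
    then have J: "J \<le> 1 / (24 * ?m * \<delta>)" "1 / (24 * ?m * \<delta>) \<le> J + 1"
      unfolding J_def by linarith+
    have "real (J + 1) ^ CARD('m) * real (card B) \<le> 4 * real M ^ CARD('r)"
    proof (rule card_near_kernel_le[where L="2 * L" and \<delta>="2 * \<delta>"])
      show "0 < M" by (fact M(3))
      show "finite B" "\<And>b i. b \<in> B \<Longrightarrow> \<bar>real_of_int (b i)\<bar> \<le> 2 * L"
           "\<And>b. b \<in> B \<Longrightarrow> int_dist (ivec b v* A) < 2 * \<delta>" by (fact B)+
      show "12 * ?r * (2 * L) \<le> real M" using M by simp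
      show "0 \<le> 2 * L" using L by simp
      show "12 * ?m * J * (2 * \<delta>) \<le> 1" using J(1) \<delta> by (simp add: field_simps)
      fix j :: "'m \<Rightarrow> int" assume j: "j \<noteq> (\<lambda>_. 0)" "\<And>i. \<bar>j i\<bar> \<le> int J"
      have jn: "1 \<le> infnorm (ivec j)" using infnorm_ivec_ge_1[OF j(1)] .
      have "\<bar>real_of_int (j i)\<bar> \<le> J" for i using j(2)[of i] by linarith
      then have "infnorm (ivec j) \<le> J"
        unfolding infnorm_cart_le_iff by simp
      also have "\<dots> \<le> 1 / \<delta>"
      proof (rule order_trans[OF J(1)])
        show "1 / (24 * ?m * \<delta>) \<le> 1 / \<delta>" proof (intro divide_left_mono)
          show "\<delta> \<le> 24 * ?m * \<delta>" using \<delta> mult_right_mono[of 1 "24 * ?m" \<delta>] m1 by linarith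
        qed (use \<delta> m1 in auto)
      qed
      finally have "(1 / \<delta>) powr (- w) \<le> infnorm (ivec j) powr (- w)"
        using jn assms(2) by (intro powr_mono2') auto
      then have "\<delta> powr w \<le> infnorm (ivec j) powr (- w)"
        using \<delta> by (simp add: powr_minus powr_divide field_simps)
      moreover have "1 / M \<le> c * \<delta> powr w"
      proof -
        have "(1 / c) * \<delta> powr (- w) \<le> M"
        proof -
          have "L * 1 \<le> L * (24 * ?r)" by (intro mult_left_mono) (use L r1 in linarith)+
          then have "L \<le> 24 * ?r * L" by (simp only: mult_ac mult_1_right)
          then show ?thesis using L(2) M(1) by linarith
        qed
        then show ?thesis using \<delta> assms(1) M(3) by (simp add: powr_minus field_simps)
      qed
      ultimately have "1 / M \<le> c * infnorm (ivec j) powr (- w)"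
        using assms(1) by (meson mult_left_mono less_imp_le order_trans)
      then show "1 / M \<le> int_dist (A *v ivec j)" using gap j(1) unfolding kernel_gap_def by fastforce
    qed
    moreover have "(1 / (24 * ?m * \<delta>)) ^ CARD('m) * real (card B) \<le> real (J + 1) ^ CARD('m) * real (card B)"
      using J(2) J0 by (intro mult_right_mono power_mono) auto
    moreover have "4 * real M ^ CARD('r) \<le> 4 * (26 * ?r * L) ^ CARD('r)"
      using M by (intro mult_left_mono power_mono) auto
    ultimately have "(1 / (24 * ?m * \<delta>)) ^ CARD('m) * real (card B) \<le> 4 * (26 * ?r * L) ^ CARD('r)"
      by linarith
    then show ?thesis
      using \<delta> m1 by (simp add: field_simps power_mult_distrib)
  qed
  have "real (card {b. (\<forall>i. \<bar>real_of_int (b i) - z i\<bar> \<le> L) \<and> int_dist (ivec b v* A) < \<delta>})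
       \<le> C * \<delta> ^ CARD('m) * L ^ CARD('r)" (is "real (card ?N) \<le> _")
    if \<delta>: "0 < \<delta>" and L: "1 \<le> L" "C * \<delta> powr (- w) \<le> L" for \<delta> L z
  proof -
    have fin: "finite ?N"
      by (rule finite_subset[OF _ finite_bounded_int_functions[of z L]]) auto
    have pos: "0 \<le> \<delta> ^ CARD('m) * L ^ CARD('r)" using \<delta> L by simp
    show ?thesis
    proof (cases "?N = {}")
      case True
      have "0 \<le> C * \<delta> ^ CARD('m) * L ^ CARD('r)"
        using pos by (simp add: C_def mult.assoc)
      then show ?thesis using True by (simp only: card.empty of_nat_0)
    next
      case False
      then obtain b0 where b0: "b0 \<in> ?N" by blast
      let ?s = "\<lambda>b i. b i - b0 i"
      have "inj_on ?s ?N" by (auto simp: inj_on_def fun_eq_iff)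
      then have "card ?N = card (?s ` ?N)" by (simp add: card_image)
      also have "real \<dots> \<le> 4 * (26 * ?r) ^ CARD('r) * (24 * ?m) ^ CARD('m) * (\<delta> ^ CARD('m) * L ^ CARD('r))"
      proof (rule origin[OF \<delta> L(1)])
        have "1 / c * \<delta> powr (- w) \<le> C * \<delta> powr (- w)" by (intro mult_right_mono) (auto simp: C_def)
        then show "1 / c * \<delta> powr (- w) \<le> L" using L by linarith
        show "finite (?s ` ?N)" using fin by simp
        fix d assume "d \<in> ?s ` ?N"
        then obtain b where b: "b \<in> ?N" "d = ?s b" by blast
        show "\<bar>real_of_int (d i)\<bar> \<le> 2 * L" for i
        proof -
          have "\<bar>real_of_int (b i) - z i\<bar> \<le> L" "\<bar>real_of_int (b0 i) - z i\<bar> \<le> L" using b b0 by blast+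
          then show ?thesis unfolding b(2) of_int_diff by linarith
        qed
        obtain p where p: "\<And>i. \<bar>(ivec b v* A) $ i - of_int (p i)\<bar> < \<delta>"
          using b(1) unfolding int_dist_less_iff by blast
        obtain p0 where p0: "\<And>i. \<bar>(ivec b0 v* A) $ i - of_int (p0 i)\<bar> < \<delta>"
          using b0 unfolding int_dist_less_iff by blast
        show "int_dist (ivec d v* A) < 2 * \<delta>"
          unfolding int_dist_less_iff
        proof (intro exI allI)
          fix i
          show "\<bar>(ivec d v* A) $ i - of_int (p i - p0 i)\<bar> < 2 * \<delta>"
            using p[of i] p0[of i]
            by (simp add: b(2) ivec_diff[symmetric] vector_matrix_mult_diff_distrib abs_diff_less_iff)
        qed
      qed
      also have "\<dots> \<le> C * (\<delta> ^ CARD('m) * L ^ CARD('r))"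
        using pos by (intro mult_right_mono) (auto simp: C_def)
      finally show ?thesis by (simp add: mult.assoc)
    qed
  qed
  moreover have "1 \<le> C" by (simp add: C_def)
  ultimately show ?thesis by blast
qed

section \<open>The convergence half\<close>

definition cube :: "real^'d \<Rightarrow> real \<Rightarrow> (real^'d) set" where
  "cube z r = {x. \<forall>i. \<bar>x $ i - z $ i\<bar> \<le> r}"

lemma cube_eq_cbox: "cube z r = cbox (z - (\<chi> i. r)) (z + (\<chi> i. r))"
  by (auto simp: cube_def mem_box_cart abs_le_iff algebra_simps)

lemma lmeasurable_cube [simp, intro]: "cube z r \<in> lmeasurable"
  by (simp add: cube_eq_cbox)

lemma sets_cube [simp, intro]: "cube z r \<in> sets lebesgue"
  by (simp add: fmeasurableD)

lemma measure_cube: "0 \<le> r \<Longrightarrow> measure lebesgue (cube (z::real^'d::finite) r) = (2 * r) ^ CARD('d)"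
proof -
  assume r: "0 \<le> r"
  have "z \<in> cube z r" using r by (simp add: cube_def)
  then have "cbox (z - (\<chi> i. r)) (z + (\<chi> i. r)) \<noteq> {}" by (auto simp: cube_eq_cbox)
  then have "measure lebesgue (cube z r) = (\<Prod>i\<in>(UNIV::'d set). 2 * r)"
    unfolding cube_eq_cbox by (simp add: content_cbox_cart)
  then show ?thesis by simp
qed

lemma center_in_cube: "0 \<le> r \<Longrightarrow> z \<in> cube z r"
  by (simp add: cube_def)

lemma cube_mono: "r \<le> s \<Longrightarrow> cube z r \<subseteq> cube z s"
  by (auto simp: cube_def intro: order_trans)

lemma cube_subset_cube: "g \<in> cube z r \<Longrightarrow> r + s \<le> t \<Longrightarrow> cube g s \<subseteq> cube z t"
proof
  fix x assume *: "g \<in> cube z r" "r + s \<le> t" "x \<in> cube g s"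
  have "\<bar>x $ i - z $ i\<bar> \<le> t" for i
  proof -
    have "\<bar>g $ i - z $ i\<bar> \<le> r" "\<bar>x $ i - g $ i\<bar> \<le> s" using * by (auto simp: cube_def)
    then show ?thesis using *(2) by linarith
  qed
  then show "x \<in> cube z t" by (simp add: cube_def)
qed

lemma measure_finite_UN_cubes_le:
  assumes "finite G" "0 \<le> r"
  shows "measure lebesgue (\<Union>g\<in>G. cube (f g :: real^'d::finite) r) \<le> real (card G) * (2 * r) ^ CARD('d)"
proof -
  have "measure lebesgue (\<Union>g\<in>G. cube (f g) r) \<le> (\<Sum>g\<in>G. measure lebesgue (cube (f g) r))"
    using assms by (intro measure_UNION_le) auto
  then show ?thesis using assms by (simp add: measure_cube)
qed

definition graph_point :: "real^'m^('d::finite option) \<Rightarrow> real^'d \<Rightarrow> real^('d + 'm::finite)" where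
  "graph_point A x = join_vec x (tilde x v* A)"

lemma graph_point_nth [simp]:
  "graph_point A x $ Inl i = x $ i"
  "graph_point A x $ Inr j = (tilde x v* A) $ j"
  by (simp_all add: graph_point_def join_vec_def)

lemma affine_graph_eq_range: "affine_graph A = range (graph_point A)"
  by (auto simp: affine_graph_def graph_point_def)

definition row_bound :: "real^'m::finite^'r::finite \<Rightarrow> real" where
  "row_bound A = 1 + (\<Sum>i\<in>UNIV. \<Sum>j\<in>UNIV. \<bar>A $ i $ j\<bar>)"

lemma row_bound_ge_1: "1 \<le> row_bound A"
  by (simp add: row_bound_def sum_nonneg)

lemma vector_matrix_bound:
  assumes "\<And>i. \<bar>v $ i\<bar> \<le> e"
  shows "\<bar>(v v* A) $ j\<bar> \<le> row_bound A * e"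
proof -
  have e: "0 \<le> e" using assms[of undefined] by linarith
  have "\<bar>(v v* A) $ j\<bar> \<le> (\<Sum>i\<in>UNIV. \<bar>v $ i * A $ i $ j\<bar>)"
    by (simp add: vector_matrix_mult_def)
  also have "\<dots> \<le> (\<Sum>i\<in>UNIV. e * (\<Sum>j\<in>UNIV. \<bar>A $ i $ j\<bar>))"
    unfolding abs_mult by (intro sum_mono mult_mono assms e member_le_sum) auto
  also have "\<dots> \<le> row_bound A * e"
    using e by (simp add: row_bound_def sum_distrib_left[symmetric] algebra_simps)
  finally show ?thesis .
qed

lemma tilde_nth [simp]: "tilde x $ None = 1" "tilde x $ Some i = x $ i"
  by (simp_all add: tilde_def)

text \<open>
  This allows the closeness of the affine subspace to rational points to be tested on integer vectors \<open>b = (q,a)\<close>: the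
  error made in moving from \<open>x\<close> to \<open>a/q\<close> is absorbed by a constant that depends on \<open>A\<close>.
\<close>
lemma graph_point_error:
  fixes b :: "'d::finite option \<Rightarrow> int"
  assumes "\<And>i. \<bar>of_int (b None) * x $ i - of_int (b (Some i))\<bar> \<le> e"
  shows "\<bar>of_int (b None) * (tilde x v* A) $ j - (ivec b v* A) $ j\<bar> \<le> row_bound A * e"
proof -
  have e: "0 \<le> e" using assms[of undefined] by linarith
  have "of_int (b None) * (tilde x v* A) $ j - (ivec b v* A) $ j = ((of_int (b None) *\<^sub>R tilde x - ivec b) v* A) $ j"
    by (simp add: vector_matrix_mult_diff_distrib scaleR_vector_matrix_assoc)
  also have "\<bar>\<dots>\<bar> \<le> row_bound A * e"
  proof (rule vector_matrix_bound)
    fix i :: "'d option"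
    show "\<bar>(of_int (b None) *\<^sub>R tilde x - ivec b) $ i\<bar> \<le> e"
      using assms e by (cases i) auto
  qed
  finally show ?thesis .
qed

lemma int_dist_graph_pointD:
  fixes A :: "real^'m::finite^('d::finite option)"
  assumes "int_dist (real q *\<^sub>R graph_point A x) < e"
  shows "\<exists>b. b None = int q \<and> (\<forall>i. \<bar>of_int (b None) * x $ i - of_int (b (Some i))\<bar> \<le> e)
    \<and> int_dist (ivec b v* A) < (1 + row_bound A) * e"
proof -
  obtain p where p: "\<And>i. \<bar>(real q *\<^sub>R graph_point A x) $ i - of_int (p i)\<bar> < e"
    using assms unfolding int_dist_less_iff by blast
  define b where "b i = (case i of None \<Rightarrow> int q | Some i \<Rightarrow> p (Inl i))" for i
  have b: "b None = int q" "\<And>i. b (Some i) = p (Inl i)" by (simp_all add: b_def)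
  have 1: "\<bar>of_int (b None) * x $ i - of_int (b (Some i))\<bar> \<le> e" for i
    using p[of "Inl i"] by (simp add: b)
  have "\<bar>(ivec b v* A) $ j - of_int (p (Inr j))\<bar> < (1 + row_bound A) * e" for j
    using p[of "Inr j"] graph_point_error[of b x e A j, OF 1] by (simp add: b algebra_simps)
  then have "int_dist (ivec b v* A) < (1 + row_bound A) * e" unfolding int_dist_less_iff by (intro exI allI)
  then show ?thesis using b(1) 1 by blast
qed

lemma int_dist_graph_pointI:
  fixes A :: "real^'m::finite^('d::finite option)"
  assumes "b None = int q" "\<And>i. \<bar>of_int (b None) * x $ i - of_int (b (Some i))\<bar> \<le> e"
    and "int_dist (ivec b v* A) < e" "(1 + row_bound A) * e \<le> e'"
  shows "int_dist (real q *\<^sub>R graph_point A x) < e'"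
proof -
  obtain p where p: "\<And>j. \<bar>(ivec b v* A) $ j - of_int (p j)\<bar> < e"
    using assms(3) unfolding int_dist_less_iff by blast
  have e: "0 < e" using p[of undefined] by linarith
  have "e < (1 + row_bound A) * e" using e row_bound_ge_1[of A] by simp
  then have ee: "e < e'" using assms(4) by linarith
  define c where "c i = (case i of Inl i \<Rightarrow> b (Some i) | Inr j \<Rightarrow> p j)" for i
  have "\<bar>(real q *\<^sub>R graph_point A x) $ i - of_int (c i)\<bar> < e'" for i
  proof (cases i)
    case (Inl k)
    then show ?thesis using assms(2)[of k] ee assms(1) by (simp add: c_def)
  next
    case (Inr j)
    then show ?thesis
      using p[of j] graph_point_error[of b x e A j, OF assms(2)] assms(1,4)
      by (simp add: c_def algebra_simps)
  qed
  then show ?thesis unfolding int_dist_less_iff by blast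
qed

text \<open>
  The base points \<open>x\<close> for which some \<open>b = (q,a)\<close> with \<open>q\<close> in the dyadic range of \<open>2\<^sup>s\<close> makes \<open>a/q\<close> close
  to \<open>x\<close> and the affine subspace close to a rational point above \<open>a/q\<close>.
\<close>
definition near_rational :: "real^'m::finite^('d::finite option) \<Rightarrow> nat \<Rightarrow> real \<Rightarrow> real \<Rightarrow> (real^'d) set" where
  "near_rational A s \<delta> \<alpha> = {x. \<exists>b. 2 ^ s \<le> b None \<and> b None < 2 ^ (s + 1) \<and>
      (\<forall>i. \<bar>of_int (b None) * x $ i - of_int (b (Some i))\<bar> \<le> \<delta>) \<and> int_dist (ivec b v* A) < \<alpha>}"

text \<open>
  The expected measure of \<open>near_rational\<close> in a cube of radius \<open>l\<close>, as a uniform upper bound. The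
  factor \<open>1 + l\<close> is due to cubes with \<open>l > 1\<close>; an enclosing measurable set is used so that no
  measurability of \<open>near_rational\<close> has to be discussed.
\<close>
definition near_rational_bound :: "real^'m::finite^('d::finite option) \<Rightarrow> real \<Rightarrow> real \<Rightarrow> real \<Rightarrow> bool" where
  "near_rational_bound A w R C \<longleftrightarrow> (\<forall>z l s \<alpha> \<delta>. (\<forall>i. \<bar>z $ i\<bar> \<le> R) \<longrightarrow> 0 < l \<longrightarrow> 0 < \<alpha> \<longrightarrow> 0 \<le> \<delta> \<longrightarrow>
     \<delta> \<le> 2 ^ s * l \<longrightarrow> 1 \<le> 2 ^ s * l \<longrightarrow> C * \<alpha> powr (- w) \<le> 2 ^ s * l \<longrightarrow>
     (\<exists>D\<in>lmeasurable. cube z l \<inter> near_rational A s \<delta> \<alpha> \<subseteq> D \<and>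
        measure lebesgue D \<le> C * l ^ CARD('d) * (1 + l) * \<alpha> ^ CARD('m) * \<delta> ^ CARD('d) * 2 ^ s))"

lemma near_rational_boundD:
  fixes A :: "real^'m::finite^('d::finite option)"
  assumes "near_rational_bound A w R C" "\<And>i. \<bar>z $ i\<bar> \<le> R" "0 < l" "0 < \<alpha>" "0 \<le> \<delta>"
     "\<delta> \<le> 2 ^ s * l" "1 \<le> 2 ^ s * l" "C * \<alpha> powr (- w) \<le> 2 ^ s * l"
  obtains D where "D \<in> lmeasurable" "cube z l \<inter> near_rational A s \<delta> \<alpha> \<subseteq> D"
    "measure lebesgue D \<le> C * l ^ CARD('d) * (1 + l) * \<alpha> ^ CARD('m) * \<delta> ^ CARD('d) * 2 ^ s"
proof -
  have "\<exists>D\<in>lmeasurable. cube z l \<inter> near_rational A s \<delta> \<alpha> \<subseteq> D \<and>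
        measure lebesgue D \<le> C * l ^ CARD('d) * (1 + l) * \<alpha> ^ CARD('m) * \<delta> ^ CARD('d) * 2 ^ s"
    by (rule assms(1)[unfolded near_rational_bound_def, rule_format]) (rule assms)+
  then show thesis using that by (elim bexE conjE)
qed

text \<open>
  The cone of all \<open>(q,a)\<close> with \<open>q\<close> of order \<open>2\<^sup>s\<close> and \<open>a/q\<close> in a cube of radius \<open>l\<close> is cut into about
  \<open>1/l\<close> slices, each contained in a box of side comparable to \<open>2\<^sup>s l\<close>, so that the counting bound for boxes
  loses no power of \<open>l\<close> when \<open>l \<le> 1\<close>. This uniformity in small cubes is what
  the divergence half depends on. The slices are sheared in the direction of the center \<open>z\<close>,
  whence the dependence of the constant on \<open>R\<close>.
\<close>
lemma ex_near_rational_bound: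
  fixes A :: "real^'m::finite^('d::finite option)"
  assumes "0 < c" "0 < w" "0 \<le> R"
    and gap: "kernel_gap A c w"
  shows "\<exists>C\<ge>1. near_rational_bound A w R C"
proof -
  let ?d = "CARD('d)" and ?m = "CARD('m)"
  obtain C0 where C0: "1 \<le> C0" and count: "\<And>\<delta> L z. 0 < \<delta> \<Longrightarrow> 1 \<le> L \<Longrightarrow> C0 * \<delta> powr (- w) \<le> L \<Longrightarrow>
     real (card {b. (\<forall>i. \<bar>real_of_int (b i) - z i\<bar> \<le> L) \<and> int_dist (ivec b v* A) < \<delta>})
       \<le> C0 * \<delta> ^ ?m * L ^ CARD('d option)"
    using kernel_count_bound[OF assms(1,2) gap] by blast
  define C where "C = C0 * (3 + R) ^ (?d + 1) * 2 ^ ?d"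
  have C1: "C0 \<le> C"
  proof -
    have "1 * 1 \<le> (3 + R) ^ (?d + 1) * (2::real) ^ ?d"
      using assms(3) by (intro mult_mono one_le_power) auto
    then show ?thesis unfolding C_def mult.assoc using C0 mult_left_mono[of 1 _ C0] by simp
  qed
  have "\<exists>D\<in>lmeasurable. cube z l \<inter> near_rational A s \<delta> \<alpha> \<subseteq> D \<and>
        measure lebesgue D \<le> C * l ^ ?d * (1 + l) * \<alpha> ^ ?m * \<delta> ^ ?d * 2 ^ s"
    if z: "\<And>i. \<bar>z $ i\<bar> \<le> R" and l: "0 < l" and \<alpha>: "0 < \<alpha>" and \<delta>: "0 \<le> \<delta>" "\<delta> \<le> 2 ^ s * l"
      and h1: "1 \<le> 2 ^ s * l" and hC: "C * \<alpha> powr (- w) \<le> 2 ^ s * l" for z l s \<alpha> \<delta>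
  proof -
    define h where "h = 2 ^ s * l"
    have h: "1 \<le> h" "0 < h" using h1 by (auto simp: h_def)
    define L where "L = h * (3 + R)"
    have "h * 1 \<le> L" unfolding L_def using h assms(3) by (intro mult_left_mono) auto
    then have hL: "h \<le> L" by simp
    define I where "I = {..nat \<lfloor>1 / l\<rfloor>}"
    \<comment> \<open>The slice with index \<open>i\<close> consists of the \<open>q\<close> in an interval of length \<open>h\<close>, over which \<open>qz\<close> moves by at
        most \<open>hR\<close>.\<close>
    define base where "base i = 2 ^ s + real i * h" for i :: nat
    define ctr where "ctr i k = (case k of None \<Rightarrow> base i | Some j \<Rightarrow> base i * z $ j)" for i and k :: "'d option"
    define S where "S i = {b. (\<forall>k. \<bar>real_of_int (b k) - ctr i k\<bar> \<le> L) \<and> int_dist (ivec b v* A) < \<alpha>}" for i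
    define pt where "pt b = (\<chi> j. real_of_int (b (Some j)) / real_of_int (b None))" for b :: "'d option \<Rightarrow> int"
    define D where "D = (\<Union>i\<in>I. \<Union>b\<in>S i. cube (pt b) (\<delta> / 2 ^ s))"
    have finS: "finite (S i)" for i
      unfolding S_def by (rule finite_subset[OF _ finite_bounded_int_functions[of "ctr i" L]]) auto
    have cardS: "real (card (S i)) \<le> C0 * \<alpha> ^ ?m * L ^ (?d + 1)" for i
    proof -
      have "C0 * \<alpha> powr (- w) \<le> C * \<alpha> powr (- w)" using C1 by (intro mult_right_mono) auto
      then have "C0 * \<alpha> powr (- w) \<le> L" using hC hL by (simp add: h_def)
      moreover have "1 \<le> L" using h hL by linarith
      ultimately show ?thesis unfolding S_def using count[OF \<alpha>, of L "ctr i"] by (simp add: card_option)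
    qed
    have D: "D \<in> lmeasurable" unfolding D_def I_def
      by (intro fmeasurable.finite_UN finS) auto
    have "measure lebesgue D \<le> (\<Sum>i\<in>I. measure lebesgue (\<Union>b\<in>S i. cube (pt b) (\<delta> / 2 ^ s)))"
      unfolding D_def using finS by (intro measure_UNION_le) (auto simp: I_def)
    also have "\<dots> \<le> (\<Sum>i\<in>I. C0 * \<alpha> ^ ?m * L ^ (?d + 1) * (2 * (\<delta> / 2 ^ s)) ^ ?d)"
    proof (rule sum_mono)
      fix i
      have "measure lebesgue (\<Union>b\<in>S i. cube (pt b) (\<delta> / 2 ^ s)) \<le> real (card (S i)) * (2 * (\<delta> / 2 ^ s)) ^ ?d"
        using finS \<delta> by (intro measure_finite_UN_cubes_le) auto
      also have "\<dots> \<le> C0 * \<alpha> ^ ?m * L ^ (?d + 1) * (2 * (\<delta> / 2 ^ s)) ^ ?d"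
        using cardS \<delta> by (intro mult_right_mono) auto
      finally show "measure lebesgue (\<Union>b\<in>S i. cube (pt b) (\<delta> / 2 ^ s)) \<le> \<dots>" .
    qed
    also have "\<dots> = real (card I) * (C0 * \<alpha> ^ ?m * L ^ (?d + 1) * (2 * (\<delta> / 2 ^ s)) ^ ?d)" by simp
    also have "\<dots> \<le> ((1 + l) / l) * (C0 * \<alpha> ^ ?m * L ^ (?d + 1) * (2 * (\<delta> / 2 ^ s)) ^ ?d)"
    proof (rule mult_right_mono)
      have "real (card I) = real (nat \<lfloor>1 / l\<rfloor>) + 1" by (simp add: I_def)
      also have "\<dots> \<le> 1 / l + 1" using l by simp
      finally show "real (card I) \<le> (1 + l) / l" using l by (simp add: add_divide_distrib)
      show "0 \<le> C0 * \<alpha> ^ ?m * L ^ (?d + 1) * (2 * (\<delta> / 2 ^ s)) ^ ?d"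
        using C0 \<alpha> \<delta> h hL by (intro mult_nonneg_nonneg zero_le_power) auto
    qed
    also have "\<dots> = C * l ^ ?d * (1 + l) * \<alpha> ^ ?m * \<delta> ^ ?d * 2 ^ s"
    proof -
      have "((1 + l) / l) * (C0 * a * (P * l * u) ^ (?d + 1) * (2 * (\<delta> / P)) ^ ?d)
          = C0 * u ^ (?d + 1) * 2 ^ ?d * l ^ ?d * (1 + l) * a * \<delta> ^ ?d * P" if "0 < P" for a u P :: real
        using l that by (simp add: power_mult_distrib power_divide field_simps)
      from this[of "2 ^ s" "\<alpha> ^ ?m" "3 + R"] show ?thesis by (simp only: C_def L_def h_def zero_less_power zero_less_numeral)
    qed
    finally have mD: "measure lebesgue D \<le> C * l ^ ?d * (1 + l) * \<alpha> ^ ?m * \<delta> ^ ?d * 2 ^ s" .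
    have "x \<in> D" if x: "x \<in> cube z l" and b: "2 ^ s \<le> b None" "b None < 2 ^ (s + 1)"
      "\<And>i. \<bar>of_int (b None) * x $ i - of_int (b (Some i))\<bar> \<le> \<delta>" "int_dist (ivec b v* A) < \<alpha>" for x b
    proof -
      let ?q = "real_of_int (b None)"
      have "real_of_int (2 ^ s) \<le> ?q" "?q < real_of_int (2 ^ (s + 1))"
        using b(1,2) by (simp_all only: of_int_le_iff of_int_less_iff)
      then have q: "2 ^ s \<le> ?q" "?q < 2 * 2 ^ s" by simp_all
      have q0: "0 < ?q" using q(1) by (rule less_le_trans[rotated]) simp
      define i where "i = nat \<lfloor>(?q - 2 ^ s) / h\<rfloor>"
      have nn: "0 \<le> (?q - 2 ^ s) / h" using q h by simp
      have "(?q - 2 ^ s) / h \<le> 2 ^ s / h" using q h by (intro divide_right_mono) auto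
      also have "\<dots> = 1 / l" by (simp add: h_def)
      finally have "i \<in> I" unfolding I_def i_def by (simp add: nat_mono floor_mono)
      have "real i \<le> (?q - 2 ^ s) / h" "(?q - 2 ^ s) / h \<le> real i + 1"
        using nn unfolding i_def by linarith+
      then have bi: "base i \<le> ?q" "?q \<le> base i + h"
        using h by (simp_all add: base_def field_simps)
      have "\<bar>real_of_int (b k) - ctr i k\<bar> \<le> L" for k
      proof (cases k)
        case None
        then show ?thesis using bi hL by (simp add: ctr_def)
      next
        case (Some j)
        have xz: "\<bar>x $ j - z $ j\<bar> \<le> l" using x by (simp add: cube_def)
        have "\<bar>?q * (x $ j - z $ j)\<bar> \<le> (2 * 2 ^ s) * l"
          unfolding abs_mult using q q0 xz by (intro mult_mono) auto
        then have 1: "\<bar>?q * x $ j - ?q * z $ j\<bar> \<le> 2 * h" by (simp add: h_def right_diff_distrib)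
        have "\<bar>(?q - base i) * z $ j\<bar> \<le> h * R"
          unfolding abs_mult using bi z[of j] h by (intro mult_mono) auto
        then have 2: "\<bar>?q * z $ j - base i * z $ j\<bar> \<le> h * R" by (simp add: left_diff_distrib)
        have 3: "\<bar>?q * x $ j - of_int (b (Some j))\<bar> \<le> h" using b(3)[of j] \<delta> by (simp add: h_def)
        have "\<bar>of_int (b (Some j)) - base i * z $ j\<bar> \<le> h + 2 * h + h * R"
          using 1 2 3 by linarith
        then show ?thesis using Some by (simp add: ctr_def L_def algebra_simps)
      qed
      then have "b \<in> S i" using b(4) by (simp add: S_def)
      moreover have "x \<in> cube (pt b) (\<delta> / 2 ^ s)"
        unfolding cube_def
      proof (safe)
        fix j
        have "\<bar>x $ j - pt b $ j\<bar> = \<bar>?q * x $ j - of_int (b (Some j))\<bar> / ?q"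
          using q0 by (simp add: pt_def field_simps)
        also have "\<dots> \<le> \<delta> / 2 ^ s"
          using b(3)[of j] q q0 \<delta> by (intro frac_le) auto
        finally show "\<bar>x $ j - pt b $ j\<bar> \<le> \<delta> / 2 ^ s" .
      qed
      ultimately show "x \<in> D" using \<open>i \<in> I\<close> unfolding D_def by blast
    qed
    then have "cube z l \<inter> near_rational A s \<delta> \<alpha> \<subseteq> D" unfolding near_rational_def by blast
    then show ?thesis using D mD by (intro bexI conjI)
  qed
  then have "near_rational_bound A w R C" unfolding near_rational_bound_def by simp
  moreover have "1 \<le> C" using C0 C1 by linarith
  ultimately show ?thesis by blast
qed

text \<open>
  Replacing \<open>\<psi>\<close> by the maximum \<open>\<phi>\<close> of \<open>\<psi>\<close> and the power \<open>-1/w\<close> keeps the series convergent because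
  \<open>w < n\<close>, and makes the counting bound applicable on each dyadic range.
\<close>
theorem khintchine_convergence:
  fixes A :: "real^'m::finite^('d::finite option)"
  assumes c: "0 < c" and w: "0 < w" "w < real (CARD('d) + CARD('m))"
    and gap: "kernel_gap A c w"
    and \<psi>: "\<And>q. 1 \<le> q \<Longrightarrow> 0 \<le> \<psi> q" "antimono_on {1..} \<psi>"
    and sum: "summable (\<lambda>q. \<psi> (Suc q) ^ CARD('d + 'm))"
  shows "negligible {x. graph_point A x \<in> psi_approximable \<psi>}"
proof -
  let ?d = "CARD('d)" and ?m = "CARD('m)"
  let ?n = "?d + ?m"
  define \<phi> where "\<phi> q = (if q = 0 then 0 else max (\<psi> q) (real q powr (- 1 / w)))" for q :: nat
  have \<phi>_pos: "0 < \<phi> q" if "1 \<le> q" for q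
    using that by (auto simp: \<phi>_def less_max_iff_disj)
  have \<phi>_nn: "0 \<le> \<phi> q" for q using \<phi>_pos[of q] by (cases "q = 0") (auto simp: \<phi>_def)
  have \<phi>_ge: "real q powr (- 1 / w) \<le> \<phi> q" "\<psi> q \<le> \<phi> q" if "1 \<le> q" for q
    using that by (auto simp: \<phi>_def)
  have \<phi>_mono: "\<phi> q \<le> \<phi> p" if "1 \<le> p" "p \<le> q" for p q
  proof -
    have "real q powr (- 1 / w) \<le> real p powr (- 1 / w)" using that w by (intro powr_mono2') auto
    moreover have "\<psi> q \<le> \<psi> p" using \<psi>(2) that by (auto simp: monotone_on_def)
    ultimately show ?thesis using that by (auto simp: \<phi>_def)
  qed
  have sum\<phi>: "summable (\<lambda>q. \<phi> q ^ ?n)"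
  proof -
    have "summable (\<lambda>q. real q powr (- real ?n / w))"
      using summable_real_powr_iff[of "- real ?n / w"] w by (simp add: field_simps)
    then have "summable (\<lambda>q. real (Suc q) powr (- real ?n / w))"
      by (subst summable_Suc_iff)
    then have s: "summable (\<lambda>q. \<psi> (Suc q) ^ ?n + real (Suc q) powr (- real ?n / w))"
      using sum by (intro summable_add) simp_all
    have "summable (\<lambda>q. \<phi> (Suc q) ^ ?n)"
    proof (rule summable_comparison_test'[OF s])
      fix q :: nat
      have "(real (Suc q) powr (- 1 / w)) ^ ?n = real (Suc q) powr (- real ?n / w)"
        by (subst powr_realpow[symmetric]) (simp_all add: powr_powr minus_divide_left[symmetric] del: of_nat_Suc of_nat_add)
      moreover have "\<phi> (Suc q) = \<psi> (Suc q) \<or> \<phi> (Suc q) = real (Suc q) powr (- 1 / w)"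
        by (auto simp: \<phi>_def max_def)
      moreover have "0 \<le> \<psi> (Suc q) ^ ?n" using \<psi>(1)[of "Suc q"] by simp
      ultimately have "\<phi> (Suc q) ^ ?n \<le> \<psi> (Suc q) ^ ?n + real (Suc q) powr (- real ?n / w)"
        by auto
      then show "norm (\<phi> (Suc q) ^ ?n) \<le> \<psi> (Suc q) ^ ?n + real (Suc q) powr (- real ?n / w)"
        using \<phi>_nn[of "Suc q"] by simp
    qed
    then show ?thesis by (subst (asm) summable_Suc_iff)
  qed
  then have sum2: "summable (\<lambda>t. 2 ^ t * \<phi> (2 ^ t) ^ ?n)"
    by (subst (asm) condensation_test) (auto intro!: power_mono \<phi>_mono \<phi>_nn simp: zero_le_power \<phi>_nn)
  obtain C where C: "1 \<le> C" and cover: "near_rational_bound A w 0 C"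
    using ex_near_rational_bound[OF c w(1) order_refl gap] by blast
  define K where "K = 1 + row_bound A"
  have K: "1 \<le> K" using row_bound_ge_1[of A] by (simp add: K_def)
  have local: "negligible ({x. graph_point A x \<in> psi_approximable \<psi>} \<inter> cube 0 (real R))" for R :: nat
  proof -
    define l where "l = real R + C + \<phi> 1"
    have l: "1 \<le> l" "C \<le> l" "\<phi> 1 \<le> l" "real R \<le> l"
      using C \<phi>_nn[of 1] by (auto simp: l_def)
    let ?E = "\<lambda>t. cube 0 l \<inter> near_rational A t (\<phi> (2 ^ t)) (K * \<phi> (2 ^ t))"
    have "\<exists>D\<in>lmeasurable. ?E t \<subseteq> D \<and>
        measure lebesgue D \<le> C * l ^ ?d * (1 + l) * (K * \<phi> (2 ^ t)) ^ ?m * \<phi> (2 ^ t) ^ ?d * 2 ^ t" for t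
    proof (rule near_rational_boundD[OF cover, of 0 l "K * \<phi> (2 ^ t)" "\<phi> (2 ^ t)" t])
      have p: "0 < \<phi> (2 ^ t)" by (rule \<phi>_pos) simp
      have t1: "1 * l \<le> 2 ^ t * l" using l by (intro mult_right_mono) auto
      show "0 < K * \<phi> (2 ^ t)" "0 \<le> \<phi> (2 ^ t)" using p K by auto
      show "1 \<le> 2 ^ t * l" "0 < l" using t1 l by linarith+
      have "\<phi> (2 ^ t) \<le> \<phi> 1" by (rule \<phi>_mono) auto
      then show "\<phi> (2 ^ t) \<le> 2 ^ t * l" using l t1 by linarith
      have "(2 ^ t) powr (- 1 / w) \<le> \<phi> (2 ^ t)" using \<phi>_ge(1)[of "2 ^ t"] by simp
      also have "\<dots> \<le> K * \<phi> (2 ^ t)" using mult_right_mono[OF K, of "\<phi> (2 ^ t)"] p by simp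
      finally have "(K * \<phi> (2 ^ t)) powr (- w) \<le> ((2 ^ t) powr (- 1 / w)) powr (- w)"
        using w by (intro powr_mono2') auto
      also have "\<dots> = 2 ^ t" using w by (simp add: powr_powr)
      finally have "C * (K * \<phi> (2 ^ t)) powr (- w) \<le> l * 2 ^ t"
        using l C by (intro mult_mono) auto
      then show "C * (K * \<phi> (2 ^ t)) powr (- w) \<le> 2 ^ t * l" by (simp add: mult.commute)
    qed auto
    then obtain D where D: "\<And>t. D t \<in> lmeasurable" "\<And>t. ?E t \<subseteq> D t"
      "\<And>t. measure lebesgue (D t) \<le> C * l ^ ?d * (1 + l) * (K * \<phi> (2 ^ t)) ^ ?m * \<phi> (2 ^ t) ^ ?d * 2 ^ t"
      by metis
    have "summable (\<lambda>t. measure lebesgue (D t))"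
    proof (rule summable_comparison_test'[of "\<lambda>t. C * l ^ ?d * (1 + l) * K ^ ?m * (2 ^ t * \<phi> (2 ^ t) ^ ?n)"])
      show "summable (\<lambda>t. C * l ^ ?d * (1 + l) * K ^ ?m * (2 ^ t * \<phi> (2 ^ t) ^ ?n))"
        using sum2 by (rule summable_mult)
      show "norm (measure lebesgue (D t)) \<le> C * l ^ ?d * (1 + l) * K ^ ?m * (2 ^ t * \<phi> (2 ^ t) ^ ?n)" for t
        using D(3)[of t] by (simp add: power_mult_distrib power_add mult_ac)
    qed
    then have "limsup D \<in> null_sets lebesgue"
      by (intro borel_cantelli_limsup1) (auto simp: emeasure_eq_measure2[OF D(1)] intro: fmeasurableD[OF D(1)])
    then have "negligible (limsup D)" by (simp add: negligible_iff_null_sets)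
    moreover have "{x. graph_point A x \<in> psi_approximable \<psi>} \<inter> cube 0 (real R) \<subseteq> limsup D"
    proof
      fix x assume "x \<in> {x. graph_point A x \<in> psi_approximable \<psi>} \<inter> cube 0 (real R)"
      then have inf: "infinite {q. 1 \<le> q \<and> int_dist (real q *\<^sub>R graph_point A x) < \<psi> q}" (is "infinite ?Q")
        and x: "x \<in> cube 0 l" using cube_mono[OF l(4)] by (auto simp: psi_approximable_def)
      have "\<exists>t\<ge>T. x \<in> D t" for T
      proof -
        obtain q where q: "2 ^ T \<le> q" "q \<in> ?Q"
          using inf by (meson infinite_nat_iff_unbounded_le)
        then obtain t where t: "2 ^ t \<le> q" "q < 2 ^ (t + 1)" using ex_power_ivl1[of 2 q] by auto
        have "(2::nat) ^ T < 2 ^ (t + 1)" using q(1) t(2) by linarith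
        then have "T < t + 1" by (subst (asm) power_strict_increasing_iff) auto
        then have "T \<le> t" by simp
        have "\<psi> q \<le> \<phi> (2 ^ t)" using \<phi>_ge(2)[of q] \<phi>_mono[of "2 ^ t" q] q t by force
        then have "int_dist (real q *\<^sub>R graph_point A x) < \<phi> (2 ^ t)" using q by auto
        from int_dist_graph_pointD[OF this] obtain b where
          b: "b None = int q" "\<And>i. \<bar>of_int (b None) * x $ i - of_int (b (Some i))\<bar> \<le> \<phi> (2 ^ t)"
            "int_dist (ivec b v* A) < K * \<phi> (2 ^ t)" by (auto simp: K_def)
        have "2 ^ t \<le> b None" "b None < 2 ^ (t + 1)"
          using t unfolding b(1) by (metis of_nat_le_iff of_nat_power of_nat_numeral, metis of_nat_less_iff of_nat_power of_nat_numeral)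
        then have "x \<in> ?E t" using b(2,3) x unfolding near_rational_def by blast
        then show ?thesis using D(2) \<open>T \<le> t\<close> by blast
      qed
      then show "x \<in> limsup D" by (auto simp: mem_limsup_iff frequently_sequentially)
    qed
    ultimately show ?thesis using negligible_subset by blast
  qed
  have "{x. graph_point A x \<in> psi_approximable \<psi>} \<subseteq> (\<Union>R::nat. {x. graph_point A x \<in> psi_approximable \<psi>} \<inter> cube 0 (real R))"
  proof clarsimp
    fix x :: "real^'d"
    obtain R where "infnorm x \<le> real (R::nat)" using real_arch_simple by blast
    then show "\<exists>R::nat. x \<in> cube 0 (real R)" by (auto simp: cube_def infnorm_cart_le_iff)
  qed
  moreover have "negligible (\<Union>R::nat. {x. graph_point A x \<in> psi_approximable \<psi>} \<inter> cube 0 (real R))"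
    using local by (intro negligible_countable_Union) auto
  ultimately show ?thesis using negligible_subset by blast
qed

section \<open>Separated families of cubes and limsup sets of full measure\<close>

definition separated :: "real \<Rightarrow> (real^'d) set \<Rightarrow> bool" where
  "separated r G \<longleftrightarrow> (\<forall>g\<in>G. \<forall>h\<in>G. g \<noteq> h \<longrightarrow> (\<exists>i. r < \<bar>g $ i - h $ i\<bar>))"

lemma separated_subset: "separated r G \<Longrightarrow> H \<subseteq> G \<Longrightarrow> separated r H"
  unfolding separated_def by blast

lemma exists_separated_net:
  fixes P :: "(real^'d::finite) set"
  assumes "finite P" "0 \<le> r"
  shows "\<exists>G\<subseteq>P. separated r G \<and> P \<subseteq> (\<Union>g\<in>G. cube g r)"
  using assms(1)
proof induction
  case empty
  then show ?case by (auto simp: separated_def)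
next
  case (insert p P)
  then obtain G where G: "G \<subseteq> P" "separated r G" "P \<subseteq> (\<Union>g\<in>G. cube g r)" by blast
  show ?case
  proof (cases "p \<in> (\<Union>g\<in>G. cube g r)")
    case True
    then show ?thesis using G by (intro exI[of _ G]) blast
  next
    case False
    then have far: "\<exists>i. r < \<bar>p $ i - g $ i\<bar>" if "g \<in> G" for g
      using that by (auto simp: cube_def not_le)
    then have "separated r (insert p G)"
      using G(2) unfolding separated_def by (metis abs_minus_commute insert_iff)
    moreover have "p \<in> cube p r" using assms(2) by (rule center_in_cube)
    ultimately show ?thesis using G(1,3) by (intro exI[of _ "insert p G"]) blast
  qed
qed

lemma disjnt_cubes_if_separated:
  assumes "separated r G" "2 * s \<le> r" "g \<in> G" "h \<in> G" "g \<noteq> h"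
  shows "disjnt (cube g s) (cube h s)"
proof -
  obtain i where i: "r < \<bar>g $ i - h $ i\<bar>" using assms unfolding separated_def by blast
  have False if "x \<in> cube g s" "x \<in> cube h s" for x
  proof -
    have "\<bar>x $ i - g $ i\<bar> \<le> s" "\<bar>x $ i - h $ i\<bar> \<le> s" using that by (auto simp: cube_def)
    then show False using i assms(2) by linarith
  qed
  then show ?thesis by (auto simp: disjnt_iff)
qed

lemma measure_UN_separated_cubes:
  fixes G :: "(real^'d::finite) set"
  assumes "finite G" "separated r G" "2 * s \<le> r" "0 \<le> s"
  shows "measure lebesgue (\<Union>g\<in>G. cube g s) = real (card G) * (2 * s) ^ CARD('d)"
proof -
  have "measure lebesgue (\<Union>g\<in>G. cube g s) = (\<Sum>g\<in>G. measure lebesgue (cube g s))"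
    using assms(1) disjnt_cubes_if_separated[OF assms(2,3)]
    by (intro measure_UNION') (auto simp: pairwise_def)
  then show ?thesis using assms(4) by (simp add: measure_cube)
qed

lemma card_separated_le:
  fixes G :: "(real^'d::finite) set"
  assumes "finite G" "separated r G" "0 \<le> r" "G \<subseteq> cube z \<rho>" "0 \<le> \<rho>"
  shows "real (card G) * r ^ CARD('d) \<le> (2 * \<rho> + r) ^ CARD('d)"
proof -
  have "real (card G) * r ^ CARD('d) = measure lebesgue (\<Union>g\<in>G. cube g (r / 2))"
    using measure_UN_separated_cubes[OF assms(1,2), of "r / 2"] assms(3) by simp
  also have "\<dots> \<le> measure lebesgue (cube z (\<rho> + r / 2))"
  proof (rule measure_mono_fmeasurable)
    show "(\<Union>g\<in>G. cube g (r / 2)) \<subseteq> cube z (\<rho> + r / 2)"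
      using assms(4) by (intro UN_least cube_subset_cube[where r=\<rho>]) auto
  qed (use assms(1) in \<open>auto intro!: sets.finite_UN\<close>)
  also have "\<dots> = (2 * \<rho> + r) ^ CARD('d)"
    using assms(3,5) by (simp add: measure_cube algebra_simps)
  finally show ?thesis .
qed

text \<open>
  The Cauchy-Schwarz inequality for the counting function of the sets and the indicator of their union,
  read off from the quadratic polynomial \<open>c \<mapsto> \<integral> (f - c 1\<^sub>U)\<^sup>2\<close> at its minimum.
\<close>
lemma second_moment_bound:
  assumes "finite F" and E: "\<And>t. t \<in> F \<Longrightarrow> E t \<in> fmeasurable M"
  shows "(\<Sum>t\<in>F. measure M (E t))\<^sup>2 \<le> measure M (\<Union>t\<in>F. E t) * (\<Sum>s\<in>F. \<Sum>t\<in>F. measure M (E s \<inter> E t))"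
proof -
  let ?U = "\<Union>t\<in>F. E t"
  let ?f = "\<lambda>x. \<Sum>t\<in>F. indicator (E t) x :: real"
  define a where "a = (\<Sum>t\<in>F. measure M (E t))"
  define b where "b = (\<Sum>s\<in>F. \<Sum>t\<in>F. measure M (E s \<inter> E t))"
  have U: "?U \<in> fmeasurable M" using assms by (intro fmeasurable.finite_UN) auto
  have int: "integrable M (indicator S :: _ \<Rightarrow> real)" and val: "integral\<^sup>L M (indicator S :: _ \<Rightarrow> real) = measure M S"
    if "S \<in> fmeasurable M" for S
    using that by (auto simp: fmeasurable_def top.not_eq_extremum sets.Int_space_eq2)
  have quad: "0 \<le> b - 2 * c * a + c\<^sup>2 * measure M ?U" for c
  proof -
    have eq: "(?f x - c * indicator ?U x)\<^sup>2 = (\<Sum>s\<in>F. \<Sum>t\<in>F. indicator (E s \<inter> E t) x) - 2 * c * ?f x + c\<^sup>2 * indicator ?U x" for x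
    proof (cases "x \<in> ?U")
      case True
      then show ?thesis
        by (simp add: power2_diff) (simp add: power2_eq_square sum_product indicator_inter_arith)
    next
      case False
      then have "\<And>t. t \<in> F \<Longrightarrow> x \<notin> E t" by blast
      then show ?thesis using False by (simp add: indicator_inter_arith)
    qed
    have "0 \<le> integral\<^sup>L M (\<lambda>x. (?f x - c * indicator ?U x)\<^sup>2)"
      by (rule integral_nonneg_AE) simp
    also have "\<dots> = b - 2 * c * a + c\<^sup>2 * measure M ?U"
      unfolding eq a_def b_def using E U by (simp add: int val fmeasurable_Int_fmeasurable fmeasurableD)
    finally show ?thesis .
  qed
  show ?thesis
  proof (cases "measure M ?U = 0")
    case True
    have "measure M (E t) = 0" if "t \<in> F" for t
    proof -
      have "measure M (E t) \<le> measure M ?U"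
        using that E U by (intro measure_mono_fmeasurable) (auto intro: fmeasurableD)
      then show ?thesis using True measure_nonneg[of M "E t"] by simp
    qed
    then show ?thesis using True by simp
  next
    case False
    then have p: "0 < measure M ?U" by (simp add: zero_less_measure_iff)
    have "0 \<le> (b - 2 * (a / measure M ?U) * a + (a / measure M ?U)\<^sup>2 * measure M ?U) * measure M ?U"
      using quad[of "a / measure M ?U"] p by (intro mult_nonneg_nonneg) auto
    also have "\<dots> = b * measure M ?U - a\<^sup>2" using p by (simp add: field_simps power2_eq_square)
    finally show ?thesis by (simp add: a_def b_def mult.commute)
  qed
qed

lemma sum_half_powers_le:
  assumes "finite F" "inj_on k F"
  shows "(\<Sum>s\<in>F. (1 / 2 :: real) ^ k s) \<le> 2"
proof -
  have "(\<Sum>s\<in>F. (1 / 2 :: real) ^ k s) = sum ((^) (1 / 2)) (k ` F)"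
    using assms by (simp add: sum.reindex)
  also have "\<dots> \<le> suminf ((^) (1 / 2 :: real))"
    using assms by (intro sum_le_suminf summable_geometric) auto
  also have "\<dots> = 2" by (simp add: suminf_geometric)
  finally show ?thesis .
qed

lemma sum_half_power_dist_le:
  fixes F :: "nat set"
  assumes "finite F"
  shows "(\<Sum>s\<in>F. (1 / 2 :: real) ^ nat \<bar>int t - int s\<bar>) \<le> 4"
proof -
  have "(\<Sum>s\<in>F. (1 / 2 :: real) ^ nat \<bar>int t - int s\<bar>)
      \<le> (\<Sum>s\<in>{s\<in>F. s \<le> t}. (1 / 2) ^ nat \<bar>int t - int s\<bar>) + (\<Sum>s\<in>{s\<in>F. t < s}. (1 / 2) ^ nat \<bar>int t - int s\<bar>)"
    using assms by (subst sum.union_disjoint[symmetric]) (auto intro!: sum_mono2)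
  also have "\<dots> \<le> 2 + 2"
    using assms by (intro add_mono sum_half_powers_le) (auto simp: inj_on_def)
  finally show ?thesis by simp
qed

text \<open>
  Let \<open>E t\<close> be the union of the cubes of radius \<open>\<rho> t\<close> about \<open>G t\<close>, and \<open>v t = (\<rho> t / r t)\<^sup>d\<close>. The measure of
  \<open>E t\<close> is comparable to \<open>v t l\<^sup>d\<close>. For \<open>s < t\<close> a cube of \<open>E s\<close> meets at most a constant times
  \<open>1 + (\<rho> s / r t)\<^sup>d\<close> cubes of \<open>E t\<close>, so \<open>E s \<inter> E t\<close> has measure at most a constant times
  \<open>(v s v t + (r t / r s)\<^sup>d v t) l\<^sup>d\<close>. The growth hypothesis makes the second term summable over \<open>s\<close>, and
  the second moment bound applies. The resulting constant depends on \<open>c\<close> and \<open>d\<close>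
  only, in particular not on the cube.
\<close>
lemma measure_UN_separated_family_ge:
  fixes G :: "nat \<Rightarrow> (real^'d::finite) set"
  assumes F: "finite F" and c: "0 \<le> c" and l: "0 < l"
    and G: "\<And>t. t \<in> F \<Longrightarrow> finite (G t)" "\<And>t. t \<in> F \<Longrightarrow> separated (r t) (G t)" "\<And>t. t \<in> F \<Longrightarrow> G t \<subseteq> cube z l"
    and r: "\<And>t. t \<in> F \<Longrightarrow> 0 < \<rho> t" "\<And>t. t \<in> F \<Longrightarrow> 2 * \<rho> t \<le> r t" "\<And>t. t \<in> F \<Longrightarrow> r t \<le> l"
    and many: "\<And>t. t \<in> F \<Longrightarrow> c * l ^ CARD('d) \<le> real (card (G t)) * r t ^ CARD('d)"
    and growth: "\<And>s t. s \<in> F \<Longrightarrow> t \<in> F \<Longrightarrow> s < t \<Longrightarrow> r t ^ CARD('d) * 2 ^ (t - s) \<le> r s ^ CARD('d)"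
    and big: "1 \<le> (\<Sum>t\<in>F. (\<rho> t / r t) ^ CARD('d))"
  shows "c\<^sup>2 / (9 * 6 ^ CARD('d)) * l ^ CARD('d) \<le> measure lebesgue (\<Union>t\<in>F. \<Union>g\<in>G t. cube g (\<rho> t))"
proof -
  let ?d = "CARD('d)"
  have p8: "(4::real) ^ ?d * 2 ^ ?d = 8 ^ ?d" and p24: "(3::real) ^ ?d * 8 ^ ?d = 24 ^ ?d"
    and p6: "(3::real) ^ ?d * 2 ^ ?d = 6 ^ ?d"
    by (simp_all add: power_mult_distrib[symmetric])
  define E where "E t = (\<Union>g\<in>G t. cube g (\<rho> t))" for t
  define v where "v t = (\<rho> t / r t) ^ ?d" for t
  define S where "S = (\<Sum>t\<in>F. v t)"
  have r0: "0 < r t" if "t \<in> F" for t using r[OF that] by linarith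
  have v0: "0 \<le> v t" if "t \<in> F" for t using r0[OF that] r(1)[OF that] by (simp add: v_def)
  have E: "E t \<in> lmeasurable" if "t \<in> F" for t
    unfolding E_def using G(1)[OF that] by (intro fmeasurable.finite_UN) auto
  have mE: "measure lebesgue (E t) = real (card (G t)) * (2 * \<rho> t) ^ ?d" if "t \<in> F" for t
    unfolding E_def using G r that by (intro measure_UN_separated_cubes[where r="r t"]) (auto intro: less_imp_le)
  have \<rho>v: "\<rho> t ^ ?d = v t * r t ^ ?d" if "t \<in> F" for t
    using r0[OF that] by (simp add: v_def power_divide)
  have lower: "2 ^ ?d * c * l ^ ?d * v t \<le> measure lebesgue (E t)" if "t \<in> F" for t
  proof -
    have "(c * l ^ ?d) * (2 ^ ?d * v t) \<le> (real (card (G t)) * r t ^ ?d) * (2 ^ ?d * v t)"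
      using many[OF that] v0[OF that] by (intro mult_right_mono) auto
    then show ?thesis using that by (simp add: mE power_mult_distrib \<rho>v mult_ac)
  qed
  have upper: "real (card (G t)) * r t ^ ?d \<le> 3 ^ ?d * l ^ ?d" if "t \<in> F" for t
  proof -
    have "real (card (G t)) * r t ^ ?d \<le> (2 * l + r t) ^ ?d"
      using G r0 that l by (intro card_separated_le[where z=z]) (auto intro: less_imp_le)
    also have "\<dots> \<le> (3 * l) ^ ?d" using r(3)[OF that] r0[OF that] l by (intro power_mono) auto
    finally show ?thesis by (simp add: power_mult_distrib)
  qed
  have ov: "measure lebesgue (E s \<inter> E t) \<le> 24 ^ ?d * l ^ ?d * (v s * v t + (1 / 2) ^ (t - s) * v t)"
    if st: "s \<in> F" "t \<in> F" "s < t" for s t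
  proof -
    define H where "H g = G t \<inter> cube g (\<rho> s + \<rho> t)" for g
    have finH: "finite (H g)" for g using G(1) st by (simp add: H_def)
    have cH: "real (card (H g)) * r t ^ ?d \<le> 4 ^ ?d * (\<rho> s ^ ?d + r t ^ ?d)" for g
    proof -
      have "real (card (H g)) * r t ^ ?d \<le> (2 * (\<rho> s + \<rho> t) + r t) ^ ?d"
        using r r0 st finH by (intro card_separated_le[where z=g] separated_subset[OF G(2)[OF st(2)]])
          (auto simp: H_def intro: less_imp_le add_nonneg_nonneg)
      also have "\<dots> \<le> (4 * max (\<rho> s) (r t)) ^ ?d"
        using r(1)[OF st(1)] r(1,2)[OF st(2)] by (intro power_mono) auto
      also have "\<dots> = 4 ^ ?d * max (\<rho> s) (r t) ^ ?d" by (simp add: power_mult_distrib)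
      also have "\<dots> \<le> 4 ^ ?d * (\<rho> s ^ ?d + r t ^ ?d)"
        using r(1)[OF st(1)] r0[OF st(2)] by (intro mult_left_mono) (auto simp: max_def)
      finally show ?thesis .
    qed
    have sub: "E s \<inter> E t \<subseteq> (\<Union>g\<in>G s. \<Union>h\<in>H g. cube h (\<rho> t))"
    proof
      fix x assume "x \<in> E s \<inter> E t"
      then obtain g h where gh: "g \<in> G s" "h \<in> G t" "x \<in> cube g (\<rho> s)" "x \<in> cube h (\<rho> t)"
        by (auto simp: E_def)
      have "\<bar>h $ i - g $ i\<bar> \<le> \<rho> s + \<rho> t" for i
      proof -
        have "\<bar>x $ i - g $ i\<bar> \<le> \<rho> s" "\<bar>x $ i - h $ i\<bar> \<le> \<rho> t" using gh by (auto simp: cube_def)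
        then show ?thesis by linarith
      qed
      then have "h \<in> H g" using gh by (simp add: H_def cube_def)
      then show "x \<in> (\<Union>g\<in>G s. \<Union>h\<in>H g. cube h (\<rho> t))" using gh by blast
    qed
    have "measure lebesgue (E s \<inter> E t) \<le> measure lebesgue (\<Union>g\<in>G s. \<Union>h\<in>H g. cube h (\<rho> t))"
      using sub G(1)[OF st(1)] finH E st
      by (intro measure_mono_fmeasurable fmeasurable.finite_UN) (auto intro!: sets.Int fmeasurableD)
    also have "\<dots> \<le> (\<Sum>g\<in>G s. measure lebesgue (\<Union>h\<in>H g. cube h (\<rho> t)))"
      using G(1)[OF st(1)] finH by (intro measure_UNION_le) (auto intro!: sets.finite_UN)
    also have "\<dots> \<le> (\<Sum>g\<in>G s. 8 ^ ?d * (\<rho> s ^ ?d + r t ^ ?d) * v t)"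
    proof (rule sum_mono)
      fix g
      have "measure lebesgue (\<Union>h\<in>H g. cube h (\<rho> t)) \<le> real (card (H g)) * (2 * \<rho> t) ^ ?d"
        using finH r(1)[OF st(2)] measure_finite_UN_cubes_le[of "H g" "\<rho> t" "\<lambda>h. h"] by simp
      also have "\<dots> = (real (card (H g)) * r t ^ ?d) * (2 ^ ?d * v t)"
        using st by (simp add: power_mult_distrib \<rho>v)
      also have "\<dots> \<le> (4 ^ ?d * (\<rho> s ^ ?d + r t ^ ?d)) * (2 ^ ?d * v t)"
        using cH v0[OF st(2)] by (intro mult_right_mono) auto
      also have "\<dots> = 8 ^ ?d * (\<rho> s ^ ?d + r t ^ ?d) * v t"
        by (simp add: p8[symmetric] mult_ac)
      finally show "measure lebesgue (\<Union>h\<in>H g. cube h (\<rho> t)) \<le> 8 ^ ?d * (\<rho> s ^ ?d + r t ^ ?d) * v t" .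
    qed
    also have "\<dots> = real (card (G s)) * (8 ^ ?d * (\<rho> s ^ ?d + r t ^ ?d) * v t)" by simp
    also have "\<dots> \<le> real (card (G s)) * (8 ^ ?d * (r s ^ ?d * (v s + (1 / 2) ^ (t - s))) * v t)"
    proof -
      have "r t ^ ?d \<le> r s ^ ?d * (1 / 2) ^ (t - s)"
        using growth[OF st] by (simp add: field_simps power_divide)
      then have "\<rho> s ^ ?d + r t ^ ?d \<le> r s ^ ?d * (v s + (1 / 2) ^ (t - s))"
        using \<rho>v[OF st(1)] by (simp add: algebra_simps)
      then show ?thesis using v0[OF st(2)] by (intro mult_left_mono mult_right_mono) auto
    qed
    also have "\<dots> = (real (card (G s)) * r s ^ ?d) * (8 ^ ?d * (v s * v t + (1 / 2) ^ (t - s) * v t))"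
      by (simp add: algebra_simps)
    also have "\<dots> \<le> (3 ^ ?d * l ^ ?d) * (8 ^ ?d * (v s * v t + (1 / 2) ^ (t - s) * v t))"
      using upper[OF st(1)] v0 st by (intro mult_right_mono) auto
    also have "\<dots> = 24 ^ ?d * l ^ ?d * (v s * v t + (1 / 2) ^ (t - s) * v t)"
      by (simp add: p24[symmetric] mult_ac)
    finally show ?thesis .
  qed
  let ?e = "\<lambda>s t. (1 / 2 :: real) ^ nat \<bar>int t - int s\<bar>"
  have ov': "measure lebesgue (E s \<inter> E t) \<le> 24 ^ ?d * l ^ ?d * (v s * v t + ?e s t * (v s + v t))"
    if st: "s \<in> F" "t \<in> F" for s t
  proof -
    have nn: "0 \<le> v s" "0 \<le> v t" "0 \<le> v s * v t" using v0 st by auto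
    have lp: "0 \<le> 24 ^ ?d * l ^ ?d" using l by simp
    consider "s < t" | "t < s" | "s = t" by linarith
    then show ?thesis
    proof cases
      case 1
      have "nat \<bar>int t - int s\<bar> = t - s" using 1 by linarith
      then have e: "?e s t = (1 / 2) ^ (t - s)" by (simp only:)
      have "(1 / 2) ^ (t - s) * v t \<le> ?e s t * (v s + v t)"
        unfolding e using nn by (intro mult_left_mono) auto
      then have "v s * v t + (1 / 2) ^ (t - s) * v t \<le> v s * v t + ?e s t * (v s + v t)" by linarith
      then show ?thesis using ov[OF st 1] mult_left_mono[OF _ lp] order_trans by blast
    next
      case 2
      have "nat \<bar>int t - int s\<bar> = s - t" using 2 by linarith
      then have e: "?e s t = (1 / 2) ^ (s - t)" by (simp only:)
      have "(1 / 2) ^ (s - t) * v s \<le> ?e s t * (v s + v t)"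
        unfolding e using nn by (intro mult_left_mono) auto
      then have "v t * v s + (1 / 2) ^ (s - t) * v s \<le> v s * v t + ?e s t * (v s + v t)"
        by (simp only: mult.commute[of "v t" "v s"])
      then have "measure lebesgue (E t \<inter> E s) \<le> 24 ^ ?d * l ^ ?d * (v s * v t + ?e s t * (v s + v t))"
        using ov[OF st(2,1) 2] mult_left_mono[OF _ lp] order_trans by blast
      then show ?thesis by (simp add: Int_commute)
    next
      case 3
      have "measure lebesgue (E t) = (real (card (G t)) * r t ^ ?d) * (2 ^ ?d * v t)"
        using st by (simp add: mE power_mult_distrib \<rho>v)
      also have "\<dots> \<le> (3 ^ ?d * l ^ ?d) * (2 ^ ?d * v t)"
        using upper[OF st(2)] nn by (intro mult_right_mono) auto
      also have "\<dots> = 6 ^ ?d * l ^ ?d * v t"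
        by (simp add: p6[symmetric] mult_ac)
      also have "\<dots> \<le> 24 ^ ?d * l ^ ?d * (v s * v t + ?e s t * (v s + v t))"
      proof (rule mult_mono)
        show "6 ^ ?d * l ^ ?d \<le> 24 ^ ?d * l ^ ?d" using l by (intro mult_right_mono power_mono) auto
        show "v t \<le> v s * v t + ?e s t * (v s + v t)" using 3 nn by simp
      qed (use nn lp in auto)
      finally show ?thesis using 3 by simp
    qed
  qed
  have S1: "1 \<le> S" using big by (simp add: S_def v_def)
  have sum_ov: "(\<Sum>s\<in>F. \<Sum>t\<in>F. measure lebesgue (E s \<inter> E t)) \<le> 24 ^ ?d * l ^ ?d * (9 * S\<^sup>2)"
  proof -
    have "(\<Sum>s\<in>F. \<Sum>t\<in>F. measure lebesgue (E s \<inter> E t))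
      \<le> (\<Sum>s\<in>F. \<Sum>t\<in>F. 24 ^ ?d * l ^ ?d * (v s * v t + ?e s t * (v s + v t)))"
      by (intro sum_mono ov')
    also have "\<dots> = 24 ^ ?d * l ^ ?d * ((\<Sum>s\<in>F. \<Sum>t\<in>F. v s * v t) + (\<Sum>s\<in>F. \<Sum>t\<in>F. ?e s t * v s) + (\<Sum>s\<in>F. \<Sum>t\<in>F. ?e s t * v t))"
      by (simp add: sum_distrib_left[symmetric] sum.distrib distrib_left add.assoc)
    also have "(\<Sum>s\<in>F. \<Sum>t\<in>F. ?e s t * v t) = (\<Sum>s\<in>F. \<Sum>t\<in>F. ?e s t * v s)"
      by (subst sum.swap) (simp add: abs_minus_commute)
    also have "(\<Sum>s\<in>F. \<Sum>t\<in>F. v s * v t) = S\<^sup>2"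
      by (simp add: S_def power2_eq_square sum_product)
    also have "24 ^ ?d * l ^ ?d * (S\<^sup>2 + (\<Sum>s\<in>F. \<Sum>t\<in>F. ?e s t * v s) + (\<Sum>s\<in>F. \<Sum>t\<in>F. ?e s t * v s))
        \<le> 24 ^ ?d * l ^ ?d * (9 * S\<^sup>2)"
    proof (rule mult_left_mono)
      have "(\<Sum>s\<in>F. \<Sum>t\<in>F. ?e s t * v s) = (\<Sum>s\<in>F. v s * (\<Sum>t\<in>F. ?e t s))"
        by (simp add: sum_distrib_left mult.commute abs_minus_commute)
      also have "\<dots> \<le> (\<Sum>s\<in>F. v s * 4)"
        using v0 by (intro sum_mono mult_left_mono sum_half_power_dist_le F) auto
      also have "\<dots> = 4 * S" by (simp add: S_def sum_distrib_right[symmetric])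
      also have "\<dots> \<le> 4 * S\<^sup>2" using S1 by (simp add: power2_eq_square)
      finally show "S\<^sup>2 + (\<Sum>s\<in>F. \<Sum>t\<in>F. ?e s t * v s) + (\<Sum>s\<in>F. \<Sum>t\<in>F. ?e s t * v s) \<le> 9 * S\<^sup>2" by linarith
    qed (use l in auto)
    finally show ?thesis .
  qed
  let ?U = "\<Union>t\<in>F. E t"
  have "2 ^ ?d * c * l ^ ?d * S \<le> (\<Sum>t\<in>F. measure lebesgue (E t))"
    unfolding S_def sum_distrib_left by (intro sum_mono lower)
  then have "(2 ^ ?d * c * l ^ ?d * S)\<^sup>2 \<le> (\<Sum>t\<in>F. measure lebesgue (E t))\<^sup>2"
    using c l S1 by (intro power_mono) auto
  also have "\<dots> \<le> measure lebesgue ?U * (\<Sum>s\<in>F. \<Sum>t\<in>F. measure lebesgue (E s \<inter> E t))"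
    by (rule second_moment_bound[OF F E])
  also have "\<dots> \<le> measure lebesgue ?U * (24 ^ ?d * l ^ ?d * (9 * S\<^sup>2))"
    by (intro mult_left_mono sum_ov) auto
  finally have fin: "(2 ^ ?d * c * l ^ ?d * S)\<^sup>2 \<le> measure lebesgue ?U * (24 ^ ?d * l ^ ?d * (9 * S\<^sup>2))" .
  have "(2 ^ ?d * c * l ^ ?d * S)\<^sup>2 = (c\<^sup>2 / (9 * 6 ^ ?d) * l ^ ?d) * (24 ^ ?d * l ^ ?d * (9 * S\<^sup>2))"
  proof -
    have "(24::real) ^ ?d = 2 ^ ?d * 2 ^ ?d * 6 ^ ?d"
      by (simp add: power_mult_distrib[symmetric])
    then show ?thesis by (simp add: power2_eq_square)
  qed
  with fin have "(c\<^sup>2 / (9 * 6 ^ ?d) * l ^ ?d) * (24 ^ ?d * l ^ ?d * (9 * S\<^sup>2)) \<le> measure lebesgue ?U * (24 ^ ?d * l ^ ?d * (9 * S\<^sup>2))"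
    by simp
  moreover have "0 < 24 ^ ?d * l ^ ?d * (9 * S\<^sup>2)" using l S1 by simp
  ultimately show ?thesis unfolding E_def by (simp only: mult_le_cancel_right_pos)
qed

lemma not_summable_finite_tail:
  fixes u :: "nat \<Rightarrow> real"
  assumes "\<And>t. 0 \<le> u t" "\<not> summable (\<lambda>t. if t \<in> T then u t else 0)"
  shows "\<exists>F\<subseteq>T \<inter> {N..}. finite F \<and> B \<le> (\<Sum>t\<in>F. u t)"
proof (rule ccontr)
  assume *: "\<not> ?thesis"
  have "summable (\<lambda>t. if t \<in> T then u t else 0)"
  proof (rule summableI_nonneg_bounded[where x="(\<Sum>t<N. u t) + B"])
    fix n
    let ?F = "T \<inter> {N..<n}"
    have "\<not> B \<le> (\<Sum>t\<in>?F. u t)" 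
    proof
      assume "B \<le> (\<Sum>t\<in>?F. u t)"
      moreover have "finite ?F" "?F \<subseteq> T \<inter> {N..}" by auto
      ultimately show False using * by (elim notE) (rule exI[of _ ?F], intro conjI)
    qed
    moreover have "(\<Sum>t<n. if t \<in> T then u t else 0) \<le> (\<Sum>t<N. u t) + (\<Sum>t\<in>?F. u t)"
    proof -
      have "(\<Sum>t<n. if t \<in> T then u t else 0) = (\<Sum>t\<in>T \<inter> {..<n}. u t)"
        using sum.inter_restrict[of "{..<n}" u T] by (simp add: Int_commute)
      also have "\<dots> \<le> (\<Sum>t\<in>{..<N} \<union> ?F. u t)"
        using assms(1) by (intro sum_mono2) auto
      also have "\<dots> = (\<Sum>t<N. u t) + (\<Sum>t\<in>?F. u t)"
        by (intro sum.union_disjoint) auto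
      finally show ?thesis .
    qed
    ultimately show "(\<Sum>t<n. if t \<in> T then u t else 0) \<le> (\<Sum>t<N. u t) + B" by linarith
  qed (use assms in auto)
  then show False using assms(2) by blast
qed

text \<open>
  A level that is not a record is dominated by an earlier record \<open>s\<close>, in the sense that
  \<open>2\<^sup>t \<phi>(t)\<^sup>m \<le> 2\<^sup>s \<phi>(s)\<^sup>m\<close>. Raising this to the power \<open>(d + m)/m\<close> shows that the term at \<open>t\<close> is at most \<open>\<theta>\<close> to
  the power \<open>t - s\<close> times the term at \<open>s\<close>, for a fixed \<open>\<theta> < 1\<close>. So the full series is dominated by the
  convolution of the record series with a geometric one. Restricting to records replaces a regularity
  assumption on the approximation function.
\<close>
lemma records_not_summable:
  fixes \<phi> :: "nat \<Rightarrow> real"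
  assumes \<phi>: "\<And>t. 0 < \<phi> t" and d: "0 < d" "0 < m"
    and div: "\<not> summable (\<lambda>t. 2 ^ t * \<phi> t ^ (d + m))"
    and T: "T = {t. \<forall>s<t. 2 ^ s * \<phi> s ^ m \<le> 2 ^ t * \<phi> t ^ m}"
  shows "\<not> summable (\<lambda>t. if t \<in> T then 2 ^ t * \<phi> t ^ (d + m) else 0)"
proof
  let ?v = "\<lambda>t. 2 ^ t * \<phi> t ^ (d + m)"
  let ?u = "\<lambda>t. if t \<in> T then ?v t else 0"
  assume su: "summable ?u"
  \<comment> \<open>This is 2 to the power \<open>-d/m\<close>.\<close>
  define \<theta> where "\<theta> = root m ((1 / 2) ^ d)"
  have \<theta>m: "\<theta> ^ m = (1 / 2) ^ d" using d by (simp add: \<theta>_def)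
  have \<theta>: "0 < \<theta>" "\<theta> < 1" using d power_strict_decreasing[of 0 d "1 / 2 :: real"] by (auto simp: \<theta>_def)
  have rec: "\<exists>s\<in>T. s \<le> t \<and> 2 ^ t * \<phi> t ^ m \<le> 2 ^ s * \<phi> s ^ m" for t
  proof (induction t rule: less_induct)
    case (less t)
    show ?case
    proof (cases "t \<in> T")
      case False
      then obtain s where s: "s < t" "2 ^ t * \<phi> t ^ m \<le> 2 ^ s * \<phi> s ^ m" by (auto simp: T not_le)
      then show ?thesis using less[of s] by (meson less_imp_le order_trans)
    qed auto
  qed
  have dom: "\<exists>s\<in>T. s \<le> t \<and> ?v t \<le> ?v s * \<theta> ^ (t - s)" for t
  proof -
    obtain s where s: "s \<in> T" "s \<le> t" "2 ^ t * \<phi> t ^ m \<le> 2 ^ s * \<phi> s ^ m" using rec by blast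
    obtain k where k: "t = s + k" using s(2) le_Suc_ex by blast
    have "(2 ^ t * \<phi> t ^ m) ^ (d + m) \<le> (2 ^ s * \<phi> s ^ m) ^ (d + m)"
      using s(3) \<phi>[of t] by (intro power_mono) (auto intro: less_imp_le)
    then have 1: "2 ^ (t * (d + m)) * \<phi> t ^ (m * (d + m)) \<le> 2 ^ (s * (d + m)) * \<phi> s ^ (m * (d + m))"
      by (simp add: power_mult_distrib power_mult)
    have gen: "(?v t) ^ m * 2 ^ (t * d) = 2 ^ (t * (d + m)) * \<phi> t ^ (m * (d + m))" for t
      by (simp add: power_mult_distrib power_mult[symmetric] power_add[symmetric] algebra_simps)
    have "(?v s * \<theta> ^ (t - s)) ^ m * 2 ^ (t * d) = 2 ^ (s * (d + m)) * \<phi> s ^ (m * (d + m))"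
    proof -
      have "(\<theta> ^ (t - s)) ^ m = (1 / 2) ^ (d * k)"
        using \<theta>m k by (metis add_diff_cancel_left' mult.commute power_mult)
      then have "(?v s * \<theta> ^ (t - s)) ^ m * 2 ^ (t * d) = (?v s) ^ m * 2 ^ (s * d) * ((1 / 2) ^ (d * k) * 2 ^ (k * d))"
        by (simp add: power_mult_distrib k power_add algebra_simps)
      also have "(1 / 2) ^ (d * k) * 2 ^ (k * d) = (1::real)"
        by (simp add: power_divide mult.commute)
      finally show ?thesis by (simp only: mult_1_right gen)
    qed
    then have "(?v t) ^ m * 2 ^ (t * d) \<le> (?v s * \<theta> ^ (t - s)) ^ m * 2 ^ (t * d)"
      using 1 gen[of t] by linarith
    then have "(?v t) ^ m \<le> (?v s * \<theta> ^ (t - s)) ^ m" by simp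
    then have "?v t \<le> ?v s * \<theta> ^ (t - s)"
      by (rule power_le_imp_le_base[where n="m - 1", unfolded Suc_diff_1[OF d(2)]])
         (use \<phi>[of s] \<theta> d in \<open>auto intro!: mult_nonneg_nonneg less_imp_le\<close>)
    then show ?thesis using s by blast
  qed
  have u0: "0 \<le> ?u t" for t using \<phi>[of t] by (auto intro: less_imp_le)
  have "summable (\<lambda>t. \<Sum>s\<le>t. ?u s * \<theta> ^ (t - s))"
    using su \<theta> u0 by (intro summable_Cauchy_product) (auto simp del: if_split intro: summable_geometric)
  then have "summable ?v"
  proof (rule summable_comparison_test')
    fix t
    obtain s where s: "s \<in> T" "s \<le> t" "?v t \<le> ?v s * \<theta> ^ (t - s)" using dom by blast
    have "?v t \<le> ?u s * \<theta> ^ (t - s)" using s by simp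
    also have "\<dots> \<le> (\<Sum>s\<le>t. ?u s * \<theta> ^ (t - s))"
      using s u0 \<theta> by (intro member_le_sum[where f="\<lambda>s. ?u s * \<theta> ^ (t - s)"]) (auto simp del: if_split)
    finally show "norm (?v t) \<le> (\<Sum>s\<le>t. ?u s * \<theta> ^ (t - s))"
      using \<phi>[of t] by (simp add: abs_mult power_abs del: if_split)
  qed
  then show False using div by blast
qed

text \<open>
  An elementary substitute for the Lebesgue density theorem. Let \<open>N\<close> be the complement of \<open>X\<close>. Cover \<open>N\<close> by
  countably many non-overlapping dyadic cubes inside an open set of measure at most \<open>\<mu>(N) + e\<close>. Since \<open>X\<close>
  occupies a proportion \<open>\<eta>'\<close> of each of them, \<open>\<mu>(N) \<le> (1 - \<eta>')(\<mu>(N) + e)\<close>, which forces \<open>\<mu>(N) = 0\<close>.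
\<close>
lemma negligible_if_uniformly_dense:
  fixes X :: "(real^'d::finite) set"
  assumes X: "X \<in> sets lebesgue" and \<eta>: "0 < \<eta>"
    and dense: "\<And>z l. z \<in> cube z0 1 \<Longrightarrow> 0 < l \<Longrightarrow> l \<le> 1 \<Longrightarrow> \<eta> * l ^ CARD('d) \<le> measure lebesgue (cube z l \<inter> X)"
  shows "negligible (cube z0 1 - X)"
proof -
  let ?\<mu> = "measure lebesgue"
  define N where "N = cube z0 1 - X"
  have N: "N \<in> lmeasurable" unfolding N_def using X by (intro fmeasurable_Diff) auto
  define \<eta>' where "\<eta>' = \<eta> / 2 ^ CARD('d)"
  have \<eta>': "0 < \<eta>'" using \<eta> by (simp add: \<eta>'_def)
  have main: "?\<mu> N \<le> (1 - \<eta>') * (?\<mu> N + e) \<or> 1 - \<eta>' < 0 \<and> ?\<mu> N \<le> 0" if e: "0 < e" for e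
  proof -
    obtain O' where O': "open O'" "N \<subseteq> O'" "O' - N \<in> lmeasurable" "emeasure lebesgue (O' - N) < ennreal e"
      using sets_lebesgue_outer_open[OF fmeasurableD[OF N] e] by blast
    have mO: "?\<mu> (O' - N) < e"
      using O'(3,4) by (simp add: emeasure_eq_measure2 ennreal_less_iff)
    define g where "g x = (if x \<in> O' then O' else UNIV)" for x
    have gauge: "gauge g" using O'(1) by (auto simp: gauge_def g_def)
    let ?a = "z0 - (\<chi> i. 1)" and ?b = "z0 + (\<chi> i. 1)"
    have Nab: "N \<subseteq> cbox ?a ?b" by (auto simp: N_def cube_eq_cbox)
    have ne: "box ?a ?b \<noteq> {}" by (simp add: interval_ne_empty_cart)
    obtain \<D> where \<D>: "countable \<D>" "\<Union>\<D> \<subseteq> cbox ?a ?b"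
      "\<And>K. K \<in> \<D> \<Longrightarrow> interior K \<noteq> {} \<and> (\<exists>c d. K = cbox c d)"
      "pairwise (\<lambda>A B. interior A \<inter> interior B = {}) \<D>"
      "\<And>K. K \<in> \<D> \<Longrightarrow> \<exists>x \<in> N \<inter> K. K \<subseteq> g x"
      "\<And>u v. cbox u v \<in> \<D> \<Longrightarrow> \<exists>n. \<forall>i \<in> Basis. v \<bullet> i - u \<bullet> i = (?b \<bullet> i - ?a \<bullet> i) / 2^n"
      "N \<subseteq> \<Union>\<D>"
      using covering_lemma[OF Nab ne gauge] by metis
    have Kcube: "\<exists>z l. z \<in> cube z0 1 \<and> 0 < l \<and> l \<le> 1 \<and> K = cube z l" if K: "K \<in> \<D>" for K
    proof -
      obtain u v where uv: "K = cbox u v" using \<D>(3)[OF K] by blast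
      obtain n where n: "\<forall>i \<in> Basis. v \<bullet> i - u \<bullet> i = (?b \<bullet> i - ?a \<bullet> i) / 2^n"
        using \<D>(6) K uv by blast
      have len: "v $ i - u $ i = 2 / 2 ^ n" for i
        using n[rule_format, of "axis i 1"] by (simp add: cart_eq_inner_axis[symmetric])
      have l2: "v $ i = u $ i + 2 / 2 ^ n" for i using len[of i] by simp
      define z where "z = (\<chi> i. (u $ i + v $ i) / 2)"
      have "z - (\<chi> i. 1 / 2 ^ n) = u" "z + (\<chi> i. 1 / 2 ^ n) = v"
        by (auto simp: vec_eq_iff z_def l2 field_simps)
      then have "K = cube z (1 / 2 ^ n)" using uv by (simp add: cube_eq_cbox)
      moreover have "z \<in> K" unfolding \<open>K = cube z (1 / 2 ^ n)\<close> by (rule center_in_cube) simp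
      then have "z \<in> cube z0 1" using \<D>(2) K by (auto simp: cube_eq_cbox)
      ultimately show ?thesis by (intro exI[of _ z] exI[of _ "1 / 2 ^ n"]) (simp add: divide_le_eq)
    qed
    have KX: "\<eta>' * ?\<mu> K \<le> ?\<mu> (K \<inter> X)" and Km: "K \<in> lmeasurable" if "K \<in> \<D>" for K
    proof -
      obtain z l where "z \<in> cube z0 1" "0 < l" "l \<le> 1" "K = cube z l" using Kcube \<open>K \<in> \<D>\<close> by blast
      then show "\<eta>' * ?\<mu> K \<le> ?\<mu> (K \<inter> X)" "K \<in> lmeasurable"
        using dense[of z l] by (simp_all add: measure_cube \<eta>'_def power_mult_distrib)
    qed
    have KXm: "K \<inter> X \<in> lmeasurable" if "K \<in> \<D>" for K
      using Km[OF that] X by (intro fmeasurable_Int_fmeasurable) auto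
    have overlap: "negligible (K \<inter> L)" if "K \<in> \<D>" "L \<in> \<D>" "K \<noteq> L" for K L
    proof -
      have "interior K \<inter> interior L = {}" using \<D>(4) that by (auto simp: pairwise_def)
      then have sub: "K \<inter> L \<subseteq> frontier K \<union> frontier L"
        using closure_subset[of K] closure_subset[of L] unfolding frontier_def by blast
      have "convex K" "convex L" using \<D>(3)[OF that(1)] \<D>(3)[OF that(2)] convex_box(1) by fast+
      then have "negligible (frontier K \<union> frontier L)"
        by (intro negligible_Un negligible_convex_frontier)
      then show ?thesis using sub by (rule negligible_subset)
    qed
    let ?V = "\<Union>\<D>"
    have V: "?V \<in> lmeasurable"
    proof (rule fmeasurableI2[of "cbox ?a ?b"])
      have "\<D> \<subseteq> sets lebesgue" using Km fmeasurableD by blast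
      then show "\<Union>\<D> \<in> sets lebesgue" using \<D>(1) by (rule sets.countable_Union[rotated])
    qed (use \<D>(2) in auto)
    have VX: "\<eta>' * ?\<mu> ?V \<le> ?\<mu> (?V \<inter> X)"
    proof (cases "\<D> = {}")
      case False
      define f where "f = from_nat_into \<D>"
      have f: "range f = \<D>" unfolding f_def using False \<D>(1) by (rule range_from_nat_into)
      define W where "W n = (\<Union>(f ` {..n}))" for n :: nat
      have fin: "\<eta>' * ?\<mu> (W n) \<le> ?\<mu> (W n \<inter> X)" for n
      proof -
        let ?I = "f ` {..n}"
        have sub: "?I \<subseteq> \<D>" using f by blast
        have "?\<mu> (W n) = (\<Sum>K\<in>?I. ?\<mu> K)"
          unfolding W_def
        proof (rule measure_negligible_finite_Union)
          show "pairwise (\<lambda>K L. negligible (K \<inter> L)) ?I"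
            unfolding pairwise_def using overlap sub by blast
        qed (use Km sub in auto)
        moreover have "?\<mu> (W n \<inter> X) = (\<Sum>K\<in>?I. ?\<mu> (K \<inter> X))"
        proof -
          have "W n \<inter> X = (\<Union>K\<in>?I. K \<inter> X)" by (auto simp: W_def)
          moreover have "?\<mu> (\<Union>K\<in>?I. K \<inter> X) = (\<Sum>K\<in>?I. ?\<mu> (K \<inter> X))"
          proof (rule measure_negligible_finite_Union_image)
            show "pairwise (\<lambda>K L. negligible (K \<inter> X \<inter> (L \<inter> X))) ?I"
              unfolding pairwise_def
            proof (intro ballI impI)
              fix K L assume "K \<in> ?I" "L \<in> ?I" "K \<noteq> L"
              then have "negligible (K \<inter> L)" using overlap sub by blast
              then show "negligible (K \<inter> X \<inter> (L \<inter> X))" by (rule negligible_subset) auto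
            qed
          qed (use KXm sub in auto)
          ultimately show ?thesis by simp
        qed
        moreover have "(\<Sum>K\<in>?I. \<eta>' * ?\<mu> K) \<le> (\<Sum>K\<in>?I. ?\<mu> (K \<inter> X))"
          using KX sub by (intro sum_mono) auto
        ultimately show ?thesis by (simp add: sum_distrib_left)
      qed
      have UW: "(\<Union>n. W n) = ?V" unfolding W_def f[symmetric] by auto
      have Wm: "W n \<in> sets lebesgue" for n
        unfolding W_def using f Km by (intro sets.finite_Union) (auto intro: fmeasurableD)
      have inc: "incseq W" unfolding W_def incseq_def by (auto intro: order_trans)
      have "(\<lambda>n. ?\<mu> (W n)) \<longlonglongrightarrow> ?\<mu> (\<Union>n. W n)"
        using Wm inc V UW by (intro Lim_measure_incseq) (auto simp: emeasure_eq_measure2)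
      moreover have "(\<lambda>n. ?\<mu> (W n \<inter> X)) \<longlonglongrightarrow> ?\<mu> (\<Union>n. W n \<inter> X)"
      proof (rule Lim_measure_incseq)
        show "incseq (\<lambda>n. W n \<inter> X)" using inc by (force simp: incseq_def)
        have "(\<Union>n. W n \<inter> X) \<in> lmeasurable"
          using V X UW by (metis Int_UN_distrib2 Sup.SUP_cong UN_extend_simps(4) fmeasurable_Int_fmeasurable)
        then show "emeasure lebesgue (\<Union>n. W n \<inter> X) \<noteq> \<infinity>" by (simp add: emeasure_eq_measure2)
      qed (use Wm X in auto)
      moreover have "(\<Union>n. W n \<inter> X) = ?V \<inter> X" using UW by blast
      ultimately show ?thesis
        using fin UW by (intro LIMSEQ_le[where X="\<lambda>n. \<eta>' * ?\<mu> (W n)" and Y="\<lambda>n. ?\<mu> (W n \<inter> X)"])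
          (auto intro!: tendsto_mult_left)
    qed simp
    have "?\<mu> N \<le> ?\<mu> (?V - X)"
      using \<D>(7) N V X by (intro measure_mono_fmeasurable fmeasurable_Diff) (auto simp: N_def intro: fmeasurableD)
    also have "\<dots> = ?\<mu> ?V - ?\<mu> (?V \<inter> X)"
    proof -
      have "?\<mu> (?V - ?V \<inter> X) = ?\<mu> ?V - ?\<mu> (?V \<inter> X)"
        using V X by (intro measurable_measure_Diff) (auto intro: fmeasurableD)
      then show ?thesis by (simp add: Diff_Int)
    qed
    finally have 1: "?\<mu> N \<le> (1 - \<eta>') * ?\<mu> ?V" using VX by (simp add: algebra_simps)
    have "?V \<subseteq> O'"
    proof
      fix x assume "x \<in> ?V"
      then obtain K where "K \<in> \<D>" "x \<in> K" by blast
      then show "x \<in> O'" using \<D>(5)[of K] O'(2) by (auto simp: g_def split: if_splits)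
    qed
    then have "?\<mu> ?V \<le> ?\<mu> (N \<union> (O' - N))"
      using V N O'(3) by (intro measure_mono_fmeasurable fmeasurable.Un) (auto intro: fmeasurableD)
    also have "\<dots> \<le> ?\<mu> N + ?\<mu> (O' - N)"
      using N O'(3) by (intro measure_Un_le) (auto intro: fmeasurableD)
    finally have 2: "?\<mu> ?V \<le> ?\<mu> N + e" using mO by linarith
    show ?thesis
    proof (cases "0 \<le> 1 - \<eta>'")
      case True
      then have "(1 - \<eta>') * ?\<mu> ?V \<le> (1 - \<eta>') * (?\<mu> N + e)" using 2 by (rule mult_left_mono[rotated])
      then show ?thesis using 1 by linarith
    next
      case False
      then have "(1 - \<eta>') * ?\<mu> ?V \<le> 0" by (simp add: mult_nonpos_nonneg)
      then show ?thesis using 1 False by linarith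
    qed
  qed
  have "?\<mu> N \<le> 0"
  proof (rule ccontr)
    assume "\<not> ?\<mu> N \<le> 0"
    then have p: "0 < ?\<mu> N" by simp
    have "?\<mu> N \<le> (1 - \<eta>') * (?\<mu> N + \<eta>' * ?\<mu> N)" using main[of "\<eta>' * ?\<mu> N"] p \<eta>' by auto
    then have "\<eta>' * \<eta>' * ?\<mu> N \<le> 0" by (simp add: algebra_simps)
    then show False using p \<eta>' by (simp add: mult_le_0_iff)
  qed
  then have "?\<mu> N = 0" using measure_nonneg[of lebesgue N] by linarith
  then show ?thesis using N unfolding N_def by (simp add: negligible_iff_measure)
qed

section \<open>Ubiquity of the rational points near the affine subspace\<close>

lemma same_cell_imp_close:
  assumes "0 < H" "\<lfloor>real H * u\<rfloor> = \<lfloor>real H * v\<rfloor>"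
  shows "\<bar>u - v\<bar> < 1 / real H"
proof -
  have "\<bar>real H * u - real H * v\<bar> < 1" using assms(2) by linarith
  then have "real H * \<bar>u - v\<bar> < 1" by (simp only: right_diff_distrib[symmetric] abs_mult abs_of_nat)
  then show ?thesis using assms(1) by (simp only: pos_less_divide_eq mult.commute of_nat_0_less_iff)
qed

lemma cell_index_bounds:
  "0 < H \<Longrightarrow> \<lfloor>real H * frac u\<rfloor> \<in> {0..<int H}"
  using frac_ge_0[of u] frac_lt_1[of u] by (simp add: floor_less_iff)

text \<open>
  Pigeonhole principle for the fractional parts of \<open>qx\<close> and of \<open>(q, \<lfloor>qx\<rfloor>)A\<close>, \<open>0 \<le> q \<le> Q\<close>. The
  second vector is not linear in \<open>q\<close>, but the difference of two of its values is again the image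
  of an integer vector under \<open>A\<close>.
\<close>
lemma Dirichlet_near_graph:
  fixes A :: "real^'m::finite^('d::finite option)" and x :: "real^'d"
  assumes \<delta>: "0 < \<delta>" "\<delta> \<le> 1" and \<alpha>: "0 < \<alpha>" "\<alpha> \<le> 1"
    and Q: "(2 / \<delta>) ^ CARD('d) * (2 / \<alpha>) ^ CARD('m) \<le> real Q"
  shows "\<exists>b. 1 \<le> b None \<and> b None \<le> int Q \<and> (\<forall>i. \<bar>of_int (b None) * x $ i - of_int (b (Some i))\<bar> \<le> \<delta>)
     \<and> int_dist (ivec b v* A) < \<alpha>"
proof -
  define H1 where "H1 = nat \<lceil>1 / \<delta>\<rceil>"
  define H2 where "H2 = nat \<lceil>1 / \<alpha>\<rceil>"
  have "1 \<le> 1 / \<delta>" "1 \<le> 1 / \<alpha>" using \<delta> \<alpha> by auto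
  then have H: "1 / \<delta> \<le> real H1" "real H1 \<le> 2 / \<delta>" "0 < H1" "1 / \<alpha> \<le> real H2" "real H2 \<le> 2 / \<alpha>" "0 < H2"
    unfolding H1_def H2_def by linarith+
  have inv: "1 / real H1 \<le> \<delta>" "1 / real H2 \<le> \<alpha>" using H \<delta> \<alpha> by (simp_all add: field_simps)
  define B where "B q k = (case k of None \<Rightarrow> int q | Some i \<Rightarrow> \<lfloor>real q * x $ i\<rfloor>)" for q and k :: "'d option"
  define y where "y q = ivec (B q) v* A" for q
  define cell where "cell q k = (case k of Inl i \<Rightarrow> \<lfloor>real H1 * frac (real q * x $ i)\<rfloor> | Inr j \<Rightarrow> \<lfloor>real H2 * frac (y q $ j)\<rfloor>)"
    for q and k :: "'d + 'm"
  let ?C = "PiE UNIV (\<lambda>k::'d + 'm. case k of Inl i \<Rightarrow> {0..<int H1} | Inr j \<Rightarrow> {0..<int H2})"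
  have "card ?C = H1 ^ CARD('d) * H2 ^ CARD('m)"
  proof -
    have "card ?C = (\<Prod>k\<in>UNIV <+> UNIV. card (case k of Inl (i::'d) \<Rightarrow> {0..<int H1} | Inr (j::'m) \<Rightarrow> {0..<int H2}))"
      by (simp add: card_PiE)
    also have "\<dots> = H1 ^ CARD('d) * H2 ^ CARD('m)"
      by (subst prod.Plus) auto
    finally show ?thesis .
  qed
  then have "real (card ?C) \<le> (2 / \<delta>) ^ CARD('d) * (2 / \<alpha>) ^ CARD('m)"
    using H \<delta> \<alpha> by (auto intro!: mult_mono power_mono)
  then have "real (card ?C) \<le> real Q" using Q by linarith
  then have "card ?C < card {0..Q}" by simp
  moreover have "cell ` {0..Q} \<subseteq> ?C"
    using cell_index_bounds[OF H(3)] cell_index_bounds[OF H(6)]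
    by (auto simp: cell_def split: sum.splits)
  moreover have "finite ?C" by (intro finite_PiE) (auto split: sum.splits)
  ultimately have "\<not> inj_on cell {0..Q}"
    by (meson card_inj_on_le not_le)
  then obtain p q where pq: "p < q" "q \<le> Q" "cell p = cell q"
    by (auto simp: inj_on_def) (metis nat_neq_iff)
  define b where "b k = B q k - B p k" for k
  have bN: "b None = int q - int p" by (simp add: b_def B_def)
  have "\<bar>of_int (b None) * x $ i - of_int (b (Some i))\<bar> \<le> \<delta>" for i
  proof -
    have "\<lfloor>real H1 * frac (real q * x $ i)\<rfloor> = \<lfloor>real H1 * frac (real p * x $ i)\<rfloor>"
      using fun_cong[OF pq(3), of "Inl i"] by (simp add: cell_def)
    from same_cell_imp_close[OF H(3) this]
    have "\<bar>frac (real q * x $ i) - frac (real p * x $ i)\<bar> \<le> \<delta>" using inv by linarith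
    then show ?thesis by (simp add: bN b_def B_def frac_def algebra_simps)
  qed
  moreover have "int_dist (ivec b v* A) < \<alpha>"
    unfolding int_dist_less_iff
  proof (intro exI allI)
    fix j
    have "\<lfloor>real H2 * frac (y q $ j)\<rfloor> = \<lfloor>real H2 * frac (y p $ j)\<rfloor>"
      using fun_cong[OF pq(3), of "Inr j"] by (simp add: cell_def)
    from same_cell_imp_close[OF H(6) this]
    have "\<bar>frac (y q $ j) - frac (y p $ j)\<bar> < \<alpha>" using inv by linarith
    moreover have yb: "ivec b v* A = y q - y p"
      unfolding y_def vector_matrix_mult_diff_distrib[symmetric] ivec_diff
      by (simp add: b_def[abs_def])
    ultimately show "\<bar>(ivec b v* A) $ j - of_int (\<lfloor>y q $ j\<rfloor> - \<lfloor>y p $ j\<rfloor>)\<bar> < \<alpha>"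
      unfolding yb by (simp add: frac_def algebra_simps)
  qed
  ultimately show ?thesis using pq bN by (intro exI[of _ b]) auto
qed

definition rational_point :: "('d::finite option \<Rightarrow> int) \<Rightarrow> real^'d" where
  "rational_point b = (\<chi> i. of_int (b (Some i)) / of_int (b None))"

lemma in_cube_rational_point:
  assumes "0 < b None" "\<And>i. \<bar>of_int (b None) * x $ i - of_int (b (Some i))\<bar> \<le> \<delta>" "\<delta> \<le> r * of_int (b None)"
  shows "x \<in> cube (rational_point b) r"
  unfolding cube_def
proof safe
  fix i
  have "\<bar>x $ i - rational_point b $ i\<bar> = \<bar>of_int (b None) * x $ i - of_int (b (Some i))\<bar> / of_int (b None)"
    using assms(1) by (simp add: rational_point_def field_simps)
  also have "\<dots> \<le> r" using assms(1) order_trans[OF assms(2)[of i] assms(3)] by (simp add: field_simps)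
  finally show "\<bar>x $ i - rational_point b $ i\<bar> \<le> r" .
qed

lemma rational_point_error:
  assumes "0 < b None" "x \<in> cube (rational_point b) r"
  shows "\<bar>of_int (b None) * x $ i - of_int (b (Some i))\<bar> \<le> of_int (b None) * r"
proof -
  have "\<bar>x $ i - of_int (b (Some i)) / of_int (b None)\<bar> \<le> r"
    using assms(2) by (simp add: cube_def rational_point_def)
  then have "of_int (b None) * \<bar>x $ i - of_int (b (Some i)) / of_int (b None)\<bar> \<le> of_int (b None) * r"
    using assms(1) by (intro mult_left_mono) auto
  moreover have "of_int (b None) * \<bar>y\<bar> = \<bar>of_int (b None) * y\<bar>" for y :: real
    using assms(1) by (simp add: abs_mult)
  moreover have "of_int (b None) * (x $ i - of_int (b (Some i)) / of_int (b None))
      = of_int (b None) * x $ i - of_int (b (Some i))"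
    using assms(1) by (simp add: right_diff_distrib)
  ultimately show ?thesis by simp
qed

text \<open>
  The first summand of the bound is for levels \<open>s\<close> at which the counting bound applies to the cube itself.
  Below these levels \<open>\<alpha>\<close> is enlarged just enough to make the bound applicable, in the fixed cube
  of radius \<open>C\<close>; this loses the factor \<open>l\<^sup>d\<close>, but such levels are so low that
  their contribution, the second summand, is negligible.
\<close>
lemma near_rational_small_denominators:
  fixes A :: "real^'m::finite^('d::finite option)"
  assumes C: "1 \<le> C" "near_rational_bound A w R C" and w: "real CARD('m) \<le> w"
    and z: "\<And>i. \<bar>z $ i\<bar> \<le> R" and l: "0 < l" "l \<le> 1" and \<alpha>: "0 < \<alpha>" "\<alpha> \<le> 1" and \<delta>: "0 \<le> \<delta>" "\<delta> \<le> 1"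
  shows "\<exists>D\<in>lmeasurable. cube z l \<inter> near_rational A s \<delta> \<alpha> \<subseteq> D \<and>
     measure lebesgue D \<le> 2 * C * l ^ CARD('d) * (\<alpha> ^ CARD('m) * \<delta> ^ CARD('d)) * 2 ^ s
       + C * C ^ CARD('d) * (1 + C) * (\<alpha> ^ CARD('m) * \<delta> ^ CARD('d)) * ((C / l) * \<alpha> powr (- w))"
proof -
  let ?d = "CARD('d)" and ?m = "CARD('m)"
  let ?a = "\<alpha> ^ ?m * \<delta> ^ ?d"
  have a0: "0 \<le> ?a" using \<alpha> \<delta> by simp
  have m1: "1 \<le> real ?m" by (simp add: Suc_leI)
  have w0: "0 < w" using w m1 by linarith
  define X where "X = (C / l) * \<alpha> powr (- w)"
  have nn1: "0 \<le> 2 * C * l ^ ?d * ?a * 2 ^ s" using C l a0 by simp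
  have nn2: "0 \<le> C * C ^ ?d * (1 + C) * ?a * X" using C l a0 by (simp add: X_def)
  have \<alpha>w: "1 \<le> \<alpha> powr (- w)"
    using \<alpha> w0 powr_mono2'[of "- w" \<alpha> 1] by simp
  show ?thesis
  proof (cases "C * \<alpha> powr (- w) \<le> 2 ^ s * l")
    case True
    have "1 * 1 \<le> C * \<alpha> powr (- w)" using C \<alpha>w by (intro mult_mono) auto
    then have c1: "1 \<le> 2 ^ s * l" using True by linarith
    then have c2: "\<delta> \<le> 2 ^ s * l" using \<delta> by linarith
    obtain D where D: "D \<in> lmeasurable" "cube z l \<inter> near_rational A s \<delta> \<alpha> \<subseteq> D"
      "measure lebesgue D \<le> C * l ^ ?d * (1 + l) * \<alpha> ^ ?m * \<delta> ^ ?d * 2 ^ s"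
      using near_rational_boundD[OF C(2) z l(1) \<alpha>(1) \<delta>(1) c2 c1 True] by blast
    have "C * l ^ ?d * (1 + l) * \<alpha> ^ ?m * \<delta> ^ ?d * 2 ^ s = (1 + l) * (C * l ^ ?d * ?a * 2 ^ s)" by (simp add: mult_ac)
    also have "\<dots> \<le> 2 * (C * l ^ ?d * ?a * 2 ^ s)" using l C a0 by (intro mult_right_mono) auto
    finally have "measure lebesgue D \<le> 2 * C * l ^ ?d * ?a * 2 ^ s + C * C ^ ?d * (1 + C) * ?a * X"
      using D(3) nn2 by (simp add: mult_ac)
    then show ?thesis using D(1,2) unfolding X_def by blast
  next
    case False
    then have sX: "2 ^ s < X" using l by (simp add: X_def field_simps)
    then have X0: "0 < X" by (rule less_trans[rotated]) simp
    \<comment> \<open>The value \<open>\<alpha>'\<close> is large enough for the bound to apply in the cube of radius \<open>C\<close>.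
        Since \<open>m \<le> w\<close>, it increases \<open>\<alpha>\<^sup>m\<close> by at most the factor \<open>u\<close>.\<close>
    define u where "u = X / 2 ^ s"
    have u: "1 \<le> u" using sX by (simp add: u_def)
    define \<alpha>' where "\<alpha>' = \<alpha> * u powr (1 / w)"
    have u1: "1 \<le> u powr (1 / w)" using u w0 by (simp add: ge_one_powr_ge_zero)
    have \<alpha>': "\<alpha> \<le> \<alpha>'" "0 < \<alpha>'" using mult_left_mono[OF u1, of \<alpha>] \<alpha> unfolding \<alpha>'_def by linarith+
    have "\<alpha>' powr (- w) = \<alpha> powr (- w) * (1 / u)"
      unfolding \<alpha>'_def using \<alpha> u w0 by (simp add: powr_mult powr_powr powr_minus_divide)
    also have "\<dots> = 2 ^ s * (l / C)" using X0 C l \<alpha> by (simp add: u_def X_def field_simps)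
    also have "\<dots> \<le> 2 ^ s * 1" using C l by (intro mult_left_mono) auto
    finally have cond: "C * \<alpha>' powr (- w) \<le> 2 ^ s * C" using C by (simp add: mult.commute)
    have p1: "1 \<le> (2::real) ^ s" by simp
    have C0: "0 < C" using C by linarith
    have "1 * 1 \<le> 2 ^ s * C" using C p1 by (intro mult_mono) auto
    then have c1: "1 \<le> 2 ^ s * C" by simp
    then have c2: "\<delta> \<le> 2 ^ s * C" using \<delta> by linarith
    obtain D where D: "D \<in> lmeasurable" "cube z C \<inter> near_rational A s \<delta> \<alpha>' \<subseteq> D"
      "measure lebesgue D \<le> C * C ^ ?d * (1 + C) * \<alpha>' ^ ?m * \<delta> ^ ?d * 2 ^ s"
      using near_rational_boundD[OF C(2) z C0 \<alpha>'(2) \<delta>(1) c2 c1 cond] by blast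
    have "cube z l \<subseteq> cube z C" using l C by (intro cube_mono) auto
    moreover have "near_rational A s \<delta> \<alpha> \<subseteq> near_rational A s \<delta> \<alpha>'"
      using \<alpha>'(1) unfolding near_rational_def by fastforce
    ultimately have sub: "cube z l \<inter> near_rational A s \<delta> \<alpha> \<subseteq> D" using D(2) by blast
    have "(u powr (1 / w)) ^ ?m \<le> u"
    proof -
      have "(u powr (1 / w)) ^ ?m = u powr (real ?m / w)"
        using u by (subst powr_realpow[symmetric]) (auto simp: powr_powr)
      also have "\<dots> \<le> u powr 1" using u w w0 by (intro powr_mono) auto
      finally show ?thesis using u by simp
    qed
    then have "\<alpha>' ^ ?m * 2 ^ s \<le> \<alpha> ^ ?m * u * 2 ^ s"
      unfolding \<alpha>'_def power_mult_distrib using \<alpha> by (intro mult_right_mono mult_left_mono) auto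
    also have "\<dots> = \<alpha> ^ ?m * X" by (simp add: u_def)
    finally have "(C * C ^ ?d * (1 + C) * \<delta> ^ ?d) * (\<alpha>' ^ ?m * 2 ^ s) \<le> (C * C ^ ?d * (1 + C) * \<delta> ^ ?d) * (\<alpha> ^ ?m * X)"
      using C \<delta> by (intro mult_left_mono) auto
    then have "measure lebesgue D \<le> 2 * C * l ^ ?d * ?a * 2 ^ s + C * C ^ ?d * (1 + C) * ?a * X"
      using D(3) nn1 by (simp add: mult_ac)
    then show ?thesis using D(1) sub unfolding X_def by blast
  qed
qed

text \<open>
  With \<open>\<alpha>\<^sup>m \<delta>\<^sup>d = 2\<^sup>n / 2\<^sup>t\<close>, the first summands of the previous bound form a geometric series, which is
  small because the levels stop at \<open>t - k\<close>; the second ones add up to at most a multiple of \<open>t\<close> times the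
  power \<open>t\<close> of a number less than 1, since \<open>w < w'\<close>.
\<close>
lemma near_rational_low_levels_small:
  fixes A :: "real^'m::finite^('d::finite option)"
  assumes C: "1 \<le> C" "near_rational_bound A w R C"
    and w: "real CARD('m) \<le> w" "w < w'" and \<kappa>: "0 < \<kappa>"
    and \<alpha>: "\<And>t. \<kappa> * 2 powr (- real t / w') \<le> \<alpha> t" "\<And>t. \<alpha> t \<le> 1"
    and \<delta>: "\<And>t. 0 < \<delta> t" "\<And>t. \<delta> t ^ CARD('d) * \<alpha> t ^ CARD('m) * 2 ^ t = 2 ^ (CARD('d) + CARD('m))"
    and k: "8 * C * 2 ^ (CARD('d) + CARD('m)) \<le> 2 ^ k"
    and z: "\<And>i. \<bar>z $ i\<bar> \<le> R" and l: "0 < l" "l \<le> 1"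
  shows "\<forall>\<^sub>F t in sequentially. \<delta> t \<le> 1 \<and> (\<exists>D\<in>lmeasurable.
     cube z l \<inter> (\<Union>s<t - k. near_rational A s (\<delta> t) (\<alpha> t)) \<subseteq> D \<and> measure lebesgue D \<le> l ^ CARD('d) / 2)"
proof -
  let ?d = "CARD('d)" and ?m = "CARD('m)"
  let ?n = "?d + ?m"
  have m1: "1 \<le> real ?m" by (simp add: Suc_leI)
  have w0: "0 < w" "0 < w'" using w m1 by linarith+
  have \<alpha>0: "0 < \<alpha> t" for t using \<alpha>(1)[of t] \<kappa> less_le_trans[of 0 "\<kappa> * 2 powr (- real t / w')" "\<alpha> t"] by simp
  have a: "\<alpha> t ^ ?m * \<delta> t ^ ?d = 2 ^ ?n / 2 ^ t" for t using \<delta>(2)[of t] by (simp add: field_simps)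
  define q1 where "q1 = (2::real) powr (real ?m / w' - 1)"
  define q2 where "q2 = (2::real) powr (w / w' - 1)"
  have q1: "0 < q1" "q1 < 1" and q2: "0 < q2" "q2 < 1"
    using w w0 by (auto simp: q1_def q2_def powr_less_one)
  have pw: "((2::real) powr (- real t / w')) powr (- e) / 2 ^ t = (2 powr (e / w' - 1)) ^ t" for t e
  proof -
    have "((2::real) powr (- real t / w')) powr (- e) / 2 ^ t = 2 powr (real t * (e / w')) / 2 powr real t"
      by (simp add: powr_powr powr_realpow mult.commute)
    also have "\<dots> = 2 powr (real t * (e / w' - 1))" by (simp add: powr_diff[symmetric] algebra_simps)
    also have "\<dots> = (2 powr (e / w' - 1)) ^ t" by (simp add: powr_realpow[symmetric] powr_powr mult.commute)
    finally show ?thesis .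
  qed
  have \<alpha>_le: "\<alpha> t powr (- e) / 2 ^ t \<le> \<kappa> powr (- e) * (2 powr (e / w' - 1)) ^ t" if "0 \<le> e" for t e
  proof -
    have "\<alpha> t powr (- e) \<le> (\<kappa> * 2 powr (- real t / w')) powr (- e)"
      using \<alpha>(1)[of t] \<kappa> that by (intro powr_mono2') auto
    also have "\<dots> = \<kappa> powr (- e) * (2 powr (- real t / w')) powr (- e)"
      using \<kappa> by (simp add: powr_mult)
    finally have "\<alpha> t powr (- e) / 2 ^ t \<le> \<kappa> powr (- e) * ((2 powr (- real t / w')) powr (- e) / 2 ^ t)"
      by (simp add: divide_right_mono)
    then show ?thesis by (simp only: pw)
  qed
  have ev1: "\<forall>\<^sub>F t in sequentially. 2 ^ ?n * (\<kappa> powr (- real ?m) * q1 ^ t) < 1"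
  proof (rule order_tendstoD(2))
    have "(\<lambda>t. 2 ^ ?n * (\<kappa> powr (- real ?m) * q1 ^ t)) \<longlonglongrightarrow> 2 ^ ?n * (\<kappa> powr (- real ?m) * 0)"
      using q1 by (intro tendsto_intros LIMSEQ_realpow_zero) auto
    then show "(\<lambda>t. 2 ^ ?n * (\<kappa> powr (- real ?m) * q1 ^ t)) \<longlonglongrightarrow> 0" by simp
  qed simp
  define M where "M = C * C ^ ?d * (1 + C) * 2 ^ ?n * ((C / l) * \<kappa> powr (- w))"
  have M0: "0 \<le> M" using C l by (simp add: M_def)
  have ev2: "\<forall>\<^sub>F t in sequentially. M * (real t * q2 ^ t) < l ^ ?d / 4"
  proof (rule order_tendstoD(2))
    have "(\<lambda>t. M * (real t * q2 ^ t)) \<longlonglongrightarrow> M * 0"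
      using q2 by (intro tendsto_intros powser_times_n_limit_0) auto
    then show "(\<lambda>t. M * (real t * q2 ^ t)) \<longlonglongrightarrow> 0" by simp
  qed (use l in simp)
  show ?thesis
    using ev1 ev2 eventually_ge_at_top[of k]
  proof eventually_elim
    case (elim t)
    have "\<delta> t ^ ?d = 2 ^ ?n * (\<alpha> t powr (- real ?m) / 2 ^ t)"
      using a[of t] \<alpha>0[of t] by (simp add: powr_minus powr_realpow field_simps)
    also have "\<dots> \<le> 2 ^ ?n * (\<kappa> powr (- real ?m) * q1 ^ t)"
      unfolding q1_def by (intro mult_left_mono \<alpha>_le) auto
    finally have "\<delta> t ^ ?d \<le> 1" using elim(1) by linarith
    then have \<delta>1: "\<delta> t \<le> 1" using \<delta>(1)[of t] power_le_one_iff[of "\<delta> t" ?d] by simp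
    have "\<exists>D\<in>lmeasurable. cube z l \<inter> near_rational A s (\<delta> t) (\<alpha> t) \<subseteq> D \<and>
       measure lebesgue D \<le> 2 * C * l ^ ?d * (\<alpha> t ^ ?m * \<delta> t ^ ?d) * 2 ^ s
       + C * C ^ ?d * (1 + C) * (\<alpha> t ^ ?m * \<delta> t ^ ?d) * ((C / l) * \<alpha> t powr (- w))" for s
      using \<delta>(1)[of t] by (intro near_rational_small_denominators[OF C w(1) z l \<alpha>0 \<alpha>(2) _ \<delta>1]) auto
    then obtain D where D: "\<And>s. D s \<in> lmeasurable" "\<And>s. cube z l \<inter> near_rational A s (\<delta> t) (\<alpha> t) \<subseteq> D s"
      "\<And>s. measure lebesgue (D s) \<le> 2 * C * l ^ ?d * (\<alpha> t ^ ?m * \<delta> t ^ ?d) * 2 ^ s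
       + C * C ^ ?d * (1 + C) * (\<alpha> t ^ ?m * \<delta> t ^ ?d) * ((C / l) * \<alpha> t powr (- w))"
      by metis
    have "(\<Union>s<t - k. D s) \<in> lmeasurable" using D(1) by (intro fmeasurable.finite_UN) auto
    moreover have "cube z l \<inter> (\<Union>s<t - k. near_rational A s (\<delta> t) (\<alpha> t)) \<subseteq> (\<Union>s<t - k. D s)" using D(2) by blast
    moreover have "measure lebesgue (\<Union>s<t - k. D s) \<le> l ^ ?d / 2"
    proof -
      have bound: "measure lebesgue (D s) \<le> 2 * C * l ^ ?d * (2 ^ ?n / 2 ^ t) * 2 ^ s + M * q2 ^ t" for s
      proof -
        have "C * C ^ ?d * (1 + C) * (\<alpha> t ^ ?m * \<delta> t ^ ?d) * ((C / l) * \<alpha> t powr (- w))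
            = C * C ^ ?d * (1 + C) * 2 ^ ?n * ((C / l) * (\<alpha> t powr (- w) / 2 ^ t))"
          unfolding a by simp
        also have "\<dots> \<le> C * C ^ ?d * (1 + C) * 2 ^ ?n * ((C / l) * (\<kappa> powr (- w) * q2 ^ t))"
          unfolding q2_def using C l w0 by (intro mult_left_mono \<alpha>_le) auto
        also have "\<dots> = M * q2 ^ t" by (simp add: M_def)
        finally show ?thesis using D(3)[of s] unfolding a by linarith
      qed
      have "measure lebesgue (\<Union>s<t - k. D s) \<le> (\<Sum>s<t - k. measure lebesgue (D s))"
        using D(1) by (intro measure_UNION_le) (auto intro: fmeasurableD)
      also have "\<dots> \<le> (\<Sum>s<t - k. 2 * C * l ^ ?d * (2 ^ ?n / 2 ^ t) * 2 ^ s + M * q2 ^ t)"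
        by (intro sum_mono bound)
      also have "\<dots> = 2 * C * l ^ ?d * (2 ^ ?n / 2 ^ t) * (\<Sum>s<t - k. 2 ^ s) + real (t - k) * (M * q2 ^ t)"
        by (simp add: sum.distrib sum_distrib_left)
      also have "(\<Sum>s<t - k. (2::real) ^ s) = 2 ^ (t - k) - 1"
        by (simp add: geometric_sum)
      also have "2 * C * l ^ ?d * (2 ^ ?n / 2 ^ t) * (2 ^ (t - k) - 1) + real (t - k) * (M * q2 ^ t)
          \<le> 2 * C * l ^ ?d * (2 ^ ?n / 2 ^ t) * 2 ^ (t - k) + real t * (M * q2 ^ t)"
        using C l M0 q2 by (intro add_mono mult_left_mono mult_right_mono) auto
      also have "2 * C * l ^ ?d * (2 ^ ?n / 2 ^ t) * 2 ^ (t - k) = (8 * C * 2 ^ ?n / 2 ^ k) * (l ^ ?d / 4)"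
        using elim(3) by (simp add: power_diff)
      also have "\<dots> \<le> 1 * (l ^ ?d / 4)" using k l by (intro mult_right_mono) auto
      also have "1 * (l ^ ?d / 4) + real t * (M * q2 ^ t) \<le> l ^ ?d / 2"
        using elim(2) by (simp add: mult_ac)
      finally show ?thesis by simp
    qed
    ultimately show ?case using \<delta>1 by blast
  qed
qed

text \<open>
  Apart from a set of at most half the measure, every point of the half-sized cube has a Dirichlet
  approximation whose denominator is at least \<open>2\<^sup>t\<^sup>-\<^sup>k\<close>, hence lies within \<open>r t\<close> of its
  center. A maximal separated subset of the centers has cardinality of order \<open>(l / r t)\<^sup>d\<close> because the cubes of
  radius \<open>2 r t\<close> about it cover the rest. The constants are independent of the cube; only the first
  admissible level depends on it.
\<close>
lemma local_ubiquity:
  fixes A :: "real^'m::finite^('d::finite option)"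
  assumes C: "1 \<le> C" "near_rational_bound A w R C"
    and w: "real CARD('m) \<le> w" "w < w'" and \<kappa>: "0 < \<kappa>"
    and \<alpha>: "\<And>t. \<kappa> * 2 powr (- real t / w') \<le> \<alpha> t" "\<And>t. \<alpha> t \<le> 1"
    and \<delta>: "\<And>t. 0 < \<delta> t" "\<And>t. \<delta> t ^ CARD('d) * \<alpha> t ^ CARD('m) * 2 ^ t = 2 ^ (CARD('d) + CARD('m))"
    and k: "8 * C * 2 ^ (CARD('d) + CARD('m)) \<le> 2 ^ k"
    and r: "\<And>t. r t = \<delta> t * 2 ^ k / 2 ^ t"
    and z: "\<And>i. \<bar>z $ i\<bar> \<le> R" and l: "0 < l" "l \<le> 1"
  shows "\<forall>\<^sub>F t in sequentially. k \<le> t \<and> r t \<le> l / 4 \<and> (\<exists>G. finite G \<and> separated (r t) G \<and> G \<subseteq> cube z (3 / 4 * l) \<and>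
     l ^ CARD('d) / (2 * 8 ^ CARD('d)) \<le> real (card G) * r t ^ CARD('d) \<and>
     (\<forall>g\<in>G. \<exists>b. 2 ^ (t - k) \<le> b None \<and> b None \<le> 2 ^ t \<and> g = rational_point b \<and> int_dist (ivec b v* A) < \<alpha> t))"
proof -
  let ?d = "CARD('d)" and ?m = "CARD('m)"
  let ?n = "?d + ?m"
  have l2: "0 < l / 2" "l / 2 \<le> 1" using l by auto
  have \<alpha>0: "0 < \<alpha> t" for t using \<alpha>(1)[of t] \<kappa> less_le_trans[of 0 "\<kappa> * 2 powr (- real t / w')" "\<alpha> t"] by simp
  have "(\<lambda>t. 2 ^ k * (1 / 2) ^ t) \<longlonglongrightarrow> 2 ^ k * (0::real)"
    by (intro tendsto_intros LIMSEQ_realpow_zero) auto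
  then have "(\<lambda>t. 2 ^ k * (1 / 2) ^ t) \<longlonglongrightarrow> (0::real)" by simp
  then have evr: "\<forall>\<^sub>F t in sequentially. 2 ^ k * (1 / 2) ^ t < l / 4"
    using l by (intro order_tendstoD(2)[where y=0]) auto
  show ?thesis
    using near_rational_low_levels_small[OF C w \<kappa> \<alpha> \<delta> k z l2] eventually_ge_at_top[of k] evr
  proof eventually_elim
    case (elim t)
    then obtain D where \<delta>1: "\<delta> t \<le> 1" and D: "D \<in> lmeasurable"
      "cube z (l / 2) \<inter> (\<Union>s<t - k. near_rational A s (\<delta> t) (\<alpha> t)) \<subseteq> D" "measure lebesgue D \<le> (l / 2) ^ ?d / 2" by blast
    have kt: "k \<le> t" using elim by blast
    have r0: "0 < r t" using \<delta>(1)[of t] by (simp add: r)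
    have "r t \<le> 1 * 2 ^ k / 2 ^ t" unfolding r using \<delta>1 by (intro divide_right_mono mult_right_mono) auto
    also have "1 * 2 ^ k / 2 ^ t = 2 ^ k * (1 / 2 :: real) ^ t" unfolding power_one_over by simp
    finally have rl: "r t \<le> l / 4" using elim(3) by linarith
    define P where "P = rational_point ` {b. 2 ^ (t - k) \<le> b None \<and> b None \<le> 2 ^ t \<and> int_dist (ivec b v* A) < \<alpha> t} \<inter> cube z (3 / 4 * l)"
    have "finite P"
    proof -
      have R0: "0 \<le> R" using z[of undefined] by linarith
      have "P \<subseteq> rational_point ` {b. \<forall>i. \<bar>real_of_int (b i) - 0\<bar> \<le> 2 ^ t * (R + 1)}"
      proof
        fix p assume "p \<in> P"
        then obtain b where b: "p = rational_point b" "2 ^ (t - k) \<le> b None" "b None \<le> 2 ^ t" "p \<in> cube z (3 / 4 * l)"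
          unfolding P_def by blast
        have q0: "0 < b None" using b(2) by (rule less_le_trans[rotated]) simp
        have "real_of_int (b None) \<le> of_int (2 ^ t)" using b(3) by (simp only: of_int_le_iff)
        then have q: "real_of_int (b None) \<le> 2 ^ t" by simp
        have "\<bar>real_of_int (b i)\<bar> \<le> 2 ^ t * (R + 1)" for i
        proof (cases i)
          case None
          have "2 ^ t * 1 \<le> 2 ^ t * (R + 1)" using R0 by (intro mult_left_mono) auto
          moreover have "\<bar>real_of_int (b i)\<bar> = real_of_int (b None)" using None q0 by simp
          ultimately show ?thesis using q by linarith
        next
          case (Some j)
          have "\<bar>p $ j - z $ j\<bar> \<le> 3 / 4 * l" using b(4) by (simp add: cube_def)
          then have "\<bar>p $ j\<bar> \<le> R + 1" using z[of j] l by linarith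
          then have "of_int (b None) * \<bar>p $ j\<bar> \<le> 2 ^ t * (R + 1)"
            using q q0 by (intro mult_mono) auto
          moreover have "of_int (b None) * \<bar>p $ j\<bar> = \<bar>real_of_int (b (Some j))\<bar>"
            using q0 by (simp add: b(1) rational_point_def)
          ultimately show ?thesis using Some by simp
        qed
        then show "p \<in> rational_point ` {b. \<forall>i. \<bar>real_of_int (b i) - 0\<bar> \<le> 2 ^ t * (R + 1)}" using b(1) by auto
      qed
      then show ?thesis
        using finite_bounded_int_functions[of "\<lambda>_. 0" "2 ^ t * (R + 1)"] finite_surj by blast
    qed
    then obtain G where G: "G \<subseteq> P" "separated (r t) G" "P \<subseteq> (\<Union>g\<in>G. cube g (r t))"
      using exists_separated_net[of P "r t"] r0 by auto
    have finG: "finite G" using G(1) \<open>finite P\<close> finite_subset by blast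
    have cover: "cube z (l / 2) \<subseteq> D \<union> (\<Union>g\<in>G. cube g (2 * r t))"
    proof
      fix x assume x: "x \<in> cube z (l / 2)"
      have "(2 / \<delta> t) ^ ?d * (2 / \<alpha> t) ^ ?m = 2 ^ t"
      proof -
        have "(2 / \<delta> t) ^ ?d * (2 / \<alpha> t) ^ ?m = 2 ^ ?n / (\<delta> t ^ ?d * \<alpha> t ^ ?m)"
          by (simp add: power_divide power_add)
        also have "\<dots> = 2 ^ t"
          unfolding \<delta>(2)[of t, symmetric] using \<delta>(1)[of t] \<alpha>0[of t] by simp
        finally show ?thesis .
      qed
      then have "(2 / \<delta> t) ^ ?d * (2 / \<alpha> t) ^ ?m \<le> real (2 ^ t)" by simp
      from Dirichlet_near_graph[OF \<delta>(1) \<delta>1 \<alpha>0 \<alpha>(2) this, of x A]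
      obtain b where b: "1 \<le> b None" "b None \<le> int (2 ^ t)"
        "\<And>i. \<bar>of_int (b None) * x $ i - of_int (b (Some i))\<bar> \<le> \<delta> t" "int_dist (ivec b v* A) < \<alpha> t"
        by blast
      show "x \<in> D \<union> (\<Union>g\<in>G. cube g (2 * r t))"
      proof (cases "b None < 2 ^ (t - k)")
        case True
        obtain q where q: "b None = int q" using b(1) by (metis int_nat_eq linorder_not_le not_one_le_zero order_trans zero_le_one)
        obtain s where s: "2 ^ s \<le> q" "q < 2 ^ (s + 1)" using ex_power_ivl1[of 2 q] b(1) q by auto
        have "int (2 ^ s) \<le> b None" "b None < int (2 ^ (s + 1))" using s unfolding q by (simp_all only: of_nat_le_iff of_nat_less_iff)
        then have "2 ^ s \<le> b None" "b None < 2 ^ (s + 1)" by simp_all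
        moreover have "(2::int) ^ s < 2 ^ (t - k)" using calculation(1) True by linarith
        then have "s < t - k" by (subst (asm) power_strict_increasing_iff) auto
        ultimately show ?thesis using D(2) x b(3,4) unfolding near_rational_def by blast
      next
        case False
        then have bk: "2 ^ (t - k) \<le> b None" by simp
        then have "real_of_int (2 ^ (t - k)) \<le> of_int (b None)" by (simp only: of_int_le_iff)
        then have bk': "2 ^ (t - k) \<le> real_of_int (b None)" by simp
        have q0: "0 < b None" using b(1) by linarith
        have "\<delta> t = r t * 2 ^ (t - k)" using kt by (simp add: r power_diff)
        also have "\<dots> \<le> r t * of_int (b None)" using bk' r0 by (intro mult_left_mono) auto
        finally have xb: "x \<in> cube (rational_point b) (r t)"
          using q0 b(3) by (intro in_cube_rational_point) auto
        have "rational_point b \<in> cube x (r t)" using xb by (auto simp: cube_def abs_minus_commute)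
        moreover have "cube x (r t) \<subseteq> cube z (3 / 4 * l)" using x rl by (intro cube_subset_cube) auto
        ultimately have "rational_point b \<in> P" unfolding P_def using bk b(2,4) by auto
        then obtain g where g: "g \<in> G" "rational_point b \<in> cube g (r t)" using G(3) by blast
        then have "x \<in> cube g (2 * r t)" using xb cube_subset_cube[OF g(2), of "r t" "2 * r t"] by auto
        then show ?thesis using g(1) by blast
      qed
    qed
    have "l ^ ?d = measure lebesgue (cube z (l / 2))" using l by (simp add: measure_cube)
    also have "\<dots> \<le> measure lebesgue (D \<union> (\<Union>g\<in>G. cube g (2 * r t)))"
      using cover finG D(1) by (intro measure_mono_fmeasurable fmeasurable.Un fmeasurable.finite_UN) auto
    also have "\<dots> \<le> measure lebesgue D + measure lebesgue (\<Union>g\<in>G. cube g (2 * r t))"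
      using finG D(1) by (intro measure_Un_le) (auto intro: fmeasurableD sets.finite_UN)
    also have "\<dots> \<le> l ^ ?d / 2 + real (card G) * (2 * (2 * r t)) ^ ?d"
    proof (intro add_mono)
      have "(l / 2) ^ ?d \<le> l ^ ?d" using l by (intro power_mono) auto
      then show "measure lebesgue D \<le> l ^ ?d / 2" using D(3) by simp
      show "measure lebesgue (\<Union>g\<in>G. cube g (2 * r t)) \<le> real (card G) * (2 * (2 * r t)) ^ ?d"
        using finG r0 measure_finite_UN_cubes_le[of G "2 * r t" "\<lambda>g. g"] by simp
    qed
    finally have "l ^ ?d / 2 \<le> real (card G) * (2 * (2 * r t)) ^ ?d" by linarith
    also have "\<dots> = real (card G) * r t ^ ?d * 4 ^ ?d" by (simp add: power_mult_distrib)
    also have "\<dots> \<le> real (card G) * r t ^ ?d * 8 ^ ?d" using r0 by (intro mult_left_mono power_mono) auto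
    finally have "l ^ ?d / (2 * 8 ^ ?d) \<le> real (card G) * r t ^ ?d" by (simp add: field_simps)
    moreover have "G \<subseteq> cube z (3 / 4 * l)" using G(1) by (auto simp: P_def)
    moreover have "\<forall>g\<in>G. \<exists>b. 2 ^ (t - k) \<le> b None \<and> b None \<le> 2 ^ t \<and> g = rational_point b \<and> int_dist (ivec b v* A) < \<alpha> t"
      using G(1) unfolding P_def by blast
    ultimately show ?case using kt rl finG G(2) by blast
  qed
qed

section \<open>The divergence half\<close>

lemma open_int_dist_less:
  fixes f :: "'a::topological_space \<Rightarrow> real^'n::finite"
  assumes "continuous_on UNIV f"
  shows "open {x. int_dist (f x) < e}"
proof -
  have "{x. int_dist (f x) < e} = (\<Union>p. \<Inter>i. {x. \<bar>f x $ i - of_int (p i)\<bar> < e})"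
    by (auto simp: int_dist_less_iff)
  also have "open \<dots>"
    by (intro open_UN open_INT open_Collect_less continuous_intros assms ballI) auto
  finally show ?thesis .
qed

lemma continuous_on_graph_point: "continuous_on S (graph_point A)"
proof -
  have c: "continuous_on S (\<lambda>x. graph_point A x $ i)" for i
  proof (cases i)
    case (Inl j)
    then show ?thesis by (auto intro!: continuous_intros)
  next
    case (Inr j)
    have t: "continuous_on S (\<lambda>x::real^'a. tilde x $ k)" for k
      by (cases k) (auto intro!: continuous_intros)
    then show ?thesis
      unfolding Inr graph_point_nth vector_matrix_mult_def vec_lambda_beta by (intro continuous_on_sum continuous_on_mult continuous_on_const t)
  qed
  have "continuous_on S (\<lambda>x. \<chi> i. graph_point A x $ i)"
    by (rule continuous_on_vec_lambda) (rule c)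
  then show ?thesis by simp
qed

lemma sets_approximable:
  fixes A :: "real^'m::finite^('d::finite option)"
  shows "{x. graph_point A x \<in> psi_approximable \<psi>} \<in> sets lebesgue"
proof -
  let ?S = "\<lambda>q. {x. int_dist (real q *\<^sub>R graph_point A x) < \<psi> q}"
  have eq: "{x. graph_point A x \<in> psi_approximable \<psi>} = (\<Inter>N. \<Union>q\<in>{max 1 N..}. ?S q)"
  proof -
    have "graph_point A x \<in> psi_approximable \<psi> \<longleftrightarrow> (\<forall>N. \<exists>q\<ge>max 1 N. x \<in> ?S q)" for x
      unfolding psi_approximable_def infinite_nat_iff_unbounded_le by auto
    then show ?thesis unfolding set_eq_iff mem_Collect_eq INT_iff UN_iff Bex_def atLeast_iff by blast
  qed
  have "?S q \<in> sets lebesgue" for q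
  proof -
    have "open (?S q)"
      by (intro open_int_dist_less continuous_on_scaleR continuous_on_const continuous_on_graph_point)
    then show ?thesis by (simp add: borel_open)
  qed
  then show ?thesis unfolding eq
    by (intro sets.countable_INT'' sets.countable_UN') auto
qed

text \<open>
  Here \<open>\<phi>\<close> lies between the powers \<open>-1/w'\<close> and \<open>-1/n\<close>. The lower bound makes the ubiquity
  statement available, the upper bound makes the cubes around the centers disjoint.
\<close>
lemma khintchine_divergence_regular:
  fixes A :: "real^'m::finite^('d::finite option)"
  assumes c: "0 < c" and w: "real CARD('m) \<le> w" "w < w'"
    and gap: "kernel_gap A c w"
    and \<phi>: "\<And>p q. 1 \<le> p \<Longrightarrow> p \<le> q \<Longrightarrow> \<phi> q \<le> \<phi> p"
      "\<And>q. 1 \<le> q \<Longrightarrow> real q powr (- 1 / w') \<le> \<phi> q" "\<And>q. 1 \<le> q \<Longrightarrow> real q * \<phi> q ^ CARD('d + 'm) \<le> 1"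
    and div: "\<not> summable (\<lambda>t. 2 ^ t * \<phi> (2 ^ t) ^ CARD('d + 'm))"
  shows "negligible (cube z0 1 - {x. graph_point A x \<in> psi_approximable \<phi>})"
proof -
  let ?d = "CARD('d)" and ?m = "CARD('m)"
  let ?n = "?d + ?m"
  have d0: "0 < ?d" "0 < ?m" by simp_all
  have m1: "1 \<le> real ?m" by (simp add: Suc_leI)
  have w0: "0 < w" "0 < w'" using w m1 by linarith+
  define R where "R = infnorm z0 + 1"
  have R: "\<bar>z $ i\<bar> \<le> R" if "z \<in> cube z0 1" for z i
  proof -
    have "\<bar>z $ i - z0 $ i\<bar> \<le> 1" using that by (simp add: cube_def)
    moreover have "\<bar>z0 $ i\<bar> \<le> infnorm z0" by (rule component_le_infnorm_cart)
    ultimately show ?thesis unfolding R_def by linarith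
  qed
  have "0 \<le> R" by (simp add: R_def infnorm_pos_le)
  then obtain C where C: "1 \<le> C" "near_rational_bound A w R C"
    using ex_near_rational_bound[OF c w0(1) _ gap] by blast
  \<comment> \<open>With this \<open>\<kappa>\<close>, an error \<open>\<alpha> t\<close> both in \<open>qx\<close> and in \<open>bA\<close> adds up to at most \<open>\<phi>(2\<^sup>t)\<close>. The radius \<open>\<delta> t\<close>
      is the one that exactly exhausts the pigeonhole principle at level \<open>t\<close>.\<close>
  define \<kappa> where "\<kappa> = 1 / (1 + row_bound A)"
  have \<kappa>: "0 < \<kappa>" "\<kappa> \<le> 1" using row_bound_ge_1[of A] by (simp_all add: \<kappa>_def)
  define \<Phi> where "\<Phi> t = \<phi> (2 ^ t)" for t
  define \<alpha> where "\<alpha> t = \<kappa> * \<Phi> t" for t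
  define \<delta> where "\<delta> t = root ?d (2 ^ ?n / (\<alpha> t ^ ?m * 2 ^ t))" for t
  have \<Phi>_ge: "2 powr (- real t / w') \<le> \<Phi> t" for t
    using \<phi>(2)[of "2 ^ t"] w0 by (simp add: \<Phi>_def powr_realpow[symmetric] powr_powr)
  have \<Phi>0: "0 < \<Phi> t" for t using \<Phi>_ge[of t] less_le_trans[of 0 "2 powr (- real t / w')" "\<Phi> t"] by simp
  have \<Phi>n: "2 ^ t * \<Phi> t ^ ?n \<le> 1" for t using \<phi>(3)[of "2 ^ t"] by (simp add: \<Phi>_def)
  have \<Phi>1: "\<Phi> t \<le> 1" for t
  proof -
    have "1 * \<Phi> t ^ ?n \<le> 2 ^ t * \<Phi> t ^ ?n" using \<Phi>0[of t] by (intro mult_right_mono) auto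
    then have "\<Phi> t ^ ?n \<le> 1" using \<Phi>n[of t] by linarith
    then show ?thesis using \<Phi>0[of t] power_le_one_iff[of "\<Phi> t" ?n] d0 by simp
  qed
  have \<alpha>: "\<And>t. \<kappa> * 2 powr (- real t / w') \<le> \<alpha> t" "\<And>t. \<alpha> t \<le> 1" and \<alpha>0: "\<And>t. 0 < \<alpha> t" and \<alpha>\<Phi>: "\<And>t. \<alpha> t \<le> \<Phi> t"
    using \<Phi>_ge \<kappa> \<Phi>1 \<Phi>0 unfolding \<alpha>_def by (simp_all add: mult_le_one less_imp_le mult_left_le_one_le)
  have \<delta>0: "0 < \<delta> t" for t using \<alpha>0[of t] d0 by (simp add: \<delta>_def)
  have \<delta>d: "\<delta> t ^ ?d = 2 ^ ?n / (\<alpha> t ^ ?m * 2 ^ t)" for t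
    unfolding \<delta>_def using \<alpha>0[of t] d0 by (intro real_root_pow_pos2) (auto intro: less_imp_le)
  have \<delta>: "\<delta> t ^ ?d * \<alpha> t ^ ?m * 2 ^ t = 2 ^ ?n" for t
    unfolding \<delta>d using \<alpha>0[of t] by simp
  obtain k where k: "8 * C * 2 ^ ?n \<le> (2::real) ^ k"
    using real_arch_pow[of 2 "8 * C * 2 ^ ?n"] by (auto intro: less_imp_le)
  define r where "r t = \<delta> t * 2 ^ k / 2 ^ t" for t
  define \<rho> where "\<rho> t = \<alpha> t / 2 ^ t" for t
  have r0: "0 < r t" and \<rho>0: "0 < \<rho> t" for t using \<delta>0[of t] \<alpha>0[of t] by (simp_all add: r_def \<rho>_def)
  have rd: "r t ^ ?d = 2 ^ ?n * 2 ^ (k * ?d) / (\<alpha> t ^ ?m * 2 ^ t * 2 ^ (t * ?d))" for t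
    by (simp add: r_def power_mult_distrib power_divide \<delta>d power_mult[symmetric])
  have ratio: "(\<rho> t / r t) ^ ?d = \<alpha> t ^ ?n * 2 ^ t / (2 ^ ?n * 2 ^ (k * ?d))" for t
    unfolding power_divide rd \<rho>_def using \<alpha>0[of t] by (simp add: power_add power_mult[symmetric] field_simps)
  have \<rho>r: "2 * \<rho> t \<le> r t" for t
  proof -
    have "(2 * \<rho> t / r t) ^ ?d = 2 ^ ?d * (\<rho> t / r t) ^ ?d" by (simp only: power_mult_distrib times_divide_eq_right[symmetric])
    also have "\<dots> = (2 ^ t * \<alpha> t ^ ?n) / (2 ^ ?m * 2 ^ (k * ?d))" unfolding ratio by (simp add: power_add)
    also have "\<dots> \<le> 1 / 1"
    proof (rule frac_le)
      have "2 ^ t * \<alpha> t ^ ?n \<le> 2 ^ t * \<Phi> t ^ ?n"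
        using \<alpha>\<Phi> \<alpha>0 by (intro mult_left_mono power_mono) (auto intro: less_imp_le)
      then show "2 ^ t * \<alpha> t ^ ?n \<le> 1" using \<Phi>n[of t] by linarith
      have "1 * 1 \<le> (2::real) ^ ?m * 2 ^ (k * ?d)" by (intro mult_mono one_le_power) auto
      then show "1 \<le> (2::real) ^ ?m * 2 ^ (k * ?d)" by simp
    qed auto
    finally have "2 * \<rho> t / r t \<le> 1"
      using r0[of t] \<rho>0[of t] power_le_one_iff[of "2 * \<rho> t / r t" ?d] d0 by simp
    then show ?thesis using r0[of t] by (simp add: field_simps)
  qed
  define T where "T = {t. \<forall>s<t. 2 ^ s * \<Phi> s ^ ?m \<le> 2 ^ t * \<Phi> t ^ ?m}"
  have divT: "\<not> summable (\<lambda>t. if t \<in> T then 2 ^ t * \<Phi> t ^ ?n else 0)"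
    by (rule records_not_summable[OF \<Phi>0 d0 _ T_def]) (use div in \<open>simp add: \<Phi>_def\<close>)
  \<comment> \<open>At a record, \<open>r t\<close> is smaller than all earlier \<open>r s\<close> by the required factor, whatever the behaviour of
      \<open>\<phi>\<close> in between.\<close>
  have growth: "r t ^ ?d * 2 ^ (t - s) \<le> r s ^ ?d" if st: "t \<in> T" "s < t" for s t
  proof -
    obtain e where e: "t = s + e" using st(2) less_imp_add_positive by blast
    have "2 ^ s * \<Phi> s ^ ?m \<le> 2 ^ t * \<Phi> t ^ ?m" using st by (simp add: T_def)
    then have "\<kappa> ^ ?m * (2 ^ s * \<Phi> s ^ ?m) \<le> \<kappa> ^ ?m * (2 ^ t * \<Phi> t ^ ?m)" using \<kappa> by (intro mult_left_mono) auto
    then have 1: "\<alpha> s ^ ?m * 2 ^ s \<le> \<alpha> t ^ ?m * 2 ^ t" by (simp add: \<alpha>_def power_mult_distrib mult_ac)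
    have "s * ?d + e \<le> t * ?d" using d0 by (simp add: e algebra_simps)
    then have 2: "(2::real) ^ (s * ?d + e) \<le> 2 ^ (t * ?d)" by (intro power_increasing) auto
    have "(\<alpha> s ^ ?m * 2 ^ s) * 2 ^ (s * ?d + e) \<le> (\<alpha> t ^ ?m * 2 ^ t) * 2 ^ (t * ?d)"
      by (rule mult_mono[OF 1 2]) (use \<alpha>0 in \<open>auto intro: less_imp_le\<close>)
    then have "2 ^ e / ((\<alpha> t ^ ?m * 2 ^ t) * 2 ^ (t * ?d)) \<le> 1 / ((\<alpha> s ^ ?m * 2 ^ s) * 2 ^ (s * ?d))"
      using \<alpha>0[of s] \<alpha>0[of t] by (simp add: field_simps power_add)
    then have "(2 ^ ?n * 2 ^ (k * ?d)) * (2 ^ e / ((\<alpha> t ^ ?m * 2 ^ t) * 2 ^ (t * ?d)))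
      \<le> (2 ^ ?n * 2 ^ (k * ?d)) * (1 / ((\<alpha> s ^ ?m * 2 ^ s) * 2 ^ (s * ?d)))"
      by (intro mult_left_mono) auto
    then show ?thesis unfolding rd by (simp add: e)
  qed
  let ?X = "{x. graph_point A x \<in> psi_approximable \<phi>}"
  define c0 where "c0 = 1 / (2 * 8 ^ ?d :: real)"
  have c0: "0 < c0" by (simp add: c0_def)
  define \<eta> where "\<eta> = c0\<^sup>2 / (9 * 6 ^ ?d)"
  have \<eta>: "0 < \<eta>" using c0 by (simp add: \<eta>_def)
  have "\<eta> * l ^ ?d \<le> measure lebesgue (cube z l \<inter> ?X)" if z: "z \<in> cube z0 1" and l: "0 < l" "l \<le> 1" for z l
  proof -
    define good where "good t G \<longleftrightarrow> finite G \<and> separated (r t) G \<and> G \<subseteq> cube z (3 / 4 * l) \<and>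
       l ^ ?d / (2 * 8 ^ ?d) \<le> real (card G) * r t ^ ?d \<and>
       (\<forall>g\<in>G. \<exists>b. 2 ^ (t - k) \<le> b None \<and> b None \<le> 2 ^ t \<and> g = rational_point b \<and> int_dist (ivec b v* A) < \<alpha> t)" for t G
    have "\<forall>\<^sub>F t in sequentially. k \<le> t \<and> r t \<le> l / 4 \<and> (\<exists>G. good t G)"
      unfolding good_def by (rule local_ubiquity[OF C w \<kappa>(1) \<alpha> \<delta>0 \<delta> k r_def R[OF z] l])
    then obtain t0 where t0: "\<forall>t\<ge>t0. k \<le> t \<and> r t \<le> l / 4 \<and> (\<exists>G. good t G)"
      unfolding eventually_sequentially by blast
    then have "\<forall>t. \<exists>G. t0 \<le> t \<longrightarrow> good t G" by blast
    from choice[OF this] obtain G where good: "\<And>t. t0 \<le> t \<Longrightarrow> good t (G t)" by blast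
    have G: "finite (G t)" "separated (r t) (G t)" "G t \<subseteq> cube z (3 / 4 * l)"
      "l ^ ?d / (2 * 8 ^ ?d) \<le> real (card (G t)) * r t ^ ?d"
      "\<And>g. g \<in> G t \<Longrightarrow> \<exists>b. 2 ^ (t - k) \<le> b None \<and> b None \<le> 2 ^ t \<and> g = rational_point b \<and> int_dist (ivec b v* A) < \<alpha> t"
      if "t0 \<le> t" for t
      using good[OF that] unfolding good_def by blast+
    have rl: "r t \<le> l / 4" and kt: "k \<le> t" if "t0 \<le> t" for t using t0 that by blast+
    define E where "E t = (\<Union>g\<in>G t. cube g (\<rho> t))" for t
    have E_sub: "E t \<subseteq> cube z l" if "t0 \<le> t" for t
    proof -
      have "3 / 4 * l + \<rho> t \<le> l" using rl[OF that] \<rho>r[of t] \<rho>0[of t] l by linarith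
      then show ?thesis unfolding E_def using G(3)[OF that] by (intro UN_least cube_subset_cube) auto
    qed
    have E_sets: "E t \<in> sets lebesgue" if "t0 \<le> t" for t
      unfolding E_def using G(1)[OF that] by (intro sets.finite_UN) auto
    define U where "U N = (\<Union>t\<in>{max N t0..}. E t)" for N
    have U_sub: "U N \<subseteq> cube z l" for N using E_sub unfolding U_def by (intro UN_least) auto
    have U_sets: "U N \<in> sets lebesgue" for N
      unfolding U_def by (intro sets.countable_UN') (auto intro!: E_sets)
    have U: "U N \<in> lmeasurable" for N
      using U_sub U_sets by (rule fmeasurableI2[OF lmeasurable_cube])
    \<comment> \<open>The bound for the tails is uniform, so it passes to their intersection, which is contained in the
        limsup set.\<close>
    have U_ge: "\<eta> * l ^ ?d \<le> measure lebesgue (U N)" for N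
    proof -
      define B where "B = 2 ^ ?n * 2 ^ (k * ?d) / \<kappa> ^ ?n"
      obtain F where F: "F \<subseteq> T \<inter> {max N t0..}" "finite F" "B \<le> (\<Sum>t\<in>F. 2 ^ t * \<Phi> t ^ ?n)"
      proof -
        have "\<exists>F\<subseteq>T \<inter> {max N t0..}. finite F \<and> B \<le> (\<Sum>t\<in>F. 2 ^ t * \<Phi> t ^ ?n)"
          by (rule not_summable_finite_tail[OF _ divT]) (use \<Phi>0 in \<open>simp add: less_imp_le\<close>)
        then show thesis using that by blast
      qed
      have Ft: "t0 \<le> t" "t \<in> T" if "t \<in> F" for t using F(1) that by auto
      have "\<eta> * l ^ ?d \<le> measure lebesgue (\<Union>t\<in>F. \<Union>g\<in>G t. cube g (\<rho> t))"
        unfolding \<eta>_def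
      proof (rule measure_UN_separated_family_ge[where r=r and z=z])
        show "0 \<le> c0" "0 < l" "finite F" using c0 l F by auto
        show "1 \<le> (\<Sum>t\<in>F. (\<rho> t / r t) ^ ?d)"
        proof -
          have "(\<Sum>t\<in>F. (\<rho> t / r t) ^ ?d) = (\<Sum>t\<in>F. 2 ^ t * \<Phi> t ^ ?n) / B"
            unfolding ratio B_def sum_divide_distrib using \<kappa>
            by (intro sum.cong) (auto simp: \<alpha>_def power_mult_distrib mult_ac)
          moreover have "0 < B" using \<kappa> by (simp add: B_def)
          ultimately show ?thesis using F(3) by simp
        qed
        fix t assume t: "t \<in> F"
        show "finite (G t)" "separated (r t) (G t)" using G Ft[OF t] by auto
        show "G t \<subseteq> cube z l"
          using G(3)[OF Ft(1)[OF t]] cube_mono[of "3 / 4 * l" l z] l by auto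
        show "0 < \<rho> t" "2 * \<rho> t \<le> r t" by (fact \<rho>0, fact \<rho>r)
        show "r t \<le> l" using rl[OF Ft(1)[OF t]] l by linarith
        show "c0 * l ^ ?d \<le> real (card (G t)) * r t ^ ?d"
          using G(4)[OF Ft(1)[OF t]] by (simp add: c0_def)
        show "r t ^ ?d * 2 ^ (t - s) \<le> r s ^ ?d" if "s \<in> F" "s < t" for s
          using growth Ft(2)[OF t] that by blast
      qed
      also have "\<dots> \<le> measure lebesgue (U N)"
      proof (rule measure_mono_fmeasurable[OF _ _ U])
        show "(\<Union>t\<in>F. \<Union>g\<in>G t. cube g (\<rho> t)) \<subseteq> U N" using F(1) unfolding U_def E_def by blast
        show "(\<Union>t\<in>F. \<Union>g\<in>G t. cube g (\<rho> t)) \<in> sets lebesgue"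
          using G(1) Ft F(2) by (intro sets.finite_UN) auto
      qed
      finally show ?thesis .
    qed
    have "(\<lambda>N. measure lebesgue (U N)) \<longlonglongrightarrow> measure lebesgue (\<Inter>N. U N)"
    proof (rule Lim_measure_decseq)
      show "decseq U" by (force simp: decseq_def U_def)
    qed (use U U_sets in \<open>auto simp: emeasure_eq_measure2\<close>)
    then have "\<eta> * l ^ ?d \<le> measure lebesgue (\<Inter>N. U N)"
      using U_ge by (intro LIMSEQ_le_const) auto
    also have "\<dots> \<le> measure lebesgue (cube z l \<inter> ?X)"
    proof (rule measure_mono_fmeasurable)
      show "(\<Inter>N. U N) \<in> sets lebesgue" using U_sets by (intro sets.countable_INT'') auto
      show "cube z l \<inter> ?X \<in> lmeasurable"
        by (intro fmeasurable_Int_fmeasurable lmeasurable_cube sets_approximable)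
      show "(\<Inter>N. U N) \<subseteq> cube z l \<inter> ?X"
      proof
        fix x assume x: "x \<in> (\<Inter>N. U N)"
        have "\<exists>q\<ge>N. 1 \<le> q \<and> int_dist (real q *\<^sub>R graph_point A x) < \<phi> q" for N
        proof -
          have "x \<in> U (N + k)" using x by blast
          then obtain t where t: "N + k \<le> t" "t0 \<le> t" "x \<in> E t" by (auto simp: U_def)
          then obtain g where g: "g \<in> G t" "x \<in> cube g (\<rho> t)" by (auto simp: E_def)
          obtain b where b: "2 ^ (t - k) \<le> b None" "b None \<le> 2 ^ t" "g = rational_point b" "int_dist (ivec b v* A) < \<alpha> t"
            using G(5)[OF t(2) g(1)] by blast
          have b0: "0 < b None" using b(1) by (rule less_le_trans[rotated]) simp
          define q where "q = nat (b None)"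
          have q: "b None = int q" using b0 by (simp add: q_def)
          have "int (2 ^ (t - k)) \<le> int q" "int q \<le> int (2 ^ t)" using b(1,2) q by simp_all
          then have q2: "2 ^ (t - k) \<le> q" "q \<le> 2 ^ t" by (simp_all only: of_nat_le_iff)
          have q1: "1 \<le> q" using q b0 by linarith
          have "t - k < 2 ^ (t - k)" by (rule less_exp)
          then have "N \<le> q" using q2(1) t(1) by linarith
          have "\<bar>of_int (b None) * x $ i - of_int (b (Some i))\<bar> \<le> \<alpha> t" for i
          proof -
            have "\<bar>of_int (b None) * x $ i - of_int (b (Some i))\<bar> \<le> of_int (b None) * \<rho> t"
              using rational_point_error[of b x "\<rho> t" i] b0 g(2) b(3) by blast
            also have "\<dots> \<le> 2 ^ t * \<rho> t"
            proof (rule mult_right_mono)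
              have "real q \<le> real (2 ^ t)" using q2(2) by (simp only: of_nat_le_iff)
              then show "real_of_int (b None) \<le> 2 ^ t" by (simp add: q)
            qed (use \<rho>0[of t] in auto)
            also have "\<dots> = \<alpha> t" by (simp add: \<rho>_def)
            finally show ?thesis .
          qed
          moreover have "(1 + row_bound A) * \<alpha> t \<le> \<phi> q"
          proof -
            have "(1 + row_bound A) * \<alpha> t = \<Phi> t" using row_bound_ge_1[of A] by (simp add: \<alpha>_def \<kappa>_def)
            also have "\<dots> \<le> \<phi> q" unfolding \<Phi>_def by (rule \<phi>(1)[OF q1 q2(2)])
            finally show ?thesis .
          qed
          ultimately have "int_dist (real q *\<^sub>R graph_point A x) < \<phi> q"
            using int_dist_graph_pointI[OF q _ b(4)] by blast
          then show ?thesis using \<open>N \<le> q\<close> q1 by blast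
        qed
        then have "x \<in> ?X" unfolding psi_approximable_def infinite_nat_iff_unbounded_le by auto
        then show "x \<in> cube z l \<inter> ?X" using x U_sub by blast
      qed
    qed
    finally show ?thesis .
  qed
  then show ?thesis
    by (intro negligible_if_uniformly_dense[OF sets_approximable \<eta>])
qed

lemma not_summable_min:
  fixes v :: "nat \<Rightarrow> real"
  assumes "\<not> summable v" "\<And>t. 0 \<le> v t"
  shows "\<not> summable (\<lambda>t. min (v t) 1)"
proof
  assume s: "summable (\<lambda>t. min (v t) 1)"
  then have "(\<lambda>t. min (v t) 1) \<longlonglongrightarrow> 0" by (rule summable_LIMSEQ_zero)
  then have "\<forall>\<^sub>F t in sequentially. min (v t) 1 < 1" by (rule order_tendstoD) simp
  then have "\<forall>\<^sub>F t in sequentially. min (v t) 1 = v t" by eventually_elim auto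
  then have "summable v" using s summable_cong[of "\<lambda>t. min (v t) 1" v] by simp
  then show False using assms by blast
qed

lemma powr_inverse_power:
  assumes "0 < x" "0 < n"
  shows "(x powr (- 1 / real n)) ^ n = 1 / (x::real)"
  using assms by (subst powr_realpow[symmetric]) (simp, simp only: powr_powr, simp add: powr_minus_divide)

text \<open>
  Cutting \<open>\<psi>\<close> off at the power \<open>-1/n\<close> preserves divergence. Raising it to at least the power \<open>-1/w'\<close>, where
  \<open>w < w' < n\<close>, adds only a null set of approximable points by the convergence half.
\<close>
theorem khintchine_divergence:
  fixes A :: "real^'m::finite^('d::finite option)"
  assumes c: "0 < c" and w: "real CARD('m) \<le> w" "w < real (CARD('d) + CARD('m))"
    and gap: "kernel_gap A c w"
    and \<psi>: "\<And>q. 1 \<le> q \<Longrightarrow> 0 \<le> \<psi> q" "antimono_on {1..} \<psi>"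
    and div: "\<not> summable (\<lambda>q. \<psi> (Suc q) ^ CARD('d + 'm))"
  shows "negligible {x. graph_point A x \<notin> psi_approximable \<psi>}"
proof -
  let ?n = "CARD('d + 'm)"
  have n: "?n = CARD('d) + CARD('m)" by simp
  have n0: "0 < ?n" by simp
  have m1: "1 \<le> real CARD('m)" by (simp add: Suc_leI)
  define w' where "w' = (w + real ?n) / 2"
  have wn: "w < real ?n" using w(2) by simp
  have "0 < w" using w(1) m1 by linarith
  moreover have "w < w'" "w' < real ?n" unfolding w'_def using less_half_sum[OF wn] gt_half_sum[OF wn] by simp_all
  ultimately have w': "w < w'" "w' < real ?n" "0 < w'" "0 < w" by linarith+
  define \<zeta> where "\<zeta> q = real q powr (- 1 / w')" for q :: nat
  \<comment> \<open>At \<open>2\<^sup>t\<close> the cut-off replaces the condensed term by its minimum with 1.\<close>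
  define \<chi>' where "\<chi>' q = min (\<psi> q) (real q powr (- 1 / real ?n))" for q :: nat
  define \<phi> where "\<phi> q = max (\<chi>' q) (\<zeta> q)" for q :: nat
  have \<zeta>0: "0 \<le> \<zeta> q" for q by (simp add: \<zeta>_def)
  have \<zeta>_mono: "\<zeta> q \<le> \<zeta> p" if "1 \<le> p" "p \<le> q" for p q
    unfolding \<zeta>_def using that w' by (intro powr_mono2') auto
  have \<chi>0: "0 \<le> \<chi>' q" if "1 \<le> q" for q using \<psi>(1)[OF that] by (simp add: \<chi>'_def)
  have \<phi>_mono: "\<phi> q \<le> \<phi> p" if "1 \<le> p" "p \<le> q" for p q
  proof -
    have "real q powr (- 1 / real ?n) \<le> real p powr (- 1 / real ?n)" using that by (intro powr_mono2') auto
    moreover have "\<psi> q \<le> \<psi> p" using \<psi>(2) that by (auto simp: monotone_on_def)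
    ultimately have "\<chi>' q \<le> \<chi>' p" unfolding \<chi>'_def by linarith
    then show ?thesis using \<zeta>_mono[OF that] unfolding \<phi>_def by linarith
  qed
  have \<phi>_le: "\<phi> q \<le> real q powr (- 1 / real ?n)" if "1 \<le> q" for q
  proof -
    have "\<zeta> q \<le> real q powr (- 1 / real ?n)"
      unfolding \<zeta>_def using that w' by (intro powr_mono) (auto simp: field_simps)
    then show ?thesis by (simp add: \<phi>_def \<chi>'_def)
  qed
  have \<phi>n: "real q * \<phi> q ^ ?n \<le> 1" if "1 \<le> q" for q
  proof -
    have "0 \<le> \<phi> q" using \<zeta>0[of q] unfolding \<phi>_def by linarith
    then have "\<phi> q ^ ?n \<le> (real q powr (- 1 / real ?n)) ^ ?n" using \<phi>_le[OF that] by (intro power_mono)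
    also have "\<dots> = 1 / real q" using that n0 by (intro powr_inverse_power) auto
    finally show ?thesis using that by (simp add: field_simps)
  qed
  have "\<not> summable (\<lambda>t. 2 ^ t * \<phi> (2 ^ t) ^ ?n)"
  proof
    assume s: "summable (\<lambda>t. 2 ^ t * \<phi> (2 ^ t) ^ ?n)"
    define f where "f q = (if q = 0 then 0 else \<psi> q ^ ?n)" for q :: nat
    have fS: "f (Suc q) = \<psi> (Suc q) ^ ?n" for q by (simp add: f_def)
    have "\<not> summable (\<lambda>q. f (Suc q))" unfolding fS by (rule div)
    then have "\<not> summable f" using summable_Suc_iff[of f] by blast
    moreover have "f (Suc q) \<le> f q" if "0 < q" for q
    proof -
      have "\<psi> (Suc q) \<le> \<psi> q" using \<psi>(2) that by (auto simp: monotone_on_def)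
      then show ?thesis using \<psi>(1)[of "Suc q"] that by (simp add: f_def power_mono)
    qed
    moreover have f0: "0 \<le> f q" for q using \<psi>(1)[of q] by (cases "q = 0") (auto simp: f_def)
    ultimately have "\<not> summable (\<lambda>t. 2 ^ t * f (2 ^ t))" using condensation_test[of f] by blast
    then have "\<not> summable (\<lambda>t. min (2 ^ t * f (2 ^ t)) 1)"
      using f0 by (intro not_summable_min) auto
    moreover have "summable (\<lambda>t. min (2 ^ t * f (2 ^ t)) 1)"
    proof (rule summable_comparison_test'[OF s])
      fix t :: nat
      have "min (2 ^ t * f (2 ^ t)) 1 = 2 ^ t * \<chi>' (2 ^ t) ^ ?n"
      proof -
        have "(real (2 ^ t) powr (- 1 / real ?n)) ^ ?n = 1 / 2 ^ t"
          using n0 by (subst powr_inverse_power) auto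
        moreover have "0 \<le> \<psi> (2 ^ t)" by (rule \<psi>(1)) simp
        moreover have "min a b ^ ?n = min (a ^ ?n) (b ^ ?n)" if "0 \<le> a" "0 \<le> b" for a b :: real
          using that by (simp add: min_def power_mono_iff)
        ultimately have "\<chi>' (2 ^ t) ^ ?n = min (\<psi> (2 ^ t) ^ ?n) (1 / 2 ^ t)"
          unfolding \<chi>'_def by simp
        then show ?thesis by (simp add: f_def min_def field_simps)
      qed
      also have "\<dots> \<le> 2 ^ t * \<phi> (2 ^ t) ^ ?n"
        using \<chi>0[of "2 ^ t"] by (intro mult_left_mono power_mono) (auto simp: \<phi>_def)
      finally show "norm (min (2 ^ t * f (2 ^ t)) 1) \<le> 2 ^ t * \<phi> (2 ^ t) ^ ?n"
        using f0[of "2 ^ t"] by simp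
    qed
    ultimately show False by blast
  qed
  then have neg: "negligible (cube z0 1 - {x. graph_point A x \<in> psi_approximable \<phi>})" for z0
    by (intro khintchine_divergence_regular[OF c w(1) w'(1) gap \<phi>_mono _ \<phi>n]) (auto simp: \<phi>_def \<zeta>_def)
  have conv: "negligible {x. graph_point A x \<in> psi_approximable \<zeta>}"
  proof (rule khintchine_convergence[OF c w'(4) w(2) gap])
    show "antimono_on {1..} \<zeta>" using \<zeta>_mono by (auto simp: monotone_on_def)
    have "summable (\<lambda>q. real q powr (- real ?n / w'))"
      using summable_real_powr_iff[of "- real ?n / w'"] w' by (simp add: field_simps)
    then have "summable (\<lambda>q. real (Suc q) powr (- real ?n / w'))" by (subst summable_Suc_iff)
    moreover have "\<zeta> (Suc q) ^ ?n = real (Suc q) powr (- real ?n / w')" for q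
      unfolding \<zeta>_def by (subst powr_realpow[symmetric]) (simp_all add: powr_powr minus_divide_left[symmetric] del: of_nat_Suc of_nat_add)
    ultimately show "summable (\<lambda>q. \<zeta> (Suc q) ^ ?n)" by (simp only:)
  qed (use \<zeta>0 in auto)
  let ?N = "{x. graph_point A x \<in> psi_approximable \<zeta>} \<union> (\<Union>z0\<in>range ivec. cube z0 1 - {x. graph_point A x \<in> psi_approximable \<phi>})"
  have "{x. graph_point A x \<notin> psi_approximable \<psi>} \<subseteq> ?N"
  proof
    fix x assume x: "x \<in> {x. graph_point A x \<notin> psi_approximable \<psi>}"
    have cu: "x \<in> cube (ivec (\<lambda>i. \<lfloor>x $ i\<rfloor>)) 1" by (auto simp: cube_def abs_le_iff) linarith+
    have "graph_point A x \<in> psi_approximable \<zeta>" if \<phi>x: "graph_point A x \<in> psi_approximable \<phi>"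
    proof -
      let ?Q = "\<lambda>\<psi>. {q. 1 \<le> q \<and> int_dist (real q *\<^sub>R graph_point A x) < \<psi> q}"
      have "?Q \<phi> \<subseteq> ?Q \<psi> \<union> ?Q \<zeta>" by (auto simp: \<phi>_def \<chi>'_def)
      then have "infinite (?Q \<psi> \<union> ?Q \<zeta>)" using \<phi>x finite_subset unfolding psi_approximable_def by blast
      then show ?thesis using x unfolding psi_approximable_def by simp
    qed
    then show "x \<in> ?N" using cu by blast
  qed
  moreover have "negligible ?N"
  proof (intro negligible_Un conv negligible_countable_Union)
    have "countable (UNIV :: ('d \<Rightarrow> int) set)" by simp
    then show "countable ((\<lambda>z0. cube z0 1 - {x. graph_point A x \<in> psi_approximable \<phi>}) ` range ivec)"
      by (intro countable_image)
  qed (use neg in blast)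
  ultimately show ?thesis using negligible_subset by blast
qed

section \<open>Exponents larger than the dimension\<close>

text \<open>
  The multiples \<open>qy\<close> lie close to the hyperplanes \<open>a \<cdot> z \<in> \<int>\<close>. Sort their fractional parts by the number of
  the hyperplane, of which there are \<open>O(h)\<close>, and by a grid of mesh \<open>1/H\<close> in all coordinates except
  the one where \<open>a\<close> is large. When two multiples agree in these data, the equation of the
  hyperplane controls the remaining coordinate. Compared with the usual pigeonhole
  argument, a factor \<open>H\<close> in the number of cells is replaced by \<open>h\<close>.
\<close>
lemma Dirichlet_near_hyperplane:
  fixes y :: "real^'n::finite" and a :: "'n \<Rightarrow> int"
  assumes h: "h = \<bar>real_of_int (a k0)\<bar>" "1 \<le> h" and K: "\<And>i. \<bar>real_of_int (a i)\<bar> \<le> K * h" "1 \<le> K"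
    and \<eta>: "\<bar>(\<Sum>i\<in>UNIV. of_int (a i) * y $ i) - of_int p0\<bar> \<le> \<eta>" "real N * \<eta> \<le> h"
    and H: "0 < H" "(2 * ((real CARD('n) * K + 1) * h) + 1) * real H ^ (CARD('n) - 1) \<le> real N"
  shows "\<exists>q\<ge>1. q \<le> N \<and> int_dist (real q *\<^sub>R y) \<le> real CARD('n) * K / real H + real N * \<eta> / h"
proof -
  let ?n = "real CARD('n)"
  have n1: "1 \<le> ?n" by (simp add: Suc_leI)
  have \<eta>0: "0 \<le> \<eta>" using \<eta>(1) by linarith
  have h0: "0 < h" using h(2) by linarith
  define level where "level q = (\<Sum>i\<in>UNIV. a i * \<lfloor>real q * y $ i\<rfloor>) - int q * p0" for q :: nat
  have frac_eq: "(\<Sum>i\<in>UNIV. of_int (a i) * frac (real q * y $ i)) = real q * ((\<Sum>i\<in>UNIV. of_int (a i) * y $ i) - of_int p0) - of_int (level q)" for q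
    by (simp add: frac_def level_def right_diff_distrib sum_subtractf sum_distrib_left mult_ac)
  define W where "W = \<lfloor>(?n * K + 1) * h\<rfloor>"
  have W: "of_int W \<le> (?n * K + 1) * h" "0 \<le> W"
    using h0 K n1 by (auto simp: W_def)
  have level_bound: "level q \<in> {-W..W}" if q: "q \<le> N" for q
  proof -
    have "\<bar>\<Sum>i\<in>UNIV. of_int (a i) * frac (real q * y $ i)\<bar> \<le> (\<Sum>i\<in>(UNIV::'n set). K * h * 1)"
    proof (rule order_trans[OF sum_abs], rule sum_mono)
      fix i
      show "\<bar>of_int (a i) * frac (real q * y $ i)\<bar> \<le> K * h * 1"
        unfolding abs_mult using K(1)[of i] frac_lt_1[of "real q * y $ i"] frac_ge_0[of "real q * y $ i"]
        by (intro mult_mono) auto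
    qed
    then have 1: "\<bar>\<Sum>i\<in>UNIV. of_int (a i) * frac (real q * y $ i)\<bar> \<le> ?n * K * h" by (simp add: mult_ac)
    have "\<bar>real q * ((\<Sum>i\<in>UNIV. of_int (a i) * y $ i) - of_int p0)\<bar> \<le> real N * \<eta>"
      unfolding abs_mult using q \<eta>(1) by (intro mult_mono) auto
    then have "\<bar>real_of_int (level q)\<bar> \<le> (?n * K + 1) * h"
      using 1 \<eta>(2) frac_eq[of q] by (simp add: distrib_right)
    then have "\<bar>level q\<bar> \<le> W" unfolding W_def by (simp add: le_floor_iff)
    then show ?thesis by auto
  qed
  define cell where "cell q i = (if i = k0 then level q else \<lfloor>real H * frac (real q * y $ i)\<rfloor>)" for q i
  let ?C = "PiE UNIV (\<lambda>i. if i = k0 then {-W..W} else {0..<int H})"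
  have "card ?C = (\<Prod>i\<in>insert k0 (UNIV - {k0}). card (if i = k0 then {-W..W} else {0..<int H}))"
    by (simp add: card_PiE insert_absorb)
  also have "\<dots> = nat (2 * W + 1) * (\<Prod>i\<in>UNIV - {k0}. card (if i = k0 then {-W..W} else {0..<int H}))"
    by (subst prod.insert) (auto simp: algebra_simps)
  also have "(\<Prod>i\<in>UNIV - {k0}. card (if i = k0 then {-W..W} else {0..<int H})) = (\<Prod>i\<in>UNIV - {k0}. H)"
    by (intro prod.cong) auto
  also have "\<dots> = H ^ (CARD('n) - 1)" by (simp add: card_Diff_singleton)
  finally have "real (card ?C) = (2 * of_int W + 1) * real H ^ (CARD('n) - 1)" using W(2) by simp
  also have "\<dots> \<le> (2 * ((?n * K + 1) * h) + 1) * real H ^ (CARD('n) - 1)"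
    using W(1) by (intro mult_right_mono) auto
  finally have "real (card ?C) \<le> real N" using H(2) by linarith
  then have "card ?C < card {0..N}" by simp
  moreover have "cell ` {0..N} \<subseteq> ?C"
    using cell_index_bounds[OF H(1)] level_bound by (auto simp: cell_def)
  moreover have "finite ?C" by (intro finite_PiE) auto
  ultimately have "\<not> inj_on cell {0..N}" by (meson card_inj_on_le not_le)
  then obtain p q where pq: "p < q" "q \<le> N" "cell p = cell q"
    by (auto simp: inj_on_def) (metis nat_neq_iff)
  define v where "v i = frac (real q * y $ i) - frac (real p * y $ i)" for i
  have v_small: "\<bar>v i\<bar> \<le> 1 / real H" if "i \<noteq> k0" for i
  proof -
    have "\<lfloor>real H * frac (real q * y $ i)\<rfloor> = \<lfloor>real H * frac (real p * y $ i)\<rfloor>"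
      using fun_cong[OF pq(3), of i] that by (simp add: cell_def)
    from same_cell_imp_close[OF H(1) this] show ?thesis unfolding v_def by linarith
  qed
  have "level q = level p" using fun_cong[OF pq(3), of k0] by (simp add: cell_def)
  then have "(\<Sum>i\<in>UNIV. of_int (a i) * v i) = (real q - real p) * ((\<Sum>i\<in>UNIV. of_int (a i) * y $ i) - of_int p0)"
    using frac_eq[of q] frac_eq[of p] by (simp add: v_def right_diff_distrib sum_subtractf left_diff_distrib)
  also have "\<bar>\<dots>\<bar> \<le> real N * \<eta>"
    unfolding abs_mult using pq \<eta>(1) by (intro mult_mono) auto
  finally have tot: "\<bar>\<Sum>i\<in>UNIV. of_int (a i) * v i\<bar> \<le> real N * \<eta>" .
  have "\<bar>\<Sum>i\<in>UNIV - {k0}. of_int (a i) * v i\<bar> \<le> (\<Sum>i\<in>UNIV - {k0}. K * h * (1 / real H))"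
  proof (rule order_trans[OF sum_abs], rule sum_mono)
    fix i assume "i \<in> UNIV - {k0}"
    then show "\<bar>of_int (a i) * v i\<bar> \<le> K * h * (1 / real H)"
      unfolding abs_mult using K(1)[of i] v_small[of i] K(2) h0 by (intro mult_mono) auto
  qed
  also have "\<dots> \<le> (\<Sum>i\<in>(UNIV::'n set). K * h * (1 / real H))"
    using K(2) h0 by (intro sum_mono2) auto
  finally have rest: "\<bar>\<Sum>i\<in>UNIV - {k0}. of_int (a i) * v i\<bar> \<le> ?n * (K * h * (1 / real H))" by simp
  have "(\<Sum>i\<in>UNIV. of_int (a i) * v i) = of_int (a k0) * v k0 + (\<Sum>i\<in>UNIV - {k0}. of_int (a i) * v i)"
    by (simp add: sum.remove[of UNIV k0])
  then have "\<bar>of_int (a k0) * v k0\<bar> \<le> real N * \<eta> + ?n * (K * h * (1 / real H))"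
    using tot rest by linarith
  then have "h * \<bar>v k0\<bar> \<le> real N * \<eta> + ?n * (K * h * (1 / real H))" by (simp add: abs_mult h(1))
  then have "\<bar>v k0\<bar> \<le> (real N * \<eta> + ?n * (K * h * (1 / real H))) / h"
    using h0 by (simp add: pos_le_divide_eq mult.commute)
  also have "\<dots> = ?n * K / real H + real N * \<eta> / h"
    using h0 by (simp add: add_divide_distrib)
  finally have v0: "\<bar>v k0\<bar> \<le> ?n * K / real H + real N * \<eta> / h" .
  have "\<bar>v i\<bar> \<le> ?n * K / real H + real N * \<eta> / h" for i
  proof (cases "i = k0")
    case False
    have "1 * 1 \<le> ?n * K" using n1 K by (intro mult_mono) auto
    then have "1 / real H \<le> ?n * K / real H" by (intro divide_right_mono) auto
    moreover have "0 \<le> real N * \<eta> / h" using \<eta>0 h0 by simp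
    ultimately show ?thesis using v_small[OF False] by linarith
  qed (use v0 in simp)
  then have "int_dist (real (q - p) *\<^sub>R y) \<le> ?n * K / real H + real N * \<eta> / h"
    using pq(1)
    by (intro int_dist_leI[where p="\<lambda>i. \<lfloor>real q * y $ i\<rfloor> - \<lfloor>real p * y $ i\<rfloor>"])
       (simp add: v_def frac_def of_nat_diff algebra_simps)
  then show ?thesis using pq by (intro exI[of _ "q - p"]) auto
qed

text \<open>
  If only finitely many \<open>q\<close> occurred, one of them would have distance zero, and so would its
  multiples.
\<close>
lemma psi_approximable_if_arbitrarily_close:
  fixes y :: "real^'n::finite"
  assumes \<psi>: "\<And>q. 1 \<le> q \<Longrightarrow> 0 < \<psi> q"
    and close: "\<And>e. 0 < e \<Longrightarrow> \<exists>q\<ge>1. int_dist (real q *\<^sub>R y) < \<psi> q \<and> int_dist (real q *\<^sub>R y) < e"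
  shows "y \<in> psi_approximable \<psi>"
proof (rule ccontr)
  let ?Q = "{q. 1 \<le> q \<and> int_dist (real q *\<^sub>R y) < \<psi> q}"
  assume "y \<notin> psi_approximable \<psi>"
  then have fin: "finite ?Q" by (simp add: psi_approximable_def)
  have "\<exists>q\<in>?Q. int_dist (real q *\<^sub>R y) = 0"
  proof (rule ccontr)
    assume "\<not> ?thesis"
    then have pos: "0 < int_dist (real q *\<^sub>R y)" if "q \<in> ?Q" for q
      using that int_dist_nonneg[of "real q *\<^sub>R y"] by (metis less_eq_real_def)
    define e where "e = Min (insert 1 ((\<lambda>q. int_dist (real q *\<^sub>R y)) ` ?Q))"
    have "0 < e" unfolding e_def using fin pos by (subst Min_gr_iff) auto
    then obtain q where q: "q \<in> ?Q" "int_dist (real q *\<^sub>R y) < e" using close by blast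
    moreover have "e \<le> int_dist (real q *\<^sub>R y)" unfolding e_def using fin q(1) by (intro Min_le) auto
    ultimately show False by linarith
  qed
  then obtain q where q: "1 \<le> q" "int_dist (real q *\<^sub>R y) = 0" by blast
  have "range (\<lambda>k. Suc k * q) \<subseteq> ?Q"
  proof safe
    fix k
    show "1 \<le> Suc k * q" using q(1) by simp
    have "int_dist (real (Suc k) *\<^sub>R (real q *\<^sub>R y)) = 0" by (rule int_dist_scale_zero[OF q(2)])
    then show "int_dist (real (Suc k * q) *\<^sub>R y) < \<psi> (Suc k * q)"
      using \<psi>[of "Suc k * q"] q(1) by (simp only: scaleR_scaleR of_nat_mult) simp
  qed
  moreover have "inj (\<lambda>k. Suc k * q)" using q(1) by (auto simp: inj_def)
  ultimately show False using fin by (meson finite_subset infinite_UNIV_nat range_inj_infinite)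
qed

lemma infnorm_attained: "\<exists>k. infnorm (x::real^'n::finite) = \<bar>x $ k\<bar>"
proof -
  have "finite (range (\<lambda>i. \<bar>x $ i\<bar>))" by simp
  then have "Max (range (\<lambda>i. \<bar>x $ i\<bar>)) \<in> range (\<lambda>i. \<bar>x $ i\<bar>)" by (intro Max_in) auto
  then obtain k where k: "Max (range (\<lambda>i. \<bar>x $ i\<bar>)) = \<bar>x $ k\<bar>" by blast
  have "infnorm x \<le> \<bar>x $ k\<bar>" unfolding infnorm_cart_le_iff k[symmetric] by simp
  then show ?thesis using component_le_infnorm_cart[of x k] by (intro exI[of _ k]) linarith
qed

text \<open>
  If \<open>AJ\<close> is close to the integer vector \<open>p = (p\<^sub>0, p')\<close>, then \<open>y \<cdot> J - x \<cdot> p'\<close> is close to \<open>p\<^sub>0\<close> for every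
  point \<open>(x,y)\<close> of the affine subspace.
\<close>
lemma close_to_rational_hyperplane:
  fixes A :: "real^'m::finite^('d::finite option)" and x :: "real^'d"
  assumes J: "1 \<le> infnorm (ivec J)" "int_dist (A *v ivec J) < \<epsilon>" "\<epsilon> \<le> 1"
  shows "\<exists>a p0 k0. infnorm (ivec J) = \<bar>real_of_int (a k0)\<bar> \<and>
    (\<forall>i. \<bar>real_of_int (a i)\<bar> \<le> row_bound A * infnorm (ivec J)) \<and>
    \<bar>(\<Sum>i\<in>UNIV. of_int (a i) * graph_point A x $ i) - of_int p0\<bar> \<le> (\<Sum>i\<in>UNIV. \<bar>tilde x $ i\<bar>) * \<epsilon>"
proof -
  let ?h = "infnorm (ivec J)"
  obtain p where p: "\<And>i. \<bar>(A *v ivec J) $ i - of_int (p i)\<bar> < \<epsilon>"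
    using J(2) unfolding int_dist_less_iff by blast
  obtain l0 where l0: "?h = \<bar>ivec J $ l0\<bar>" using infnorm_attained by blast
  define a where "a k = (case k of Inl i \<Rightarrow> - p (Some i) | Inr l \<Rightarrow> J l)" for k
  have "\<bar>real_of_int (p i)\<bar> \<le> row_bound A * ?h" for i
  proof -
    have "\<bar>(A *v ivec J) $ i\<bar> \<le> (\<Sum>l\<in>UNIV. \<bar>A $ i $ l * ivec J $ l\<bar>)"
      unfolding matrix_vector_mult_def vec_lambda_beta by (rule sum_abs)
    also have "\<dots> \<le> (\<Sum>l\<in>UNIV. \<bar>A $ i $ l\<bar> * ?h)"
      unfolding abs_mult by (intro sum_mono mult_left_mono component_le_infnorm_cart) auto
    also have "\<dots> \<le> (\<Sum>i\<in>UNIV. \<Sum>l\<in>UNIV. \<bar>A $ i $ l\<bar>) * ?h"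
      unfolding sum_distrib_right[symmetric]
      by (intro mult_right_mono member_le_sum[where f="\<lambda>i. \<Sum>l\<in>UNIV. \<bar>A $ i $ l\<bar>"] sum_nonneg infnorm_pos_le) auto
    finally have "\<bar>(A *v ivec J) $ i\<bar> \<le> (\<Sum>i\<in>UNIV. \<Sum>l\<in>UNIV. \<bar>A $ i $ l\<bar>) * ?h" .
    then have "\<bar>real_of_int (p i)\<bar> \<le> (\<Sum>i\<in>UNIV. \<Sum>l\<in>UNIV. \<bar>A $ i $ l\<bar>) * ?h + ?h"
      using p[of i] J by linarith
    then show ?thesis by (simp add: row_bound_def algebra_simps)
  qed
  moreover have "\<bar>real_of_int (J l)\<bar> \<le> row_bound A * ?h" for l
  proof -
    have "\<bar>ivec J $ l\<bar> \<le> ?h" by (rule component_le_infnorm_cart)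
    moreover have "1 * ?h \<le> row_bound A * ?h"
      by (intro mult_right_mono row_bound_ge_1 infnorm_pos_le)
    ultimately show ?thesis by simp
  qed
  ultimately have bound: "\<bar>real_of_int (a i)\<bar> \<le> row_bound A * ?h" for i
    by (cases i) (simp_all add: a_def)
  have "(\<Sum>i\<in>UNIV. of_int (a i) * graph_point A x $ i)
      = (\<Sum>i\<in>UNIV. of_int (a (Inl i)) * graph_point A x $ Inl i) + (\<Sum>l\<in>UNIV. of_int (a (Inr l)) * graph_point A x $ Inr l)"
    by (subst UNIV_Plus_UNIV[symmetric], subst sum.Plus) (auto simp: comp_def)
  also have "(\<Sum>l\<in>UNIV. of_int (a (Inr l)) * graph_point A x $ Inr l) = (\<Sum>i\<in>UNIV. tilde x $ i * (A *v ivec J) $ i)"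
    using dot_lmul_matrix[of "tilde x" A "ivec J"] by (simp add: a_def inner_vec_def mult.commute)
  also have "(\<Sum>i\<in>UNIV. of_int (a (Inl i)) * graph_point A x $ Inl i) = of_int (p None) - (\<Sum>i\<in>UNIV. tilde x $ i * of_int (p i))"
    by (simp add: a_def UNIV_option_conv sum.reindex sum_negf mult.commute)
  finally have "(\<Sum>i\<in>UNIV. of_int (a i) * graph_point A x $ i) - of_int (p None)
      = (\<Sum>i\<in>UNIV. tilde x $ i * ((A *v ivec J) $ i - of_int (p i)))"
    by (simp add: right_diff_distrib sum_subtractf)
  also have "\<bar>\<dots>\<bar> \<le> (\<Sum>i\<in>UNIV. \<bar>tilde x $ i\<bar> * \<epsilon>)"
    by (rule order_trans[OF sum_abs]) (auto intro!: sum_mono mult_left_mono less_imp_le[OF p] simp: abs_mult)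
  finally have "\<bar>(\<Sum>i\<in>UNIV. of_int (a i) * graph_point A x $ i) - of_int (p None)\<bar> \<le> (\<Sum>i\<in>UNIV. \<bar>tilde x $ i\<bar>) * \<epsilon>"
    by (simp add: sum_distrib_right)
  moreover have "?h = \<bar>real_of_int (a (Inr l0))\<bar>" using l0 by (simp add: a_def)
  ultimately show ?thesis using bound by blast
qed

lemma eventually_powr_sum_less:
  fixes e1 e2 g C1 C2 :: real
  assumes "g < e1" "g < e2"
  shows "\<forall>\<^sub>F h in at_top. C1 * h powr (- e1) + C2 * h powr (- e2) < h powr (- g)"
proof -
  have "((\<lambda>h. C1 * h powr (g - e1) + C2 * h powr (g - e2)) \<longlongrightarrow> C1 * 0 + C2 * 0) at_top"
    using assms by (intro tendsto_intros tendsto_neg_powr filterlim_ident) auto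
  then have "\<forall>\<^sub>F h in at_top. C1 * h powr (g - e1) + C2 * h powr (g - e2) < 1"
    by (intro order_tendstoD(2)) auto
  then show ?thesis using eventually_gt_at_top[of 0]
  proof eventually_elim
    case (elim h)
    have "C1 * h powr (- e1) + C2 * h powr (- e2) = (C1 * h powr (g - e1) + C2 * h powr (g - e2)) * h powr (- g)"
      by (simp add: distrib_right powr_add[symmetric] mult.assoc)
    also have "\<dots> < 1 * h powr (- g)" using elim by (intro mult_strict_right_mono) auto
    finally show ?case by simp
  qed
qed

lemma nat_floor_bounds:
  assumes "1 \<le> (y::real)"
  shows "real (nat \<lfloor>y\<rfloor>) \<le> y" "y / 2 \<le> real (nat \<lfloor>y\<rfloor>)" "0 < nat \<lfloor>y\<rfloor>"
proof -
  have "1 \<le> \<lfloor>y\<rfloor>" using assms by linarith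
  moreover from this have "real (nat \<lfloor>y\<rfloor>) = of_int \<lfloor>y\<rfloor>" by simp
  ultimately show "real (nat \<lfloor>y\<rfloor>) \<le> y" "y / 2 \<le> real (nat \<lfloor>y\<rfloor>)" "0 < nat \<lfloor>y\<rfloor>" by linarith+
qed

text \<open>
  Let \<open>h = \<bar>J\<bar>\<close> for one of the infinitely many good \<open>J\<close>, and use \<open>N\<close> about \<open>h\<close> to the power \<open>\<tau>\<close>
  multiples. The mesh is then of the order of \<open>h\<close> to the power \<open>-e1\<close>, and the distance to the hyperplane accumulates to \<open>h\<close> to the
  power \<open>-e2\<close>. Both are smaller than \<open>N\<close> to the power \<open>-1/n\<close>: the first because \<open>\<tau> > n\<close>, the second
  because \<open>\<tau> < n(w + 1)/(n + 1)\<close>; such a \<open>\<tau>\<close> exists because \<open>w > n\<close>.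
\<close>
theorem approximable_if_large_exponent:
  fixes A :: "real^'m::finite^('d::finite option)"
  assumes w: "real (CARD('d) + CARD('m)) < w"
    and inf: "infinite {q \<in> int_vectors. int_dist (A *v q) < infnorm q powr (- w)}"
  shows "\<exists>\<gamma>>0. 1 < real (CARD('d) + CARD('m)) * \<gamma> \<and> (\<forall>x. graph_point A x \<in> psi_approximable (\<lambda>q. real q powr (- \<gamma>)))"
proof -
  let ?n = "CARD('d) + CARD('m)"
  define n where "n = real ?n"
  have "1 \<le> CARD('d)" "1 \<le> CARD('m)" by (simp_all add: Suc_leI)
  then have n2: "2 \<le> n" unfolding n_def by linarith
  have nw: "n < w" using w by (simp add: n_def)
  have "n < n * (w + 1) / (n + 1)" using nw n2 by (simp add: field_simps)
  then obtain \<tau> where \<tau>: "n < \<tau>" "\<tau> < n * (w + 1) / (n + 1)" using dense by blast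
  define e1 where "e1 = (\<tau> - 1) / (n - 1)"
  define e2 where "e2 = w + 1 - \<tau>"
  have "\<tau> / n < e1" using \<tau>(1) n2 by (simp add: e1_def field_simps)
  moreover have "\<tau> / n < e2" using \<tau>(2) n2 by (simp add: e2_def field_simps)
  ultimately have "\<tau> / n < min e1 e2" by simp
  then obtain g where g: "\<tau> / n < g" "g < min e1 e2" using dense by blast
  define \<gamma> where "\<gamma> = g / \<tau>"
  have \<tau>0: "0 < \<tau>" using \<tau>(1) n2 by linarith
  have g0: "0 < g" using g(1) \<tau>0 n2 by (smt (verit) divide_pos_pos)
  have \<gamma>: "0 < \<gamma>" "1 < n * \<gamma>" "\<tau> * \<gamma> = g"
    using g(1) g0 \<tau>0 n2 by (simp_all add: \<gamma>_def field_simps)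
  have "graph_point A x \<in> psi_approximable (\<lambda>q. real q powr (- \<gamma>))" for x
  proof (rule psi_approximable_if_arbitrarily_close)
    fix e :: real assume e: "0 < e"
    define S where "S = (\<Sum>i\<in>UNIV. \<bar>tilde x $ i\<bar>)"
    have S0: "0 \<le> S" by (simp add: S_def sum_nonneg)
    define K where "K = row_bound A"
    have K: "1 \<le> K" unfolding K_def by (rule row_bound_ge_1)
    define C where "C = 2 * (n * K + 1) + 1"
    have C: "1 \<le> C" using n2 K by (simp add: C_def)
    define D where "D = n * K * 2 * (2 * C) powr (1 / (n - 1))"
    have ev1: "\<forall>\<^sub>F h in at_top. D * h powr (- e1) + S * h powr (- e2) < h powr (- g)"
      using g by (intro eventually_powr_sum_less) auto
    have ev2: "\<forall>\<^sub>F h in at_top. h powr (- g) < e"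
      using g0 e by (intro order_tendstoD(2)[OF tendsto_neg_powr] filterlim_ident) auto
    have ev3: "\<forall>\<^sub>F h in at_top. S * h powr (- e2) < 1"
    proof (rule order_tendstoD(2))
      have "((\<lambda>h. S * h powr (- e2)) \<longlongrightarrow> S * 0) at_top"
        using g g0 by (intro tendsto_intros tendsto_neg_powr filterlim_ident) auto
      then show "((\<lambda>h. S * h powr (- e2)) \<longlongrightarrow> 0) at_top" by simp
    qed simp
    have ev4: "\<forall>\<^sub>F h in at_top. (2 * C) powr (1 / (n - 1)) * h powr (- e1) < 1"
    proof (rule order_tendstoD(2))
      have "((\<lambda>h. (2 * C) powr (1 / (n - 1)) * h powr (- e1)) \<longlongrightarrow> (2 * C) powr (1 / (n - 1)) * 0) at_top"
        using g g0 by (intro tendsto_intros tendsto_neg_powr filterlim_ident) auto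
      then show "((\<lambda>h. (2 * C) powr (1 / (n - 1)) * h powr (- e1)) \<longlongrightarrow> 0) at_top" by simp
    qed simp
    obtain h0 where h0: "\<And>h. h0 \<le> h \<Longrightarrow> D * h powr (- e1) + S * h powr (- e2) < h powr (- g) \<and>
       h powr (- g) < e \<and> S * h powr (- e2) < 1 \<and> (2 * C) powr (1 / (n - 1)) * h powr (- e1) < 1"
      using eventually_conj[OF ev1 eventually_conj[OF ev2 eventually_conj[OF ev3 ev4]]]
      unfolding eventually_at_top_linorder by blast
    obtain v where v: "v \<in> int_vectors" "int_dist (A *v v) < infnorm v powr (- w)" "max h0 1 < infnorm v"
      using infinite_bounded_int_functions[OF inf, of "max h0 1"] by blast
    then obtain J where J: "v = ivec J" by (auto simp: int_vectors_eq_range_ivec)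
    define h where "h = infnorm (ivec J)"
    have h: "1 \<le> h" "h0 \<le> h" using v(3) by (simp_all add: h_def J)
    have hp: "0 < h" using h by linarith
    have hw: "h powr (- w) \<le> 1" using h nw n2 powr_mono2'[of "- w" 1 h] by simp
    obtain a p0 k0 where a: "h = \<bar>real_of_int (a k0)\<bar>" "\<And>i. \<bar>real_of_int (a i)\<bar> \<le> K * h"
      "\<bar>(\<Sum>i\<in>UNIV. of_int (a i) * graph_point A x $ i) - of_int p0\<bar> \<le> S * h powr (- w)"
      using close_to_rational_hyperplane[of J A "h powr (- w)" x] v(2) h(1) hw unfolding h_def J K_def S_def by blast
    define N where "N = nat \<lfloor>h powr \<tau>\<rfloor>"
    define B where "B = h powr (\<tau> - 1) / (2 * C)"
    define H where "H = nat \<lfloor>B powr (1 / (n - 1))\<rfloor>"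
    have h\<tau>: "1 \<le> h powr \<tau>" using h \<tau>0 by (simp add: ge_one_powr_ge_zero)
    then have N: "real N \<le> h powr \<tau>" "h powr \<tau> / 2 \<le> real N" unfolding N_def by (simp_all only: nat_floor_bounds)
    have B0: "0 < B" using hp C by (simp add: B_def)
    have B_eq: "B powr (1 / (n - 1)) = h powr e1 / (2 * C) powr (1 / (n - 1))"
      using hp C by (simp add: B_def powr_divide powr_powr e1_def)
    have C2: "0 < (2 * C) powr (1 / (n - 1))" using C by simp
    have "1 < B powr (1 / (n - 1))"
      using h0[OF h(2)] hp C2 unfolding B_eq by (simp add: powr_minus field_simps)
    then have H: "real H \<le> B powr (1 / (n - 1))" "B powr (1 / (n - 1)) / 2 \<le> real H" "0 < H"
      unfolding H_def by (simp_all only: nat_floor_bounds less_imp_le)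
    have card_n: "CARD('d + 'm) = ?n" by simp
    have "real H ^ (?n - 1) \<le> B"
    proof -
      have "real H ^ (?n - 1) \<le> (B powr (1 / (n - 1))) ^ (?n - 1)" using H(1) by (intro power_mono) auto
      also have "\<dots> = B powr (1 / (n - 1) * real (?n - 1))"
        using B0 by (subst powr_realpow[symmetric]) (simp_all add: powr_powr)
      also have "real (?n - 1) = n - 1" using n2 unfolding n_def by (subst of_nat_diff) auto
      also have "1 / (n - 1) * (n - 1) = 1" using n2 by simp
      finally show ?thesis using B0 by simp
    qed
    then have "(2 * ((n * K + 1) * h) + 1) * real H ^ (?n - 1) \<le> (C * h) * B"
      using h n2 K B0 C by (intro mult_mono) (auto simp: C_def algebra_simps)
    also have "\<dots> = h powr \<tau> / 2" using hp C by (simp add: B_def powr_diff field_simps)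
    also have "\<dots> \<le> real N" by (fact N(2))
    finally have HN: "(2 * ((n * K + 1) * h) + 1) * real H ^ (?n - 1) \<le> real N" .
    have N\<eta>: "real N * (S * h powr (- w)) \<le> S * h powr (\<tau> - w)"
    proof -
      have "real N * (S * h powr (- w)) \<le> h powr \<tau> * (S * h powr (- w))"
        using N(1) S0 by (intro mult_right_mono) auto
      also have "\<dots> = S * h powr (\<tau> - w)" by (simp add: powr_add[symmetric] mult_ac)
      finally show ?thesis .
    qed
    have e2_eq: "h powr (\<tau> - w) = h powr (- e2) * h"
      using hp powr_add[of h "- e2" 1] by (simp add: e2_def)
    have "S * h powr (\<tau> - w) \<le> 1 * h"
      unfolding e2_eq mult.assoc[symmetric] using h0[OF h(2)] hp by (intro mult_right_mono) auto
    then have N\<eta>h: "real N * (S * h powr (- w)) \<le> h" using N\<eta> by linarith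
    obtain q where q: "1 \<le> q" "q \<le> N"
      "int_dist (real q *\<^sub>R graph_point A x) \<le> n * K / real H + real N * (S * h powr (- w)) / h"
      using Dirichlet_near_hyperplane[OF a(1) h(1) a(2) K a(3) N\<eta>h H(3)] HN unfolding card_n n_def by auto
    have "n * K / real H \<le> n * K / (B powr (1 / (n - 1)) / 2)"
      using H(2,3) n2 K B0 by (intro divide_left_mono mult_pos_pos) auto
    also have "\<dots> = D * h powr (- e1)"
      unfolding B_eq D_def using hp by (simp add: powr_minus field_simps)
    finally have 1: "n * K / real H \<le> D * h powr (- e1)" .
    have "real N * (S * h powr (- w)) / h \<le> S * h powr (\<tau> - w) / h"
      using N\<eta> hp by (intro divide_right_mono) auto
    also have "\<dots> = S * h powr (- e2)" unfolding e2_eq using hp by simp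
    finally have "int_dist (real q *\<^sub>R graph_point A x) < h powr (- g)"
      using 1 q(3) h0[OF h(2)] by linarith
    moreover have "h powr (- g) \<le> real q powr (- \<gamma>)"
    proof -
      have "real q \<le> h powr \<tau>" using q(2) N(1) by linarith
      then have "(h powr \<tau>) powr (- \<gamma>) \<le> real q powr (- \<gamma>)" using q(1) \<gamma>(1) by (intro powr_mono2') auto
      then show ?thesis by (simp add: powr_powr \<gamma>(3))
    qed
    ultimately show "\<exists>q\<ge>1. int_dist (real q *\<^sub>R graph_point A x) < real q powr (- \<gamma>) \<and> int_dist (real q *\<^sub>R graph_point A x) < e"
      using q(1) h0[OF h(2)] by (intro exI[of _ q]) auto
  qed simp
  then show ?thesis using \<gamma> by (auto simp: n_def)
qed

section \<open>Null sets in the affine subspace\<close>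

definition graph_direction :: "real^'m^('d::finite option) \<Rightarrow> real^'d \<Rightarrow> real^('d + 'm::finite)" where
  "graph_direction A v = graph_point A v - graph_point A 0"

lemma graph_direction_nth:
  "graph_direction A v $ Inl i = v $ i"
  "graph_direction A v $ Inr j = (\<Sum>i\<in>UNIV. v $ i * A $ Some i $ j)"
  by (simp_all add: graph_direction_def vector_matrix_mult_def UNIV_option_conv sum.reindex)

lemma linear_graph_direction: "linear (graph_direction A)"
proof (rule linearI)
  show "graph_direction A (u + v) = graph_direction A u + graph_direction A v" for u v
    unfolding vec_eq_iff
  proof
    fix i show "graph_direction A (u + v) $ i = (graph_direction A u + graph_direction A v) $ i"
      by (cases i) (simp_all add: graph_direction_nth sum.distrib distrib_right)
  qed
  show "graph_direction A (c *\<^sub>R u) = c *\<^sub>R graph_direction A u" for c u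
    unfolding vec_eq_iff
  proof
    fix i show "graph_direction A (c *\<^sub>R u) $ i = (c *\<^sub>R graph_direction A u) $ i"
      by (cases i) (simp_all add: graph_direction_nth sum_distrib_left mult.assoc)
  qed
qed

lemma graph_point_has_derivative: "(graph_point A has_derivative graph_direction A) (at x)"
proof -
  have "((\<lambda>x. graph_direction A x + graph_point A 0) has_derivative graph_direction A) (at x)"
    by (intro has_derivative_add_const linear_imp_has_derivative linear_graph_direction)
  then show ?thesis by (simp add: graph_direction_def[abs_def])
qed

definition base_part :: "real^('d::finite + 'm::finite) \<Rightarrow> real^'d" where
  "base_part y = (\<chi> i. y $ Inl i)"

lemma linear_base_part: "linear base_part"
  by (rule linearI) (simp_all add: base_part_def vec_eq_iff)

lemma base_part_graph_point [simp]: "base_part (graph_point A x) = x"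
  by (simp add: base_part_def vec_eq_iff)

lemma base_part_graph_direction [simp]: "base_part (graph_direction A x) = x"
  by (simp add: base_part_def vec_eq_iff graph_direction_nth)

lemma graph_point_base_part: "y \<in> affine_graph A \<Longrightarrow> graph_point A (base_part y) = y"
  by (auto simp: affine_graph_eq_range)

lemma continuous_on_base_part: "continuous_on S base_part"
  by (rule linear_continuous_on_compose[OF continuous_on_id linear_base_part])

lemma inj_graph_direction: "inj (graph_direction A)"
  by (metis base_part_graph_direction injI)

lemma local_parametrization_graph_point:
  fixes A :: "real^'m::finite^('d::finite option)"
  shows "local_parametrization UNIV (graph_point A) (affine_graph A)"
  unfolding local_parametrization_def
proof (intro conjI)
  have bl: "bounded_linear (graph_direction A)"
    using linear_graph_direction by (simp add: linear_conv_bounded_linear)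
  show "\<exists>f' :: real^'d \<Rightarrow> (real^'d) \<Rightarrow>\<^sub>L (real^('d + 'm)).
        continuous_on UNIV f' \<and>
        (\<forall>u\<in>UNIV. (graph_point A has_derivative blinfun_apply (f' u)) (at u) \<and> inj (blinfun_apply (f' u)))"
    by (rule exI[of _ "\<lambda>_. Blinfun (graph_direction A)"])
       (simp add: bounded_linear_Blinfun_apply[OF bl] graph_point_has_derivative inj_graph_direction)
  have "homeomorphism UNIV (range (graph_point A)) (graph_point A) base_part"
    by (rule homeomorphismI) (auto simp: continuous_on_graph_point continuous_on_base_part)
  then show "\<exists>g. homeomorphism UNIV (range (graph_point A)) (graph_point A) g" by blast
qed (simp_all add: affine_graph_eq_range openin_subtopology_self)

lemma submanifold_affine_graph:
  fixes A :: "real^'m::finite^('d::finite option)"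
  shows "submanifold TYPE('d) (affine_graph A)"
  unfolding submanifold_def using local_parametrization_graph_point[of A] by (auto simp: affine_graph_eq_range)

lemma continuous_on_det:
  fixes M :: "'a::topological_space \<Rightarrow> real^'n::finite^'n"
  assumes "\<And>i j. continuous_on S (\<lambda>x. M x $ i $ j)"
  shows "continuous_on S (\<lambda>x. det (M x))"
  unfolding det_def by (intro continuous_on_sum continuous_on_mult continuous_on_const continuous_on_prod assms)

lemma borel_measurable_volume_density:
  assumes "local_parametrization U f M"
  shows "(\<lambda>u. let J = matrix (frechet_derivative f (at u)) in ennreal (sqrt (det (transpose J ** J))))
    \<in> borel_measurable (lebesgue_on U)"
proof -
  obtain f' where U: "open U" and f': "continuous_on U f'"
    and der: "\<And>u. u \<in> U \<Longrightarrow> (f has_derivative blinfun_apply (f' u)) (at u)"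
    using assms unfolding local_parametrization_def by blast
  have c: "continuous_on U (\<lambda>u. matrix (blinfun_apply (f' u)) $ i $ j)" for i j
    unfolding matrix_def vec_lambda_beta
    by (intro continuous_on_component blinfun.continuous_on f' continuous_on_const)
  define \<rho> where "\<rho> u = sqrt (det (transpose (matrix (blinfun_apply (f' u))) ** matrix (blinfun_apply (f' u))))" for u
  have "continuous_on U \<rho>"
    unfolding \<rho>_def
  proof (intro continuous_on_real_sqrt continuous_on_det)
    fix i j
    show "continuous_on U (\<lambda>u. (transpose (matrix (blinfun_apply (f' u))) ** matrix (blinfun_apply (f' u))) $ i $ j)"
      unfolding matrix_matrix_mult_def transpose_def vec_lambda_beta
      by (intro continuous_on_sum continuous_on_mult c)
  qed
  then have m: "\<rho> \<in> borel_measurable (lebesgue_on U)"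
    using U by (intro continuous_imp_measurable_on_sets_lebesgue) auto
  have "(\<lambda>u. let J = matrix (frechet_derivative f (at u)) in ennreal (sqrt (det (transpose J ** J))))
    \<in> borel_measurable (lebesgue_on U) \<longleftrightarrow> (\<lambda>u. ennreal (\<rho> u)) \<in> borel_measurable (lebesgue_on U)"
  proof (rule measurable_cong)
    fix u assume "u \<in> space (lebesgue_on U)"
    then have "frechet_derivative f (at u) = blinfun_apply (f' u)"
      using frechet_derivative_at[OF der] by simp
    then show "(let J = matrix (frechet_derivative f (at u)) in ennreal (sqrt (det (transpose J ** J)))) = ennreal (\<rho> u)"
      by (simp add: \<rho>_def Let_def)
  qed
  then show ?thesis using m by simp
qed

text \<open>
  Let \<open>g\<close> be the first component of an arbitrary parametrization \<open>f\<close>. Since \<open>f\<close> is the graph map after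
  \<open>g\<close>, its derivative factors through that of \<open>g\<close>, which is therefore invertible. So \<open>g\<close> has a differentiable
  inverse, which maps null sets to null sets.
\<close>
lemma null_in_affine_graph_if_negligible:
  fixes A :: "real^'m::finite^('d::finite option)"
  assumes "negligible {x. graph_point A x \<in> E}"
  shows "null_in TYPE('d) (affine_graph A) E"
  unfolding null_in_def
proof (intro allI impI)
  fix U :: "(real^'d) set" and f :: "real^'d \<Rightarrow> real^('d + 'm)"
  assume par: "local_parametrization U f (affine_graph A)"
  then obtain f' h where U: "open U"
    and der: "\<And>u. u \<in> U \<Longrightarrow> (f has_derivative blinfun_apply (f' u)) (at u)"
    and inj: "\<And>u. u \<in> U \<Longrightarrow> inj (blinfun_apply (f' u))"
    and op: "openin (top_of_set (affine_graph A)) (f ` U)"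
    and hom: "homeomorphism U (f ` U) f h"
    unfolding local_parametrization_def by blast
  define g where "g u = base_part (f u)" for u
  have fg: "graph_point A (g u) = f u" if "u \<in> U" for u
    unfolding g_def using openin_imp_subset[OF op] that by (intro graph_point_base_part) auto
  define k where "k x = h (graph_point A x)" for x
  have kg: "k (g u) = u" if "u \<in> U" for u
    using homeomorphism_apply1[OF hom that] fg[OF that] by (simp add: k_def)
  have cont_g: "continuous_on U g"
    unfolding g_def by (rule linear_continuous_on_compose[OF homeomorphism_cont1[OF hom] linear_base_part])
  have k_diff: "k differentiable (at (g u))" if u: "u \<in> U" for u
  proof -
    define g' where "g' v = base_part (blinfun_apply (f' u) v)" for v
    have dg: "(g has_derivative g') (at u)"
      unfolding g_def g'_def
      by (rule bounded_linear.has_derivative[OF linear_base_part[unfolded linear_conv_bounded_linear] der[OF u]])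
    have "(graph_point A \<circ> g has_derivative graph_direction A \<circ> g') (at u)"
      by (rule diff_chain_at[OF dg graph_point_has_derivative])
    then have "(f has_derivative graph_direction A \<circ> g') (at u)"
      by (rule has_derivative_transform_within_open[OF _ U u]) (simp add: fg)
    then have f'_eq: "blinfun_apply (f' u) = graph_direction A \<circ> g'"
      using has_derivative_unique[OF der[OF u]] by blast
    have "linear g'" using dg has_derivative_linear by blast
    moreover have "inj g'" using inj[OF u] unfolding f'_eq by (rule inj_on_imageI2)
    ultimately obtain g'' where g'': "\<And>v. g' (g'' v) = v"
      using linear_injective_isomorphism[of g'] by blast
    have "(k has_derivative g'') (at (g u))"
      by (rule has_derivative_inverse_strong[OF U u cont_g kg dg]) (auto simp: g'')
    then show ?thesis by (rule differentiableI)
  qed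
  let ?N = "{u \<in> U. f u \<in> E}"
  have "?N = k ` ({x. graph_point A x \<in> E} \<inter> g ` U)"
  proof (intro equalityI subsetI)
    fix u assume u: "u \<in> ?N"
    then have "g u \<in> {x. graph_point A x \<in> E} \<inter> g ` U" by (simp add: fg)
    then show "u \<in> k ` ({x. graph_point A x \<in> E} \<inter> g ` U)" using u kg[of u] by (metis (no_types, lifting) image_eqI mem_Collect_eq)
  qed (auto simp: fg kg)
  also have "negligible \<dots>"
  proof (rule negligible_differentiable_image_negligible[OF order_refl])
    show "negligible ({x. graph_point A x \<in> E} \<inter> g ` U)" using assms by (rule negligible_subset) auto
    show "k differentiable_on {x. graph_point A x \<in> E} \<inter> g ` U"
      unfolding differentiable_on_def using k_diff differentiable_at_withinI by blast
  qed
  finally have "?N \<in> null_sets lebesgue" by (simp add: negligible_iff_null_sets)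
  then have N: "?N \<in> null_sets (lebesgue_on U)"
    using U by (subst null_sets_restrict_space) auto
  show "?N \<in> null_sets (coordinate_volume U f)"
    unfolding coordinate_volume_def null_sets_density_iff[OF borel_measurable_volume_density[OF par]]
    using N AE_not_in[OF N] by auto
qed

text \<open>
  The matrices on the segment from the identity to the Gram matrix are positive definite, hence
  invertible, so the determinant keeps its sign along it.
\<close>
lemma det_gram_pos:
  fixes J :: "real^'k::finite^'n::finite"
  assumes "inj ((*v) J)"
  shows "0 < det (transpose J ** J)"
proof (rule ccontr)
  assume neg: "\<not> 0 < det (transpose J ** J)"
  define B where "B s = (1 - s) *\<^sub>R mat 1 + s *\<^sub>R (transpose J ** J)" for s :: real
  have "continuous_on {0..1} (\<lambda>s. det (B s))"
    unfolding B_def by (intro continuous_on_det) (auto intro!: continuous_intros)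
  moreover have "det (B 0) = 1" "det (B 1) \<le> 0" using neg by (simp_all add: B_def)
  ultimately obtain s where s: "0 \<le> s" "s \<le> 1" "det (B s) = 0"
    using IVT2'[of "\<lambda>s. det (B s)" 1 0 0] by auto
  then have "\<not> invertible (B s)" by (simp add: invertible_det_nz)
  then obtain v where v: "v \<noteq> 0" "B s *v v = 0"
    unfolding invertible_left_inverse matrix_left_invertible_ker by blast
  have "J *v v \<noteq> 0" using assms v(1) by (metis injD matrix_vector_mult_0_right)
  have "B s *v v = (1 - s) *\<^sub>R v + s *\<^sub>R (transpose J *v (J *v v))"
    by (simp add: B_def matrix_vector_mult_add_rdistrib scaleR_matrix_vector_assoc[symmetric] matrix_vector_mul_assoc)
  then have "0 = v \<bullet> ((1 - s) *\<^sub>R v + s *\<^sub>R (transpose J *v (J *v v)))" using v(2) by simp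
  also have "\<dots> = (1 - s) * (v \<bullet> v) + s * ((J *v v) \<bullet> (J *v v))"
    unfolding transpose_matrix_vector inner_add_right inner_scaleR_right
    by (simp only: inner_commute[of v "(J *v v) v* J"] dot_lmul_matrix)
  finally have z: "(1 - s) * (v \<bullet> v) + s * ((J *v v) \<bullet> (J *v v)) = 0" by simp
  have p: "0 < v \<bullet> v" "0 < (J *v v) \<bullet> (J *v v)" using v(1) \<open>J *v v \<noteq> 0\<close> by simp_all
  show False
  proof (cases "s = 1")
    case False
    then have "0 < (1 - s) * (v \<bullet> v)" using s p by simp
    moreover have "0 \<le> s * ((J *v v) \<bullet> (J *v v))" using s p by simp
    ultimately show False using z by linarith
  qed (use z p in auto)
qed

lemma not_null_in_affine_graph:
  fixes A :: "real^'m::finite^('d::finite option)"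
  shows "\<not> null_in TYPE('d) (affine_graph A) (affine_graph A)"
proof
  assume null: "null_in TYPE('d) (affine_graph A) (affine_graph A)"
  define J where "J = matrix (graph_direction A)"
  have "{u \<in> UNIV. graph_point A u \<in> affine_graph A} \<in> null_sets (coordinate_volume UNIV (graph_point A))"
    using null local_parametrization_graph_point[of A] unfolding null_in_def by blast
  then have "AE u in lebesgue_on UNIV. (let J = matrix (frechet_derivative (graph_point A) (at u)) in ennreal (sqrt (det (transpose J ** J)))) = 0"
    unfolding coordinate_volume_def null_sets_density_iff[OF borel_measurable_volume_density[OF local_parametrization_graph_point]]
    by (simp add: affine_graph_eq_range)
  moreover have "frechet_derivative (graph_point A) (at u) = graph_direction A" for u
    using frechet_derivative_at[OF graph_point_has_derivative] by metis
  ultimately have AE_zero: "AE u::real^'d in lebesgue. ennreal (sqrt (det (transpose J ** J))) = 0"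
    unfolding J_def Let_def by (simp only: lebesgue_on_UNIV_eq)
  have "0 < det (transpose J ** J)"
  proof (rule det_gram_pos)
    have "(*v) J = graph_direction A"
      unfolding J_def using matrix_vector_mul(2)[OF linear_graph_direction] .
    then show "inj ((*v) J)" using inj_graph_direction by simp
  qed
  then have nz: "ennreal (sqrt (det (transpose J ** J))) \<noteq> 0" by (simp add: ennreal_eq_0_iff)
  obtain N where N: "{u \<in> space lebesgue. \<not> ennreal (sqrt (det (transpose J ** J))) = 0} \<subseteq> (N :: (real^'d) set)"
    "emeasure lebesgue N = 0" "N \<in> sets lebesgue"
    using AE_E[OF AE_zero] by blast
  have "N = UNIV" using N(1) nz by auto
  then have "negligible (UNIV :: (real^'d) set)"
    using N(2,3) by (simp only: negligible_iff_null_sets null_sets_def mem_Collect_eq)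
  then show False by simp
qed

section \<open>Affine subspaces of Khintchine type\<close>

lemma khintchine_type_if_small_exponent:
  fixes A :: "real^'m::finite^('d::finite option)"
  assumes "dioph_exponent A < ereal (real (CARD('d) + CARD('m)))"
  shows "khintchine_type TYPE('d) (affine_graph A)"
proof -
  have "real CARD('m) < real (CARD('d) + CARD('m))" by simp
  from dioph_exponent_less_imp_kernel_gap[OF assms this]
  obtain w c where w: "real CARD('m) < w" "w < real (CARD('d) + CARD('m))" and c: "0 < c"
    and gap: "kernel_gap A c w" by blast
  have w0: "0 < w" using w(1) by (rule le_less_trans[rotated]) simp
  show ?thesis
    unfolding khintchine_type_def
  proof (intro conjI allI impI submanifold_affine_graph)
    fix \<psi> :: "nat \<Rightarrow> real"
    assume "approx_function \<psi> \<and> antimono_on {1..} \<psi>"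
    then have \<psi>: "\<And>q. 1 \<le> q \<Longrightarrow> 0 \<le> \<psi> q" "antimono_on {1..} \<psi>" by (auto simp: approx_function_def)
    show "null_in TYPE('d) (affine_graph A) (psi_approximable \<psi> \<inter> affine_graph A)"
      if "summable (\<lambda>q. \<psi> (Suc q) ^ CARD('d + 'm))"
      using khintchine_convergence[OF c w0 w(2) gap \<psi> that]
      by (intro null_in_affine_graph_if_negligible) (simp add: affine_graph_eq_range)
    show "null_in TYPE('d) (affine_graph A) (affine_graph A - psi_approximable \<psi>)"
      if "\<not> summable (\<lambda>q. \<psi> (Suc q) ^ CARD('d + 'm))"
      using khintchine_divergence[OF c less_imp_le[OF w(1)] w(2) gap \<psi> that]
      by (intro null_in_affine_graph_if_negligible) (simp add: affine_graph_eq_range)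
  qed
qed

lemma not_khintchine_type_if_large_exponent:
  fixes A :: "real^'m::finite^('d::finite option)"
  assumes "ereal (real (CARD('d) + CARD('m))) < dioph_exponent A"
  shows "\<not> khintchine_type TYPE('d) (affine_graph A)"
proof
  let ?n = "CARD('d) + CARD('m)"
  assume K: "khintchine_type TYPE('d) (affine_graph A)"
  obtain w where w: "real ?n < w" "infinite {q \<in> int_vectors. int_dist (A *v q) < infnorm q powr (- w)}"
    using assms unfolding dioph_exponent_def less_Sup_iff by auto
  obtain \<gamma> where \<gamma>: "0 < \<gamma>" "1 < real ?n * \<gamma>"
    and all: "\<And>x. graph_point A x \<in> psi_approximable (\<lambda>q. real q powr (- \<gamma>))"
    using approximable_if_large_exponent[OF w] by blast
  let ?\<psi> = "\<lambda>q::nat. real q powr (- \<gamma>)"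
  have "approx_function ?\<psi>" by (simp add: approx_function_def)
  moreover have "antimono_on {1..} ?\<psi>"
    using \<gamma>(1) by (auto simp: monotone_on_def intro!: powr_mono2')
  moreover have "summable (\<lambda>q. ?\<psi> (Suc q) ^ CARD('d + 'm))"
  proof -
    have "?\<psi> (Suc q) ^ CARD('d + 'm) = real (Suc q) powr (- (real ?n * \<gamma>))" for q
      by (subst powr_realpow[symmetric]) (simp_all add: powr_powr mult.commute)
    moreover have "summable (\<lambda>q. real (Suc q) powr (- (real ?n * \<gamma>)))"
      using summable_real_powr_iff[of "- (real ?n * \<gamma>)"] \<gamma>(2)
      by (subst summable_Suc_iff[of "\<lambda>q. real q powr (- (real ?n * \<gamma>))"]) simp
    ultimately show ?thesis by (simp only:)
  qed
  ultimately have "null_in TYPE('d) (affine_graph A) (psi_approximable ?\<psi> \<inter> affine_graph A)"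
    using K unfolding khintchine_type_def by blast
  moreover have "psi_approximable ?\<psi> \<inter> affine_graph A = affine_graph A"
    using all by (auto simp: affine_graph_eq_range)
  ultimately show False using not_null_in_affine_graph[of A] by simp
qed

theorem theorem2p1:
  fixes A :: "real^'m::finite^('d::finite option)"
  assumes "dioph_exponent A \<noteq> ereal (real (CARD('d) + CARD('m)))"
  shows "khintchine_type TYPE('d) (affine_graph A) \<longleftrightarrow>
           dioph_exponent A < ereal (real (CARD('d) + CARD('m)))"
  using assms khintchine_type_if_small_exponent[of A] not_khintchine_type_if_large_exponent[of A]
  by (meson linorder_neqE)

end
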